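(* There exists a constant $C$ such that for any $w,s,\delta>0$ (and $\varepsilon>0$) and all $p$ such that $$p\le\frac{\delta}{(w\log(1/\varepsilon))^{C\log w}},$$ there is a $p$-regular distribution $\mathcal D$ on $2^{[n]}$ that can be sampled efficiently using $r$ random bits, where $$r=r(n,s,\varepsilon,\delta)=O\Big((\log w)\cdot\big(\log n+s\log(1/\delta)\big)+w\log\big(w\log(1/\varepsilon)\big)\Big),$$ such that the indicator events $\mathsf 1\{i\in L\}$ (for $L\leftarrow\mathcal D$) are $p$-biased and the following holds: for any width-$w$ DNF formula $f:\{0,1\}^n\to\{0,1\}$ and $\rho\leftarrow\mathcal D$, $$\Pr\big[f_\rho\text{ does not have }\varepsilon\text{-sandwiching approximators that are width-}s\text{ DNF formulae}\big]<\varepsilon+\delta^{s/4}.$$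
   Context: A DNF formula is an OR of terms, each term being an AND of literals; it has width $w$ if every term has at most $w$ literals. Functions $g_\ell,g_u$ are $\varepsilon$-sandwiching approximators for a Boolean function $g$ if $g_\ell\le g\le g_u$ pointwise and each of $g_\ell,g_u$ differs from $g$ with probability at most $\varepsilon$ on a uniformly random input. Restrictions: for $L\subseteq[n]$ and $x\in\{0,1\}^{[n]\setminus L}$, the restriction $\rho=\rho_{L,x}\in\{*,0,1\}^n$ has $\rho_i=*$ if $i\in L$ and $\rho_i=x_i$ otherwise; $L(\rho)=L$ is the set of live variables. For $f:\{0,1\}^n\to\{0,1\}$, the function $f_\rho:\{0,1\}^{L(\rho)}\to\{0,1\}$ is $f_\rho(y)=f(z)$ with $z_i=y_i$ for $i\in L(\rho)$ and $z_i=\rho_i$ otherwise. For a distribution $\mathcal D$ on $2^{[n]}$ (the subsets of $[n]$), $\rho\leftarrow\mathcal D$ means $\rho=\rho_{L,x}$ with $L\leftarrow\mathcal D$ and $x$ uniform in $\{0,1\}^{[n]\setminus L}$. $\mathcal D$ is $p$-regular if $\Pr_{L\leftarrow\mathcal D}[i\in L]=p$ for every $i\in[n]$; likewise the indicator events are $p$-biased if each has probability $p$. The $r$ random bits are those used to sample $L\leftarrow\mathcal D$.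
   Formalization: Restricted to ε ≤ 1/2 (the claim fails as ε tends to 1), to p = m/2^k with k = O(the bound on r) for any fixed constant (r uniform bits give only multiples of 2^-r), and to parameters for which the expression bounding r is nonnegative. *)

theory Defs
  imports "HOL-Probability.Probability"
begin

section \<open>DNF formulae on Boolean cubes\<close>

text \<open>The ground set of variables is \<open>{..<n}\<close>.  For a set \<open>I\<close> of variables, \<open>cube I\<close> is
  the Boolean cube with coordinates in \<open>I\<close>.\<close>

definition cube :: "nat set \<Rightarrow> (nat \<Rightarrow> bool) set" where
  "cube I = (I \<rightarrow>\<^sub>E UNIV)"

definition unif :: "nat set \<Rightarrow> (nat \<Rightarrow> bool) pmf" where
  "unif I = pmf_of_set (cube I)"

text \<open>The literal \<open>(i, b)\<close> is satisfied by \<open>x\<close> iff \<open>x i = b\<close>; a term is a set of literals and a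
  DNF formula is a set of terms.  The empty formula is the constant 0, a formula containing the
  empty term is the constant 1.\<close>

type_synonym literal = "nat \<times> bool"
type_synonym dnf = "literal set set"

definition eval_dnf :: "dnf \<Rightarrow> (nat \<Rightarrow> bool) \<Rightarrow> bool" where
  "eval_dnf F x \<longleftrightarrow> (\<exists>T\<in>F. \<forall>(i, b)\<in>T. x i = b)"

definition width_dnf :: "nat set \<Rightarrow> nat \<Rightarrow> dnf \<Rightarrow> bool" where
  "width_dnf I w F \<longleftrightarrow>
     finite F \<and> (\<forall>T\<in>F. finite T \<and> T \<subseteq> I \<times> UNIV \<and> card T \<le> w)"

definition sandwiching ::
  "nat set \<Rightarrow> real \<Rightarrow> ((nat \<Rightarrow> bool) \<Rightarrow> bool) \<Rightarrow> ((nat \<Rightarrow> bool) \<Rightarrow> bool) \<Rightarrow> ((nat \<Rightarrow> bool) \<Rightarrow> bool) \<Rightarrow> bool"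
  where
  "sandwiching I \<epsilon> g gl gu \<longleftrightarrow>
     (\<forall>y\<in>cube I. gl y \<le> g y \<and> g y \<le> gu y) \<and>
     measure_pmf.prob (unif I) {y. gl y \<noteq> g y} \<le> \<epsilon> \<and>
     measure_pmf.prob (unif I) {y. gu y \<noteq> g y} \<le> \<epsilon>"

definition has_dnf_sandwich ::
  "nat set \<Rightarrow> real \<Rightarrow> nat \<Rightarrow> ((nat \<Rightarrow> bool) \<Rightarrow> bool) \<Rightarrow> bool" where
  "has_dnf_sandwich I \<epsilon> s g \<longleftrightarrow>
     (\<exists>Gl Gu. width_dnf I s Gl \<and> width_dnf I s Gu \<and>
        sandwiching I \<epsilon> g (eval_dnf Gl) (eval_dnf Gu))"

section \<open>Restrictions\<close>

text \<open>A restriction maps a variable to \<open>None\<close> (the symbol \<open>*\<close>) or to \<open>Some\<close> of a bit.\<close>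

type_synonym restriction = "nat \<Rightarrow> bool option"

definition mk_restriction :: "nat set \<Rightarrow> (nat \<Rightarrow> bool) \<Rightarrow> restriction" where
  "mk_restriction L x = (\<lambda>i. if i \<in> L then None else Some (x i))"

definition live :: "nat \<Rightarrow> restriction \<Rightarrow> nat set" where
  "live n \<rho> = {i. i < n \<and> \<rho> i = None}"

definition restrict_fun ::
  "nat \<Rightarrow> restriction \<Rightarrow> ((nat \<Rightarrow> bool) \<Rightarrow> bool) \<Rightarrow> (nat \<Rightarrow> bool) \<Rightarrow> bool" where
  "restrict_fun n \<rho> f y = f (\<lambda>i\<in>{..<n}. case \<rho> i of None \<Rightarrow> y i | Some b \<Rightarrow> b)"

definition random_restriction :: "nat \<Rightarrow> nat set pmf \<Rightarrow> restriction pmf" where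
  "random_restriction n D =
     bind_pmf D (\<lambda>L. map_pmf (mk_restriction L) (unif ({..<n} - L)))"

definition p_biased :: "'a pmf \<Rightarrow> real \<Rightarrow> ('a \<Rightarrow> bool) \<Rightarrow> bool" where
  "p_biased D p E \<longleftrightarrow> measure_pmf.prob D {\<omega>. E \<omega>} = p"

definition p_regular :: "nat \<Rightarrow> real \<Rightarrow> nat set pmf \<Rightarrow> bool" where
  "p_regular n p D \<longleftrightarrow> (\<forall>i<n. measure_pmf.prob D {L. i \<in> L} = p)"

section \<open>Efficient sampling\<close>

text \<open>Efficient means polynomial time on a random access machine, programmed in a structured
  while language.  The machine has registers and a memory, both holding natural numbers, and every
  operation and test has unit cost.  As addition and truncated subtraction are the only arithmetic
  operations, a step makes the largest number in the state at most one bit longer (up to the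
  constants in the program), so polynomial time here agrees with polynomial time on Turing
  machines.\<close>

datatype com =
    SetC nat nat        \<comment> \<open>\<open>reg i := c\<close>\<close>
  | Add nat nat nat     \<comment> \<open>\<open>reg i := reg j + reg k\<close>\<close>
  | Sub nat nat nat     \<comment> \<open>\<open>reg i := reg j - reg k\<close>, truncated\<close>
  | Load nat nat        \<comment> \<open>\<open>reg i := mem (reg j)\<close>\<close>
  | Store nat nat       \<comment> \<open>\<open>mem (reg i) := reg j\<close>\<close>
  | Seq com com
  | Ite nat com com     \<comment> \<open>branch on \<open>reg i \<noteq> 0\<close>\<close>
  | While nat com       \<comment> \<open>loop as long as \<open>reg i \<noteq> 0\<close>\<close>

type_synonym state = "(nat \<Rightarrow> nat) \<times> (nat \<Rightarrow> nat)"

text \<open>\<open>exec P st t st'\<close>: started in \<open>st = (registers, memory)\<close>, the program \<open>P\<close> halts in \<open>st'\<close>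
  after exactly \<open>t\<close> steps.\<close>

inductive exec :: "com \<Rightarrow> state \<Rightarrow> nat \<Rightarrow> state \<Rightarrow> bool" where
  SetC: "exec (SetC i c) (R, M) 1 (R(i := c), M)"
| Add: "exec (Add i j k) (R, M) 1 (R(i := R j + R k), M)"
| Sub: "exec (Sub i j k) (R, M) 1 (R(i := R j - R k), M)"
| Load: "exec (Load i j) (R, M) 1 (R(i := M (R j)), M)"
| Store: "exec (Store i j) (R, M) 1 (R, M(R i := R j))"
| Seq: "exec P st t st' \<Longrightarrow> exec Q st' t' st'' \<Longrightarrow> exec (Seq P Q) st (t + t') st''"
| IteT: "fst st i \<noteq> 0 \<Longrightarrow> exec P st t st' \<Longrightarrow> exec (Ite i P Q) st (t + 1) st'"
| IteF: "fst st i = 0 \<Longrightarrow> exec Q st t st' \<Longrightarrow> exec (Ite i P Q) st (t + 1) st'"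
| WhileF: "fst st i = 0 \<Longrightarrow> exec (While i P) st 1 st"
| WhileT: "fst st i \<noteq> 0 \<Longrightarrow> exec P st t st' \<Longrightarrow> exec (While i P) st' t' st'' \<Longrightarrow>
    exec (While i P) st (t + t' + 1) st''"

text \<open>The parameters are given in the first registers and the random bits in the first
  memory cells; everything else is 0.\<close>

definition init_state :: "nat list \<Rightarrow> bool list \<Rightarrow> state" where
  "init_state ps \<sigma> =
     (\<lambda>i. if i < length ps then ps ! i else 0,
      \<lambda>j. if j < length \<sigma> then of_bool (\<sigma> ! j) else 0)"

definition output_set :: "nat \<Rightarrow> state \<Rightarrow> nat set" where
  "output_set n st = {i. i < n \<and> snd st i \<noteq> 0}"

text \<open>\<open>samples P c ps n r D\<close>: on parameters \<open>ps\<close> and \<open>r\<close> uniform random bits, \<open>P\<close> outputs a subset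
  of \<open>{..<n}\<close> with distribution \<open>D\<close>, in time at most \<open>(n + r + 2) ^ c\<close>.  Requiring this with one
  \<open>P\<close> and one \<open>c\<close> for a whole family of parameters expresses sampling in time
  polynomial in \<open>n\<close> and \<open>r\<close>; as the base is at least 2, the exponent \<open>c\<close> also absorbs constant
  factors.\<close>

definition samples :: "com \<Rightarrow> nat \<Rightarrow> nat list \<Rightarrow> nat \<Rightarrow> nat \<Rightarrow> nat set pmf \<Rightarrow> bool" where
  "samples P c ps n r D \<longleftrightarrow>
     (\<exists>out :: bool list \<Rightarrow> nat set.
        (\<forall>\<sigma>. length \<sigma> = r \<longrightarrow>
           (\<exists>t st. exec P (init_state ps \<sigma>) t st \<and> t \<le> (n + r + 2) ^ c \<and>
              out \<sigma> = output_set n st)) \<and>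
        D = map_pmf out (pmf_of_set {\<sigma>. length \<sigma> = r}))"

text \<open>What the sampler is told.  A machine cannot read the reals \<open>\<epsilon>\<close>, \<open>\<delta>\<close>; it gets
  \<open>log (1/\<epsilon>)\<close> and \<open>log (1/\<delta>)\<close> rounded up, i.e. \<open>\<epsilon>\<close> and \<open>\<delta>\<close> rounded down to powers of two
  (with \<open>\<delta> \<ge> 1\<close> represented by 0).  The probability \<open>p = m / 2 ^ k\<close> is given exactly.\<close>

definition sampler_params ::
  "nat \<Rightarrow> nat \<Rightarrow> nat \<Rightarrow> real \<Rightarrow> real \<Rightarrow> nat \<Rightarrow> nat \<Rightarrow> nat \<Rightarrow> nat list" where
  "sampler_params n w s \<epsilon> \<delta> m k r =
     [n, w, s, nat \<lceil>log 2 (1 / \<epsilon>)\<rceil>, nat \<lceil>log 2 (1 / \<delta>)\<rceil>, m, k, r]"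

text \<open>The expression inside the \<open>O(\<dots>)\<close> that bounds the number of random bits.\<close>

definition seed_bound :: "nat \<Rightarrow> nat \<Rightarrow> nat \<Rightarrow> real \<Rightarrow> real \<Rightarrow> real" where
  "seed_bound n w s \<epsilon> \<delta> =
     log 2 (real w) * (log 2 (real n) + real s * log 2 (1 / \<delta>))
     + real w * log 2 (real w * log 2 (1 / \<epsilon>))"

text \<open>Two conventions on parameters used with \<open>seed_bound\<close>.  (1) A \<open>p\<close>-regular distribution
  sampled from \<open>r\<close> uniform bits exists only if \<open>p\<close> is a multiple of \<open>1 / 2 ^ r\<close>, so with
  \<open>r = O(seed_bound)\<close> only numbers \<open>p = m / 2 ^ k\<close> with \<open>k = O(seed_bound)\<close> can occur; the constant
  \<open>A\<close> of this \<open>O\<close> is arbitrary.  (2) For large \<open>\<delta> > 1\<close> the expression \<open>seed_bound\<close> is negative and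
  then no \<open>r\<close> at all satisfies the bound.\<close>

definition admissible_prob :: "real \<Rightarrow> real \<Rightarrow> real \<Rightarrow> nat \<Rightarrow> nat \<Rightarrow> bool" where
  "admissible_prob A B p m k \<longleftrightarrow> p = real m / 2 ^ k \<and> p \<le> 1 \<and> real k \<le> A * B"

end

theory Submission
  imports Defs "HOL-Library.Z2" "HOL-Computational_Algebra.Polynomial"
begin

text \<open>The live set \<open>L\<close> is an intersection of \<open>J\<close> independent random sets, with \<open>s * 2 ^ J\<close> about \<open>w\<close>,
  and of a coin that corrects the probability to exactly \<open>p\<close>.  One of these sets halves the width of
  a DNF: a DNF \<open>f\<close> of width \<open>2 * t\<close> is first sandwiched between DNFs of the same width that have few
  terms, uniformly in the size of \<open>f\<close>.  By a union bound all terms of these DNFs keep at most \<open>t\<close>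
  live literals, for which it suffices that the events \<open>i \<in> L\<close> are nearly \<open>t\<close>-wise independent;
  Markov's inequality controls the sandwiching error after the restriction.

  The few terms come from a spread lemma.  Call a term good if, up to a tiny error, it implies a small
  part of \<open>f\<close>.  The minimal good terms form the upper approximator and the corresponding parts of \<open>f\<close>
  the lower one.  If there were too many minimal good terms of size \<open>k\<close>, then a maximal core contained
  in too many of them would leave a spread family, which is satisfied with high probability, so that the core
  itself would be good.

  The nearly independent bits are inner products of a random vector with the powers of a random element of
  \<open>GF(2)[X] / (X ^ N - 1)\<close>.  For \<open>N = 3 ^ (k + 1)\<close> this ring has a residue field of size at least
  \<open>2 ^ (2 * 3 ^ k)\<close>, so the sampler needs no search for an irreducible polynomial.\<close>

section \<open>Nearly independent bits from powers of a polynomial\<close>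

text \<open>A width-w DNF may have about n ^ w terms. A union bound over them would force about
  \<open>log n\<close> random bits per variable in each stage, and then p would have to shrink with
  n. The sparse approximators have a number of terms that depends only on w and \<epsilon>. Stage j
  treats width \<open>2 * t\<close> with \<open>t = s * 2 ^ j\<close> and spends \<open>a j\<close>
  bits per variable. Of these, \<open>48 * \<beta>\<close> pay for the union bound. As \<beta> is
  about log (w log (1/\<epsilon>)) and there are O(log w) stages, this is the origin of the exponent
  C log w. The other bits, about \<open>dlt / (4 * 2 ^ j)\<close>, count t times because t live
  literals are needed, which yields \<open>\<delta> powr (s / 4)\<close> in every stage; over the
  stages they form a geometric series, so they cost p no more than one factor \<delta>. Likewise N
  is of the order \<open>log n + t * a j\<close>, and the terms \<open>t * \<beta>\<close> add up to
  about w times \<beta> in the seed length. Each step has to treat a lower and an upper formula, so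
  failure probabilities double from stage to stage; \<open>2 ^ J < 2 * w\<close> keeps this
  affordable.\<close>

definition bpset :: "nat \<Rightarrow> bit poly set" where
  "bpset m = {p. \<forall>i\<ge>m. coeff p i = 0}"

lemma coeff_sum_monom_set:
  fixes A :: "nat set"
  assumes "finite A"
  shows "coeff (\<Sum>i\<in>A. monom (1::bit) i) j = of_bool (j \<in> A)"
  using assms by (simp add: coeff_sum)

lemma bij_betw_bpset:
  "bij_betw (\<lambda>A. \<Sum>i\<in>A. monom (1::bit) i) (Pow {..<m}) (bpset m)"
proof (rule bij_betw_imageI)
  show "inj_on (\<lambda>A. \<Sum>i\<in>A. monom (1::bit) i) (Pow {..<m})"
  proof (rule inj_onI)
    fix A B assume *: "A \<in> Pow {..<m}" "B \<in> Pow {..<m}"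
      "(\<Sum>i\<in>A. monom (1::bit) i) = (\<Sum>i\<in>B. monom (1::bit) i)"
    then have fin: "finite A" "finite B" by (auto intro: finite_subset)
    have "(j \<in> A) = (j \<in> B)" for j
      using arg_cong[OF *(3), of "\<lambda>p. coeff p j"] coeff_sum_monom_set[OF fin(1), of j]
        coeff_sum_monom_set[OF fin(2), of j] by (auto split: if_splits)
    then show "A = B" by blast
  qed
  show "(\<lambda>A. \<Sum>i\<in>A. monom (1::bit) i) ` Pow {..<m} = bpset m"
  proof (intro equalityI subsetI)
    fix p assume "p \<in> (\<lambda>A. \<Sum>i\<in>A. monom (1::bit) i) ` Pow {..<m}"
    then obtain A where A: "A \<subseteq> {..<m}" "p = (\<Sum>i\<in>A. monom (1::bit) i)" by auto
    then have "finite A" by (auto intro: finite_subset)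
    then show "p \<in> bpset m" using A coeff_sum_monom_set[of A] by (auto simp: bpset_def)
  next
    fix p assume p: "p \<in> bpset m"
    let ?A = "{i. i < m \<and> coeff p i = 1}"
    have "p = (\<Sum>i\<in>?A. monom (1::bit) i)"
    proof (rule poly_eqI)
      fix j
      show "coeff p j = coeff (\<Sum>i\<in>?A. monom (1::bit) i) j"
        using p coeff_sum_monom_set[of ?A j]
        by (cases "j < m"; cases "coeff p j") (auto simp: bpset_def)
    qed
    then show "p \<in> (\<lambda>A. \<Sum>i\<in>A. monom (1::bit) i) ` Pow {..<m}" by blast
  qed
qed

lemma card_bpset: "card (bpset m) = 2 ^ m"
  using bij_betw_same_card[OF bij_betw_bpset[of m]] by (simp add: card_Pow)

lemma finite_bpset: "finite (bpset m)"
  using bij_betw_finite[OF bij_betw_bpset[of m]] by simp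

lemma bpset_iff_degree:
  assumes "m > 0"
  shows "p \<in> bpset m \<longleftrightarrow> degree p < m"
proof
  assume p: "p \<in> bpset m"
  have "degree p \<le> m - 1"
    using p assms by (intro degree_le) (auto simp: bpset_def)
  then show "degree p < m" using assms by simp
next
  assume "degree p < m"
  then show "p \<in> bpset m" by (auto simp: bpset_def coeff_eq_0)
qed

section \<open>Prime polynomials over GF(2)\<close>

text \<open>Euclid's property is the form in which primality is applied below; positive degree
  excludes zero and the unit 1.\<close>

definition bprime :: "bit poly \<Rightarrow> bool" where
  "bprime h \<longleftrightarrow> degree h > 0 \<and> (\<forall>a b. h dvd a * b \<longrightarrow> h dvd a \<or> h dvd b)"

text \<open>A divisor of least positive degree is prime by Bezout: an element of least degree in the
  ideal generated by \<open>a\<close> and \<open>h\<close> divides both, so it is 1 or equal to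
  \<open>h\<close>.\<close>

lemma ex_bprime_dvd:
  fixes P :: "bit poly"
  assumes "degree P > 0"
  shows "\<exists>h. bprime h \<and> h dvd P"
proof -
  let ?Q = "\<lambda>h. h dvd P \<and> degree h > 0"
  obtain h where h: "?Q h" and hmin: "\<And>g. ?Q g \<Longrightarrow> degree h \<le> degree g"
    using ex_has_least_nat[of ?Q P degree] assms by auto
  have "h dvd b" if ab: "h dvd a * b" and na: "\<not> h dvd a" for a b
  proof -
    let ?I = "\<lambda>g. g \<noteq> 0 \<and> (\<exists>u v. g = u * a + v * h)"
    have "h = 0 * a + 1 * h" by simp
    then have "?I h" using h by (metis degree_0 less_irrefl)
    then obtain g where g: "?I g" and gmin: "\<And>g'. ?I g' \<Longrightarrow> degree g \<le> degree g'"
      using ex_has_least_nat[of ?I h degree] by blast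
    obtain u v where uv: "g = u * a + v * h" using g by blast
    have gdvd: "g dvd c" if cI: "\<exists>u v. c = u * a + v * h" for c
    proof (rule ccontr)
      assume n: "\<not> g dvd c"
      obtain u' v' where c: "c = u' * a + v' * h" using cI by (elim exE)
      have "c mod g = c - (c div g) * g" by (simp add: minus_div_mult_eq_mod)
      also have "\<dots> = (u' - (c div g) * u) * a + (v' - (c div g) * v) * h"
        by (simp add: c uv algebra_simps del: minus_bit_def)
      finally have "\<exists>u v. c mod g = u * a + v * h" by blast
      moreover have "c mod g \<noteq> 0" using n by (simp add: mod_eq_0_iff_dvd)
      ultimately have "degree g \<le> degree (c mod g)" using gmin by blast
      then show False using degree_mod_less[of g c] \<open>c mod g \<noteq> 0\<close> g by simp
    qed
    have "a = 1 * a + 0 * h" "h = 0 * a + 1 * h" by simp_all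
    then have ga: "g dvd a" and gh: "g dvd h" using gdvd by blast+
    have "degree g = 0"
    proof (rule ccontr)
      assume "degree g \<noteq> 0"
      \<comment> \<open>By minimality of \<open>h\<close> the cofactor of \<open>g\<close> is
        constant, and 1 is the only non-zero constant over GF(2).\<close>
      then have "degree h \<le> degree g" using hmin[of g] gh h dvd_trans by blast
      obtain c where c: "h = g * c" using gh by blast
      have "c \<noteq> 0" "h \<noteq> 0" using c h by auto
      then have "degree h = degree g + degree c" using c g by (simp add: degree_mult_eq)
      then have "degree c = 0" using \<open>degree h \<le> degree g\<close> by simp
      then obtain d where "c = [:d:]" by (metis degree_eq_zeroE)
      then have "c = 1" using \<open>c \<noteq> 0\<close> by (cases d) (auto simp: one_pCons)
      then show False using c ga na by simp
    qed
    then obtain d where "g = [:d:]" by (metis degree_eq_zeroE)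
    then have "g = 1" using g by (cases d) (auto simp: one_pCons)
    then have "b = (u * a + v * h) * b" using uv by simp
    also have "\<dots> = u * (a * b) + h * (v * b)" by (simp only: algebra_simps)
    finally have "b = u * (a * b) + h * (v * b)" .
    then show "h dvd b" using ab by (metis dvd_add dvd_mult dvd_triv_left)
  qed
  then show ?thesis using h unfolding bprime_def by blast
qed

abbreviation XX :: "bit poly" where "XX \<equiv> monom 1 1"

text \<open>Fermat's argument modulo \<open>h\<close>: multiplication by X permutes the non-zero
  residues, so it preserves their product, and Euclid's property allows this product to be
  cancelled. The quotient field is never built; residues are the polynomials of degree below
  \<open>degree h\<close>.\<close>

lemma bprime_fermat:
  assumes h: "bprime h" and nX: "\<not> h dvd XX"
  shows "h dvd XX ^ (2 ^ degree h - 1) - 1"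
proof -
  let ?d = "degree h"
  let ?R = "bpset ?d - {0}"
  have d0: "?d > 0" and h0: "h \<noteq> 0" using h by (auto simp: bprime_def)
  have fin: "finite ?R" using finite_bpset by auto
  have cR: "card ?R = 2 ^ ?d - 1" using card_bpset[of ?d] finite_bpset[of ?d]
    by (subst card_Diff_singleton) (auto simp: bpset_def)
  have R: "r \<in> ?R \<longleftrightarrow> r \<noteq> 0 \<and> degree r < ?d" for r using bpset_iff_degree[OF d0] by auto
  have ndvd: "\<not> h dvd r" if "r \<in> ?R" for r
    using that R dvd_imp_degree_le by (metis not_less)
  let ?f = "\<lambda>r. (XX * r) mod h"
  have fR: "?f r \<in> ?R" if "r \<in> ?R" for r
  proof -
    have "\<not> h dvd XX * r" using h nX ndvd[OF that] unfolding bprime_def by blast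
    then have "?f r \<noteq> 0" by (simp add: mod_eq_0_iff_dvd)
    then show ?thesis using R degree_mod_less[of h "XX * r"] h0 by blast
  qed
  have inj: "inj_on ?f ?R"
  proof (rule inj_onI)
    fix r s assume rs: "r \<in> ?R" "s \<in> ?R" "?f r = ?f s"
    then have "h dvd XX * r - XX * s" by (simp add: mod_eq_dvd_iff)
    then have "h dvd XX * (r - s)" by (simp only: right_diff_distrib)
    then have *: "h dvd r - s" using h nX unfolding bprime_def by blast
    show "r = s"
    proof (rule ccontr)
      assume "r \<noteq> s"
      then have "degree h \<le> degree (r - s)" using * dvd_imp_degree_le by (metis eq_iff_diff_eq_0)
      moreover have "degree (r - s) < ?d" using rs R degree_diff_less by metis
      ultimately show False by simp
    qed
  qed
  have im: "?f ` ?R = ?R" by (rule endo_inj_surj[OF fin _ inj]) (rule image_subsetI, rule fR)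
  have "(\<Prod>r\<in>?R. r) = (\<Prod>r\<in>?R. ?f r)"
    using prod.reindex[OF inj, of "\<lambda>r. r"] unfolding im o_def .
  then have "(\<Prod>r\<in>?R. r) mod h = (\<Prod>r\<in>?R. XX * r) mod h" by (simp only: mod_prod_eq)
  also have "(\<Prod>r\<in>?R. XX * r) = XX ^ (2 ^ ?d - 1) * (\<Prod>r\<in>?R. r)"
    by (simp only: prod.distrib prod_constant cR)
  finally have "h dvd XX ^ (2 ^ ?d - 1) * (\<Prod>r\<in>?R. r) - (\<Prod>r\<in>?R. r)"
    by (metis mod_eq_dvd_iff)
  then have "h dvd (XX ^ (2 ^ ?d - 1) - 1) * (\<Prod>r\<in>?R. r)" by (simp only: left_diff_distrib mult_1)
  moreover have "\<not> h dvd (\<Prod>r\<in>A. r)" if "A \<subseteq> ?R" for A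
    using finite_subset[OF that fin] that
  proof (induction A rule: finite_induct)
    case empty
    then show ?case using d0 h0 by (metis dvd_imp_degree_le degree_1 leD one_neq_zero prod.empty)
  next
    case (insert x F)
    then show ?case using h ndvd[of x] unfolding bprime_def by (metis insert_subset prod.insert)
  qed
  ultimately show ?thesis using h unfolding bprime_def by blast
qed

text \<open>Euclid's algorithm in the exponents: modulo \<open>XX ^ k - 1\<close> the exponent m may
  be reduced to \<open>m mod k\<close>.\<close>

lemma dvd_power_gcd:
  assumes "h dvd XX ^ m - 1" "h dvd XX ^ k - 1" "\<not> h dvd XX" "bprime h"
  shows "h dvd XX ^ gcd m k - 1"
  using assms(1,2)
proof (induction m k rule: gcd_nat_induct)
  case (base m)
  then show ?case by simp
next
  case (step m k)
  have e: "XX ^ m - 1 = XX ^ (m mod k) * (XX ^ (k * (m div k)) - 1) + (XX ^ (m mod k) - 1)"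
  proof -
    have "XX ^ m = XX ^ (m mod k) * XX ^ (k * (m div k))" by (metis mod_mult_div_eq power_add)
    then show ?thesis by (simp only: right_diff_distrib mult_1_right) simp
  qed
  have "XX ^ k - 1 dvd (XX ^ k) ^ (m div k) - 1"
    by (metis dvd_triv_left power_diff_1_eq)
  then have "h dvd XX ^ (k * (m div k)) - 1"
    using dvd_trans[OF step.prems(2)] unfolding power_mult by blast
  then have "h dvd XX ^ (m mod k) - 1"
    using step.prems(1) unfolding e by (subst (asm) dvd_add_right_iff) (rule dvd_mult)
  then show ?case using step.IH step.prems by (simp add: gcd_red_nat[symmetric])
qed

text \<open>Lifting the exponent at 3: \<open>4 ^ (3 ^ k)\<close> is 1 modulo
  \<open>3 ^ Suc k\<close> but not modulo \<open>3 ^ Suc (Suc k)\<close>, so every further factor 3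
  of \<open>4 ^ e - 1\<close> requires a further factor 3 of e.\<close>

lemma three_pow_dvd:
  fixes k :: nat and e :: nat
  assumes "3 ^ Suc k dvd (4::nat) ^ e - 1"
  shows "3 ^ k dvd e"
  using assms
proof (induction k arbitrary: e)
  case 0
  then show ?case by simp
next
  case (Suc k)
  have "3 ^ Suc k dvd (4::nat) ^ e - 1" using Suc.prems by (metis dvd_trans le_imp_power_dvd lessI less_imp_le_nat)
  then have "3 ^ k dvd e" by (rule Suc.IH)
  then obtain f where f: "e = 3 ^ k * f" by blast
  have lte: "\<exists>q. (4::int) ^ (3 ^ k) = 1 + 3 ^ Suc k * (1 + 3 * q)"
  proof (induction k)
    case 0
    then show ?case by (auto intro!: exI[of _ 0])
  next
    case (Suc k)
    then obtain q where q: "(4::int) ^ (3 ^ k) = 1 + 3 ^ Suc k * (1 + 3 * q)" by blast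
    let ?a = "1 + 3 * q" and ?t = "(3::int) ^ k"
    have "(4::int) ^ (3 ^ Suc k) = (4 ^ (3 ^ k)) ^ 3" by (simp only: power_mult[symmetric] power_Suc2)
    also have "\<dots> = 1 + 3 ^ Suc (Suc k) * (1 + 3 * (q + ?t * ?a^2 + ?t^2 * ?a^3))"
      unfolding q by (simp add: power3_eq_cube power2_eq_square algebra_simps)
    finally show ?case by blast
  qed
  then obtain q where q: "(4::int) ^ (3 ^ k) = 1 + 3 ^ Suc k * (1 + 3 * q)" by blast
  let ?b = "3 ^ Suc k * (1 + 3 * q)"
  \<comment> \<open>The binomial expansion up to second order suffices, as \<open>?b * ?b\<close>
    has at least one factor 3 more than the power of 3 in \<open>?b\<close>.\<close>
  have "\<exists>r. (1 + ?b) ^ f = 1 + int f * ?b + ?b * ?b * r"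
  proof (induction f)
    case 0
    then show ?case by (auto intro!: exI[of _ 0])
  next
    case (Suc f)
    then obtain r where "(1 + ?b) ^ f = 1 + int f * ?b + ?b * ?b * r" by blast
    then have "(1 + ?b) ^ Suc f = 1 + int (Suc f) * ?b + ?b * ?b * (int f + r + ?b * r)"
      by (simp add: algebra_simps)
    then show ?case by blast
  qed
  then obtain r where r: "(1 + ?b) ^ f = 1 + int f * ?b + ?b * ?b * r" by blast
  have "int (4 ^ e - 1) = 4 ^ e - 1" by (simp add: of_nat_diff)
  also have "\<dots> = (1 + ?b) ^ f - 1" unfolding f power_mult q ..
  also have "\<dots> = 3 ^ Suc k * (int f + 3 * (int f * q + 3 ^ k * (1+3*q)^2 * r))"
    unfolding r by (simp add: algebra_simps power2_eq_square)
  finally have "int (4 ^ e - 1) = 3 ^ Suc k * (int f + 3 * (int f * q + 3 ^ k * (1+3*q)^2 * r))" .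
  moreover have "int (3 ^ Suc (Suc k)) dvd int (4 ^ e - 1)" using Suc.prems by (metis int_dvd_int_iff)
  ultimately have "(3::int) ^ Suc k * 3 dvd 3 ^ Suc k * (int f + 3 * (int f * q + 3 ^ k * (1+3*q)^2 * r))"
    by (simp add: mult.commute)
  then have "3 dvd int f + 3 * (int f * q + 3 ^ k * (1+3*q)^2 * r)"
    by (subst (asm) dvd_mult_cancel_left) auto
  then have "3 dvd int f" by (metis dvd_add_left_iff dvd_triv_left)
  then have "3 dvd f" by presburger
  then show ?case using f by (auto simp: mult.assoc mult.left_commute)
qed

text \<open>The order of 4 modulo \<open>3 ^ Suc k\<close> is \<open>3 ^ k\<close>; this forces the degree of a prime factor of
  \<open>Y ^ 2 + Y + 1 = (Y ^ 3 - 1) / (Y - 1)\<close>, where \<open>Y = X ^ (3 ^ k)\<close>, to be large.\<close>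

lemma cyclotomic_bprime:
  fixes k :: nat
  defines "N \<equiv> 3 ^ Suc k"
  shows "\<exists>h. bprime h \<and> 2 * 3 ^ k \<le> degree h \<and> h dvd XX ^ N - 1"
proof -
  define Y where "Y = XX ^ (3 ^ k)"
  define P where "P = Y ^ 2 + Y + 1"
  have Ym: "Y = monom 1 (3 ^ k)" by (simp add: Y_def monom_power)
  have "coeff P (2 * 3 ^ k) = 1"
    by (simp add: P_def Ym monom_power mult.commute)
  then have "degree P \<ge> 2 * 3 ^ k" by (intro le_degree) simp
  then have "degree P > 0" using order_less_le_trans[of 0 "2 * 3 ^ k" "degree P"] by simp
  then obtain h where h: "bprime h" "h dvd P" using ex_bprime_dvd by blast
  have XN: "XX ^ N - 1 = (Y - 1) * P"
  proof -
    have "XX ^ N = Y ^ 3" by (simp add: N_def Y_def mult.commute flip: power_mult)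
    then show ?thesis by (simp add: P_def algebra_simps power2_eq_square power3_eq_cube del: minus_bit_def)
  qed
  have hN: "h dvd XX ^ N - 1" using h XN by simp
  have h1: "\<not> h dvd 1" using h(1) unfolding bprime_def
    by (metis degree_1 dvd_imp_degree_le leD one_neq_zero)
  have hX: "\<not> h dvd XX"
  proof
    assume "h dvd XX"
    then have "h dvd XX ^ N" by (metis N_def dvd_power dvd_trans zero_less_numeral zero_less_power)
    then show False using hN h1 by (metis diff_diff_eq2 dvd_diff add_diff_cancel_left')
  qed
  \<comment> \<open>The order of X modulo \<open>h\<close> divides N, a power of 3, and also
    \<open>2 ^ degree h - 1\<close>. It remains to exclude that the common divisor is a smaller
    power of 3 than N.\<close>
  have "h dvd XX ^ gcd N (2 ^ degree h - 1) - 1"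
    using dvd_power_gcd[OF hN bprime_fermat[OF h(1) hX] hX h(1)] .
  obtain j where j: "j \<le> Suc k" "gcd N (2 ^ degree h - 1) = 3 ^ j"
    using divides_primepow_nat[of 3 "gcd N (2 ^ degree h - 1)" "Suc k"] by (auto simp: N_def)
  have "j = Suc k"
  proof (rule ccontr)
    assume "j \<noteq> Suc k"
    then have "(3::nat) ^ j dvd 3 ^ k" using j by (intro le_imp_power_dvd) simp
    then obtain c :: nat where c: "3 ^ k = 3 ^ j * c" by blast
    have "XX ^ (3 ^ j) - 1 dvd (XX ^ (3 ^ j)) ^ c - 1" by (metis dvd_triv_left power_diff_1_eq)
    then have "h dvd Y - 1" using \<open>h dvd XX ^ gcd N (2 ^ degree h - 1) - 1\<close> j(2)
      by (metis Y_def c dvd_trans power_mult)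
    \<comment> \<open>At Y = 1 the value of P is 3, which is 1 in characteristic 2, so
      \<open>h\<close> cannot divide both P and \<open>Y - 1\<close>.\<close>
    moreover have "P = (Y - 1) * (Y + 2) + 3" by (simp add: P_def algebra_simps power2_eq_square del: minus_bit_def)
    ultimately have "h dvd 3" using h(2) by (metis dvd_add_right_iff dvd_mult2)
    moreover have "(3::bit poly) = 1"
    proof -
      have "(2::bit poly) = 0" by (metis bit_2_eq_0 numeral_poly pCons_0_0)
      then have "(1::bit poly) + 2 = 1" by simp
      then show ?thesis by (simp only: one_plus_numeral) simp
    qed
    ultimately show False using h1 by simp
  qed
  then have N2: "N dvd 2 ^ degree h - 1" using j N_def by (metis gcd_dvd2)
  then have "3 dvd (2::nat) ^ degree h - 1" by (metis N_def dvd_mult_left power_Suc)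
  \<comment> \<open>As 2 has order 2 modulo 3, the degree is even and \<open>2 ^ degree h\<close> is
    a power of 4, to which \<open>three_pow_dvd\<close> applies.\<close>
  have "even (degree h)"
  proof (rule ccontr)
    assume "odd (degree h)"
    then obtain e where e: "degree h = 2 * e + 1" by (metis oddE)
    have "(2::nat) ^ degree h mod 3 = (2 * (4 ^ e mod 3)) mod 3" by (simp add: e power_mult mod_mult_right_eq)
    also have "(4::nat) ^ e mod 3 = 1" by (subst power_mod[symmetric]) simp
    finally have "(2::nat) ^ degree h mod 3 = 2" by simp
    then show False using \<open>3 dvd (2::nat) ^ degree h - 1\<close> by presburger
  qed
  then obtain e where e: "degree h = 2 * e" by blast
  then have "3 ^ Suc k dvd (4::nat) ^ e - 1" using N2 by (simp add: N_def power_mult)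
  then have "3 ^ k dvd e" by (rule three_pow_dvd)
  moreover have "e > 0" using h(1) e by (simp add: bprime_def)
  ultimately have "3 ^ k \<le> e" using dvd_imp_le by blast
  then show ?thesis using h hN e by auto
qed

section \<open>Roots in the residue field\<close>

lemma card_residue_class:
  assumes "bprime h" "degree h \<le> N"
  shows "card {p \<in> bpset N. h dvd p - a} \<le> 2 ^ (N - degree h)"
proof -
  let ?f = "\<lambda>q. a mod h + h * q"
  have d0: "degree h > 0" "h \<noteq> 0" using assms by (auto simp: bprime_def)
  then have N0: "N > 0" using assms(2) by simp
  have "{p \<in> bpset N. h dvd p - a} \<subseteq> ?f ` bpset (N - degree h)"
  proof
    fix p assume p: "p \<in> {p \<in> bpset N. h dvd p - a}"
    then have "p mod h = a mod h" by (simp add: mod_eq_dvd_iff)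
    then have e: "p = ?f (p div h)" by (metis add.commute div_mult_mod_eq mult.commute)
    have "p div h \<in> bpset (N - degree h)"
    proof (cases "p div h = 0")
      case True then show ?thesis by (simp add: bpset_def)
    next
      case False
      have "degree p < N" using p bpset_iff_degree[OF N0] by simp
      moreover have "degree p = degree h + degree (p div h)"
      proof -
        have m: "p mod h = 0 \<or> degree (p mod h) < degree h" using degree_mod_less d0 by blast
        have hq: "degree (h * (p div h)) = degree h + degree (p div h)"
          using False d0 by (simp add: degree_mult_eq)
        then have "degree (p mod h) < degree (h * (p div h))" using m d0 by auto
        then have "degree (h * (p div h) + p mod h) = degree (h * (p div h))"
          by (rule degree_add_eq_left)
        then show ?thesis using hq by simp
      qed
      ultimately show ?thesis by (subst bpset_iff_degree) auto
    qed
    then show "p \<in> ?f ` bpset (N - degree h)" using e by blast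
  qed
  then have "card {p \<in> bpset N. h dvd p - a} \<le> card (bpset (N - degree h))"
    by (meson card_image_le card_mono finite_bpset finite_imageI le_trans)
  then show ?thesis by (simp add: card_bpset)
qed

text \<open>A polynomial of degree D over a field has at most D roots, each counted here with the
  size of its residue class. The coefficients stay in GF(2)[X] and equality becomes divisibility by
  \<open>h\<close>; a leading coefficient 1 survives the reduction modulo \<open>h\<close>.\<close>

lemma card_roots:
  fixes Q :: "bit poly poly"
  assumes h: "bprime h" "degree h \<le> N" and Q: "lead_coeff Q = 1"
  shows "card {p \<in> bpset N. h dvd poly Q p} \<le> degree Q * 2 ^ (N - degree h)"
  using Q
proof (induction "degree Q" arbitrary: Q)
  case 0
  then have "Q = 1" by (metis degree_eq_zeroE lead_coeff_pCons(2) pCons_0_0 one_pCons)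
  have h1: "\<not> h dvd 1" using h(1) unfolding bprime_def
    by (metis degree_1 dvd_imp_degree_le leD one_neq_zero)
  then have "{p \<in> bpset N. h dvd poly Q p} = {}" using \<open>Q = 1\<close> by auto
  then show ?case by (metis card.empty zero_le)
next
  case (Suc D)
  show ?case
  proof (cases "\<exists>a\<in>bpset N. h dvd poly Q a")
    case False
    then have "{p \<in> bpset N. h dvd poly Q p} = {}" by auto
    then show ?thesis by (metis card.empty zero_le)
  next
    case True
    then obtain a where a: "a \<in> bpset N" "h dvd poly Q a" by blast
    let ?S = "synthetic_div Q a"
    have eq: "[:- a, 1:] * ?S + [:poly Q a:] = Q" by (rule synthetic_div_correct')
    have dS: "degree ?S = D" using Suc(2) by (metis degree_synthetic_div diff_Suc_1)
    have "coeff Q (Suc D) = coeff ?S D + coeff (smult (-a) ?S) (Suc D)"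
      by (subst eq[symmetric]) (simp add: coeff_pCons)
    also have "coeff (smult (-a) ?S) (Suc D) = 0" by (simp add: coeff_eq_0 dS)
    finally have lS: "lead_coeff ?S = 1" using Suc(2,3) dS by simp
    have pQ: "poly Q p = (p - a) * poly ?S p + poly Q a" for p
    proof -
      have "poly Q p = poly ([:- a, 1:] * ?S + [:poly Q a:]) p" by (simp only: eq)
      then show ?thesis by (simp add: algebra_simps del: minus_bit_def)
    qed
    have "{p \<in> bpset N. h dvd poly Q p} \<subseteq> {p \<in> bpset N. h dvd p - a} \<union> {p \<in> bpset N. h dvd poly ?S p}"
    proof
      fix p assume p: "p \<in> {p \<in> bpset N. h dvd poly Q p}"
      then have "h dvd (p - a) * poly ?S p" using pQ a(2) by (metis (no_types, lifting) dvd_add_left_iff mem_Collect_eq)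
      then show "p \<in> {p \<in> bpset N. h dvd p - a} \<union> {p \<in> bpset N. h dvd poly ?S p}"
        using h p unfolding bprime_def by blast
    qed
    then have "card {p \<in> bpset N. h dvd poly Q p} \<le>
      card ({p \<in> bpset N. h dvd p - a} \<union> {p \<in> bpset N. h dvd poly ?S p})"
      by (intro card_mono) (auto simp: finite_bpset)
    also have "\<dots> \<le> 2 ^ (N - degree h) + D * 2 ^ (N - degree h)"
      using card_Un_le card_residue_class[OF h, of a] Suc(1)[OF dS[symmetric] lS] dS
      by (metis (no_types, lifting) add_mono le_trans)
    finally show ?thesis using Suc(2)[symmetric] by simp
  qed
qed

text \<open>The condition makes p a root modulo \<open>h\<close> of the monic polynomial with
  exponent set E, whose degree is \<open>Max E\<close>.\<close>

lemma card_powers_dependent: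
  assumes h: "bprime h" "degree h \<le> N" and E: "E \<subseteq> {..<D}" "E \<noteq> {}"
  shows "card {p \<in> bpset N. h dvd (\<Sum>e\<in>E. p ^ e)} \<le> D * 2 ^ (N - degree h)"
proof -
  let ?Q = "\<Sum>e\<in>E. monom (1::bit poly) e"
  have fin: "finite E" using E finite_subset by blast
  have c: "coeff ?Q i = of_bool (i \<in> E)" for i using fin by (simp add: coeff_sum)
  have "degree ?Q = Max E"
  proof (rule antisym)
    show "degree ?Q \<le> Max E" using c fin by (intro degree_le) (auto dest: Max_ge)
    show "Max E \<le> degree ?Q" using c fin E by (intro le_degree) simp
  qed
  moreover have "Max E < D" using fin E by (meson Max_in lessThan_iff subsetD)
  moreover have "lead_coeff ?Q = 1" using c calculation fin E by simp
  moreover have "poly ?Q p = (\<Sum>e\<in>E. p ^ e)" for p by (simp add: poly_sum poly_monom)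
  ultimately show ?thesis using card_roots[OF h, of ?Q]
    by (metis (no_types, lifting) Collect_cong le_trans less_imp_le_nat mult_le_mono1)
qed

text \<open>\<open>cpow N x e\<close> is the coefficient vector of \<open>x ^ e\<close> in \<open>GF(2)[X] / (X ^ N - 1)\<close>.\<close>

primrec cpow :: "nat \<Rightarrow> (nat \<Rightarrow> bool) \<Rightarrow> nat \<Rightarrow> nat \<Rightarrow> bool" where
  "cpow N x 0 = (\<lambda>l. l = 0)"
| "cpow N x (Suc e) = (\<lambda>l. odd (card {i. i < N \<and> cpow N x e i \<and> x ((i + (N - l)) mod N)}))"

definition dotp :: "nat \<Rightarrow> (nat \<Rightarrow> bool) \<Rightarrow> (nat \<Rightarrow> bool) \<Rightarrow> bool" where
  "dotp N c y \<longleftrightarrow> odd (card {i. i < N \<and> c i \<and> y i})"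

definition vpoly :: "nat \<Rightarrow> (nat \<Rightarrow> bool) \<Rightarrow> bit poly" where
  "vpoly N v = (\<Sum>i<N. monom (of_bool (v i)) i)"

text \<open>The exponents are negated modulo N because \<open>cpow\<close> reads \<open>x\<close>
  forwards, in step with the current power. The cyclic product thus becomes a correlation, and the
  sampler can use the same loop for products and for inner products.\<close>

definition rpoly :: "nat \<Rightarrow> (nat \<Rightarrow> bool) \<Rightarrow> bit poly" where
  "rpoly N x = (\<Sum>m<N. monom (of_bool (x m)) ((N - m) mod N))"

lemma of_bool_odd_card:
  fixes A :: "'b set"
  assumes "finite A"
  shows "of_bool (odd (card {i\<in>A. P i})) = (\<Sum>i\<in>A. of_bool (P i) :: bit)"
  using assms
proof (induction A rule: finite_induct)
  case empty
  then show ?case by simp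
next
  case (insert a A)
  have e: "{i \<in> insert a A. P i} = (if P a then insert a {i\<in>A. P i} else {i\<in>A. P i})" by auto
  have "card {i \<in> insert a A. P i} = of_bool (P a) + card {i\<in>A. P i}"
    unfolding e using insert(1,2) by auto
  then show ?case using insert(1,2) insert(3)[symmetric] by (cases "P a") auto
qed

lemma cong_monom_mod: "XX ^ N - 1 dvd monom c i - monom c (i mod N)"
proof -
  have "XX ^ N - 1 dvd (XX ^ N) ^ (i div N) - 1" by (metis dvd_triv_left power_diff_1_eq)
  then have "XX ^ N - 1 dvd monom c (i mod N) * ((XX ^ N) ^ (i div N) - 1)" by (rule dvd_mult)
  also have "monom c (i mod N) * ((XX ^ N) ^ (i div N) - 1) = monom c i - monom c (i mod N)"
    by (simp add: monom_power right_diff_distrib mult_monom del: minus_bit_def flip: power_mult)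
  finally show ?thesis .
qed

text \<open>Reduce the exponents \<open>i - m\<close> of the expanded product modulo N and collect
  those equal to l: for each i this leaves exactly the index \<open>m = i - l\<close> at which
  \<open>cpow\<close> reads \<open>x\<close>.\<close>

lemma vpoly_cpow_Suc:
  assumes N: "N > 0"
  shows "XX ^ N - 1 dvd vpoly N (cpow N x e) * rpoly N x - vpoly N (cpow N x (Suc e))"
proof -
  let ?c = "\<lambda>i. of_bool (cpow N x e i) :: bit" and ?x = "\<lambda>m. of_bool (x m) :: bit"
  let ?j = "\<lambda>i m. i + (N - m) mod N"
  have 1: "vpoly N (cpow N x e) * rpoly N x = (\<Sum>i<N. \<Sum>m<N. monom (?c i * ?x m) (?j i m))"
    unfolding vpoly_def rpoly_def sum_product mult_monom ..
  \<comment> \<open>Modulo N, \<open>l = i - m\<close> and \<open>m = i - l\<close> are the same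
    condition; only the representatives in \<open>{..<N}\<close> need the case m = 0.\<close>
  have jm: "?j i m mod N = l \<longleftrightarrow> m = (i + (N - l)) mod N" if "i < N" "m < N" "l < N" for i m l
  proof -
    have md: "y mod N = (if y < N then y else y - N)" if "y < 2 * N" for y
      using that by (simp add: le_mod_geq)
    have 1: "(N - m) mod N = (if m = 0 then 0 else N - m)" using that by simp
    have 2: "(i + (N - l)) mod N = (if i + (N - l) < N then i + (N - l) else i + (N - l) - N)"
      using that by (intro md) linarith
    have 3: "?j i m mod N = (if ?j i m < N then ?j i m else ?j i m - N)"
    proof (rule md)
      have "(N - m) mod N < N" using that by simp
      then show "?j i m < 2 * N" using that by linarith
    qed
    show ?thesis unfolding 2 3 unfolding 1 using that by (cases "m = 0") (simp_all, linarith+)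
  qed
  have "vpoly N (cpow N x (Suc e)) = (\<Sum>l<N. monom (\<Sum>i<N. ?c i * ?x ((i + (N - l)) mod N)) l)"
  proof -
    have "of_bool (cpow N x (Suc e) l) = (\<Sum>i<N. ?c i * ?x ((i + (N - l)) mod N))" for l
      using of_bool_odd_card[OF finite_lessThan[of N], of "\<lambda>i. cpow N x e i \<and> x ((i + (N - l)) mod N)"]
      by (simp only: cpow.simps of_bool_conj lessThan_iff)
    then show ?thesis unfolding vpoly_def by (simp only:)
  qed
  also have "\<dots> = (\<Sum>l<N. \<Sum>i<N. monom (?c i * ?x ((i + (N - l)) mod N)) l)"
    by (simp only: monom_sum)
  also have "\<dots> = (\<Sum>i<N. \<Sum>l<N. monom (?c i * ?x ((i + (N - l)) mod N)) l)"
    by (rule sum.swap)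
  also have "\<dots> = (\<Sum>i<N. \<Sum>m<N. monom (?c i * ?x m) (?j i m mod N))"
  proof (rule sum.cong[OF refl])
    fix i assume i: "i \<in> {..<N}"
    show "(\<Sum>l<N. monom (?c i * ?x ((i + (N - l)) mod N)) l)
      = (\<Sum>m<N. monom (?c i * ?x m) (?j i m mod N))"
    proof (rule sum.reindex_bij_witness[where i = "\<lambda>m. ?j i m mod N" and j = "\<lambda>l. (i + (N - l)) mod N"])
      fix l assume l: "l \<in> {..<N}"
      show "(i + (N - l)) mod N \<in> {..<N}" "?j i l mod N \<in> {..<N}" using N by simp_all
      then show inv: "?j i ((i + (N - l)) mod N) mod N = l" using jm[of i _ l] i l by blast
      show "(i + (N - ?j i l mod N)) mod N = l" using jm[of i l "?j i l mod N"] i l N by simp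
      show "monom (?c i * ?x ((i + (N - l)) mod N)) (?j i ((i + (N - l)) mod N) mod N)
        = monom (?c i * ?x ((i + (N - l)) mod N)) l" using inv by simp
    qed
  qed
  finally have 2: "vpoly N (cpow N x (Suc e)) = (\<Sum>i<N. \<Sum>m<N. monom (?c i * ?x m) (?j i m mod N))" .
  show ?thesis unfolding 1 2 sum_subtractf[symmetric]
    by (intro dvd_sum cong_monom_mod)
qed

lemma vpoly_cpow:
  assumes N: "N > 0"
  shows "XX ^ N - 1 dvd rpoly N x ^ e - vpoly N (cpow N x e)"
proof (induction e)
  case 0
  have "vpoly N (cpow N x 0) = (\<Sum>i<N. if i = 0 then 1 else 0)"
    unfolding vpoly_def by (intro sum.cong) (auto simp: one_pCons monom_0)
  then show ?case using N by simp
next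
  case (Suc e)
  have "rpoly N x ^ Suc e - vpoly N (cpow N x (Suc e)) =
    (rpoly N x ^ e - vpoly N (cpow N x e)) * rpoly N x
    + (vpoly N (cpow N x e) * rpoly N x - vpoly N (cpow N x (Suc e)))"
    by (simp add: algebra_simps del: minus_bit_def cpow.simps)
  then show ?case using vpoly_cpow_Suc[OF N, of x e] Suc by (metis dvd_add dvd_mult2)
qed

text \<open>If the coefficient vectors of the powers in E add up to zero, the sum of the powers
  vanishes in the ring and hence in its residue field, so the seed is one of the roots counted
  above. Among all \<open>2 ^ N\<close> seeds these are a fraction of at most
  \<open>D / 2 ^ (2 * 3 ^ k)\<close>.\<close>

lemma card_dependent_seeds:
  assumes E: "E \<subseteq> {..<D}" "E \<noteq> {}" and N: "N = 3 ^ Suc k"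
  shows "card {xs :: bool list. length xs = N \<and> (\<forall>l<N. even (card {e\<in>E. cpow N ((!) xs) e l}))}
    \<le> D * 2 ^ (N - 2 * 3 ^ k)"
proof -
  have N0: "N > 0" using N by simp
  have fin: "finite E" using E finite_subset by blast
  obtain h where h: "bprime h" "2 * 3 ^ k \<le> degree h" "h dvd XX ^ N - 1"
    using cyclotomic_bprime[of k] N by blast
  have "degree (XX ^ N - 1) = N"
  proof -
    have "XX ^ N - 1 = monom 1 N + [:1:]" by (simp add: monom_power one_pCons)
    moreover have "degree (monom (1::bit) N + [:1:]) = N"
      using degree_add_eq_left[of "[:1:]" "monom (1::bit) N"] N0 by (simp add: degree_monom_eq)
    ultimately show ?thesis by simp
  qed
  then have dN: "degree h \<le> N" using dvd_imp_degree_le[OF h(3)] N0 by fastforce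
  let ?X = "\<lambda>xs. rpoly N ((!) xs)"
  let ?A = "{xs :: bool list. length xs = N \<and> (\<forall>l<N. even (card {e\<in>E. cpow N ((!) xs) e l}))}"
  have cX: "coeff (?X xs) ((N - m) mod N) = of_bool (xs ! m)" if "m < N" for xs m
  proof -
    have "coeff (?X xs) ((N - m) mod N) = (\<Sum>m'<N. if m' = m then of_bool (xs ! m') else 0)"
      unfolding rpoly_def coeff_sum coeff_monom using that by (intro sum.cong) (auto simp: mod_if)
    then show ?thesis using that by simp
  qed
  have inj: "inj_on ?X ?A"
  proof (rule inj_onI, rule nth_equalityI)
    fix xs ys m assume *: "xs \<in> ?A" "ys \<in> ?A" "?X xs = ?X ys"
    then show "length xs = length ys" by simp
    assume "m < length xs"
    then show "xs ! m = ys ! m" using cX[of m xs] cX[of m ys] * by (auto split: if_splits)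
  qed
  have sub: "?X ` ?A \<subseteq> {p \<in> bpset N. h dvd (\<Sum>e\<in>E. p ^ e)}"
  proof
    fix p assume "p \<in> ?X ` ?A"
    then obtain xs where xs: "xs \<in> ?A" "p = ?X xs" by blast
    have z: "(\<Sum>e\<in>E. vpoly N (cpow N ((!) xs) e)) = 0"
    proof -
      have "(\<Sum>e\<in>E. vpoly N (cpow N ((!) xs) e))
        = (\<Sum>l<N. monom (\<Sum>e\<in>E. of_bool (cpow N ((!) xs) e l)) l)"
        unfolding vpoly_def by (subst sum.swap) (simp add: monom_sum)
      also have "\<dots> = (\<Sum>l<N. 0)"
        using xs(1) by (intro sum.cong) (auto simp flip: of_bool_odd_card[OF fin])
      finally show ?thesis by simp
    qed
    have "XX ^ N - 1 dvd (\<Sum>e\<in>E. p ^ e - vpoly N (cpow N ((!) xs) e))"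
      unfolding xs(2) by (intro dvd_sum vpoly_cpow N0)
    then have "XX ^ N - 1 dvd (\<Sum>e\<in>E. p ^ e)" unfolding sum_subtractf z by simp
    then have "h dvd (\<Sum>e\<in>E. p ^ e)" using h(3) dvd_trans by blast
    moreover have "p \<in> bpset N"
    proof -
      have "coeff p i = 0" if "i \<ge> N" for i
      proof -
        have "(N - m) mod N \<noteq> i" for m using that mod_less_divisor[OF N0, of "N - m"] by linarith
        then show ?thesis unfolding xs(2) rpoly_def coeff_sum coeff_monom by simp
      qed
      then show ?thesis by (simp add: bpset_def)
    qed
    ultimately show "p \<in> {p \<in> bpset N. h dvd (\<Sum>e\<in>E. p ^ e)}" by simp
  qed
  have "card ?A = card (?X ` ?A)" using card_image[OF inj] by simp
  also have "\<dots> \<le> card {p \<in> bpset N. h dvd (\<Sum>e\<in>E. p ^ e)}"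
    using sub by (intro card_mono) (auto simp: finite_bpset)
  also have "\<dots> \<le> D * 2 ^ (N - degree h)" by (rule card_powers_dependent[OF h(1) dN E])
  also have "\<dots> \<le> D * 2 ^ (N - 2 * 3 ^ k)" using h(2) by (intro mult_left_mono power_increasing) auto
  finally show ?thesis .
qed

section \<open>Characters on bit vectors\<close>

lemma bij_betw_bool_lists:
  "bij_betw (\<lambda>ys. {l. l < N \<and> ys ! l}) {ys :: bool list. length ys = N} (Pow {..<N})"
proof (rule bij_betw_byWitness[where f' = "\<lambda>S. map (\<lambda>l. l \<in> S) [0..<N]"])
  show "\<forall>ys\<in>{ys :: bool list. length ys = N}. map (\<lambda>l. l \<in> {l. l < N \<and> ys ! l}) [0..<N] = ys"
    by (auto simp: list_eq_iff_nth_eq)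
qed auto

lemma card_bool_lists: "card {ys :: bool list. length ys = N} = 2 ^ N"
  using bij_betw_same_card[OF bij_betw_bool_lists[of N]] by (simp add: card_Pow)

lemma finite_bool_lists: "finite {ys :: bool list. length ys = N}"
  using bij_betw_finite[OF bij_betw_bool_lists[of N]] by simp

abbreviation sgnb :: "bool \<Rightarrow> real" where "sgnb b \<equiv> (if b then -1 else 1)"

lemma sgnb_odd_card:
  assumes "finite A"
  shows "sgnb (odd (card {i\<in>A. P i})) = (\<Prod>i\<in>A. sgnb (P i))"
  using assms
proof (induction A rule: finite_induct)
  case empty
  then show ?case by simp
next
  case (insert a A)
  have e: "{i \<in> insert a A. P i} = (if P a then insert a {i\<in>A. P i} else {i\<in>A. P i})" by auto
  have "card {i \<in> insert a A. P i} = of_bool (P a) + card {i\<in>A. P i}"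
    unfolding e using insert(1,2) by auto
  then show ?case using insert(1,2) insert(3)[symmetric] by (cases "P a") auto
qed

lemma sum_characters:
  "(\<Sum>ys | length (ys::bool list) = N. \<Prod>l<N. if ys ! l then g l else (1::real)) = (\<Prod>l<N. g l + 1)"
proof -
  have "(\<Sum>ys | length (ys::bool list) = N. \<Prod>l<N. if ys ! l then g l else (1::real))
    = (\<Sum>ys | length (ys::bool list) = N. \<Prod>l\<in>{l. l < N \<and> ys ! l}. g l)"
  proof (intro sum.cong refl)
    fix ys :: "bool list"
    have "{l. l < N \<and> ys ! l} = {l \<in> {..<N}. ys ! l}" by auto
    then show "(\<Prod>l<N. if ys ! l then g l else 1) = (\<Prod>l\<in>{l. l < N \<and> ys ! l}. g l)"
      by (simp only: prod.inter_filter[OF finite_lessThan])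
  qed
  also have "\<dots> = (\<Sum>S\<in>Pow {..<N}. \<Prod>l\<in>S. g l)"
    by (rule sum.reindex_bij_betw[OF bij_betw_bool_lists])
  also have "\<dots> = (\<Prod>l<N. g l + 1)" by (simp add: prod_add)
  finally show ?thesis .
qed

text \<open>Fourier expansion: the indicator of one equation is half of 1 plus a sign, and the
  product over E expands into one character for each \<open>E' \<subseteq> E\<close>. Summed over
  \<open>ys\<close>, a character vanishes unless the vectors \<open>c e\<close> with
  \<open>e \<in> E'\<close> add up to zero modulo 2, and then it contributes at most
  \<open>2 ^ N\<close>.\<close>

lemma card_dot_solutions:
  fixes c :: "nat \<Rightarrow> nat \<Rightarrow> bool"
  assumes fin: "finite E"
  shows "2 ^ card E * real (card {ys. length ys = N \<and> (\<forall>e\<in>E. dotp N (c e) ((!) ys) = t e)})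
    \<le> 2 ^ N * real (card {E'. E' \<subseteq> E \<and> (\<forall>l<N. even (card {e\<in>E'. c e l}))})"
proof -
  let ?Y = "{ys :: bool list. length ys = N}"
  let ?s = "\<lambda>ys e. sgnb (dotp N (c e) ((!) ys)) * sgnb (t e)"
  let ?g = "\<lambda>E' l. \<Prod>e\<in>E'. sgnb (c e l)"
  have "2 ^ card E * real (card {ys. length ys = N \<and> (\<forall>e\<in>E. dotp N (c e) ((!) ys) = t e)})
    = (\<Sum>ys\<in>?Y. if \<forall>e\<in>E. dotp N (c e) ((!) ys) = t e then 2 ^ card E else 0)"
    by (simp add: sum.If_cases finite_bool_lists Int_def conj_commute)
  also have "\<dots> = (\<Sum>ys\<in>?Y. \<Prod>e\<in>E. ?s ys e + 1)"
  proof (intro sum.cong refl)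
    fix ys :: "bool list"
    show "(if \<forall>e\<in>E. dotp N (c e) ((!) ys) = t e then 2 ^ card E else 0) = (\<Prod>e\<in>E. ?s ys e + 1)"
    proof (cases "\<forall>e\<in>E. dotp N (c e) ((!) ys) = t e")
      case True
      then have "(\<Prod>e\<in>E. ?s ys e + 1) = (\<Prod>e\<in>E. 2)" by (intro prod.cong) auto
      then show ?thesis using True by simp
    next
      case False
      then obtain e where "e \<in> E" "dotp N (c e) ((!) ys) \<noteq> t e" by blast
      then have "(\<Prod>e\<in>E. ?s ys e + 1) = 0" using fin by (intro prod_zero) auto
      then show ?thesis using False by simp
    qed
  qed
  also have "\<dots> = (\<Sum>ys\<in>?Y. \<Sum>E'\<in>Pow E. \<Prod>e\<in>E'. ?s ys e)"
    using fin by (simp add: prod_add)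
  also have "\<dots> = (\<Sum>E'\<in>Pow E. \<Sum>ys\<in>?Y. \<Prod>e\<in>E'. ?s ys e)" by (rule sum.swap)
  also have "\<dots> \<le> (\<Sum>E'\<in>Pow E. if \<forall>l<N. even (card {e\<in>E'. c e l}) then 2 ^ N else 0)"
  proof (intro sum_mono)
    fix E' assume "E' \<in> Pow E"
    then have fin': "finite E'" using fin finite_subset by blast
    have dp: "sgnb (dotp N v ((!) ys)) = (\<Prod>l<N. if ys ! l then sgnb (v l) else 1)" for v ys
    proof -
      have "sgnb (dotp N v ((!) ys)) = (\<Prod>l<N. sgnb (v l \<and> ys ! l))"
        unfolding dotp_def using sgnb_odd_card[of "{..<N}" "\<lambda>l. v l \<and> ys ! l"] by simp
      also have "\<dots> = (\<Prod>l<N. if ys ! l then sgnb (v l) else 1)" by (intro prod.cong) auto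
      finally show ?thesis .
    qed
    have "(\<Prod>e\<in>E'. ?s ys e) = (\<Prod>e\<in>E'. sgnb (t e)) * (\<Prod>l<N. if ys ! l then ?g E' l else 1)" for ys
    proof -
      have "(\<Prod>e\<in>E'. sgnb (dotp N (c e) ((!) ys)))
        = (\<Prod>l<N. \<Prod>e\<in>E'. if ys ! l then sgnb (c e l) else 1)"
        unfolding dp by (rule prod.swap)
      also have "\<dots> = (\<Prod>l<N. if ys ! l then ?g E' l else 1)" by (intro prod.cong) auto
      finally show ?thesis by (simp add: prod.distrib mult.commute)
    qed
    then have "(\<Sum>ys\<in>?Y. \<Prod>e\<in>E'. ?s ys e) =
      (\<Prod>e\<in>E'. sgnb (t e)) * (\<Sum>ys\<in>?Y. \<Prod>l<N. if ys ! l then ?g E' l else 1)"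
      by (simp add: sum_distrib_left)
    also have "\<dots> = (\<Prod>e\<in>E'. sgnb (t e)) * (\<Prod>l<N. ?g E' l + 1)" unfolding sum_characters ..
    \<comment> \<open>The signs of the targets t multiply to 1 or -1, and the other factor is not
      negative.\<close>
    also have "\<dots> \<le> (\<Prod>l<N. ?g E' l + 1)"
    proof -
      have "(\<Prod>e\<in>E'. sgnb (t e)) = sgnb (odd (card {e\<in>E'. t e}))" using sgnb_odd_card[OF fin', of t] by simp
      moreover have "?g E' l = sgnb (odd (card {e\<in>E'. c e l}))" for l
        using sgnb_odd_card[OF fin', of "\<lambda>e. c e l"] by simp
      then have "0 \<le> (\<Prod>l<N. ?g E' l + 1)" by (intro prod_nonneg) auto
      ultimately show ?thesis by auto
    qed
    also have "\<dots> = (if \<forall>l<N. even (card {e\<in>E'. c e l}) then 2 ^ N else 0)"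
    proof -
      have g: "?g E' l = sgnb (odd (card {e\<in>E'. c e l}))" for l
        using sgnb_odd_card[OF fin', of "\<lambda>e. c e l"] by simp
      show ?thesis
      proof (cases "\<forall>l<N. even (card {e\<in>E'. c e l})")
        case True
        then have "(\<Prod>l<N. ?g E' l + 1) = (\<Prod>l<N. 2)" unfolding g by (intro prod.cong) auto
        then show ?thesis using True by simp
      next
        case False
        then obtain l where "l < N" "odd (card {e\<in>E'. c e l})" by blast
        then have "(\<Prod>l<N. ?g E' l + 1) = 0" unfolding g by (intro prod_zero) auto
        then show ?thesis unfolding if_not_P[OF False] .
      qed
    qed
    finally show "(\<Sum>ys\<in>?Y. \<Prod>e\<in>E'. ?s ys e) \<le> (if \<forall>l<N. even (card {e\<in>E'. c e l}) then 2 ^ N else 0)" .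
  qed
  also have "\<dots> = 2 ^ N * real (card {E'. E' \<subseteq> E \<and> (\<forall>l<N. even (card {e\<in>E'. c e l}))})"
    using fin by (simp add: sum.If_cases Int_def)
  finally show ?thesis .
qed

text \<open>In the average over \<open>xs\<close> the empty subset gives the term
  \<open>1 / 2 ^ card E\<close> of truly independent bits. Every other subset is dependent for few
  \<open>xs\<close> only, and the number \<open>2 ^ card E\<close> of subsets cancels against the
  same factor in \<open>card_dot_solutions\<close>, so the error does not grow with E. This is the
  powering construction of small-bias bits.\<close>

lemma card_seeds:
  assumes E: "E \<subseteq> {..<D}" and N: "N = 3 ^ Suc k"
  shows "(\<Sum>xs | length (xs::bool list) = N.
      real (card {ys. length ys = N \<and> (\<forall>e\<in>E. dotp N (cpow N ((!) xs) e) ((!) ys) = t e)}))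
    \<le> 2 ^ (2 * N) * (1 / 2 ^ card E + real D / 2 ^ (2 * 3 ^ k))"
proof -
  let ?X = "{xs :: bool list. length xs = N}"
  have fin: "finite E" using E finite_subset by blast
  let ?P = "\<lambda>xs E'. \<forall>l<N. even (card {e\<in>E'. cpow N ((!) xs) e l})"
  have "2 ^ card E * (\<Sum>xs\<in>?X.
      real (card {ys. length ys = N \<and> (\<forall>e\<in>E. dotp N (cpow N ((!) xs) e) ((!) ys) = t e)}))
    \<le> (\<Sum>xs\<in>?X. 2 ^ N * real (card {E'. E' \<subseteq> E \<and> ?P xs E'}))"
    unfolding sum_distrib_left by (intro sum_mono card_dot_solutions fin)
  also have "\<dots> = 2 ^ N * (\<Sum>xs\<in>?X. \<Sum>E'\<in>Pow E. if ?P xs E' then 1 else 0)"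
    using fin by (simp add: sum.If_cases Int_def sum_distrib_left)
  also have "(\<Sum>xs\<in>?X. \<Sum>E'\<in>Pow E. if ?P xs E' then 1 else 0)
    = (\<Sum>E'\<in>Pow E. \<Sum>xs\<in>?X. if ?P xs E' then 1 else (0::real))" by (rule sum.swap)
  also have "\<dots> = (\<Sum>E'\<in>Pow E. real (card {xs. length xs = N \<and> ?P xs E'}))"
    by (simp add: sum.If_cases finite_bool_lists Int_def)
  also have "\<dots> \<le> (\<Sum>E'\<in>Pow E. (if E' = {} then 2 ^ N else 0) + real D * 2 ^ (N - 2 * 3 ^ k))"
  proof (intro sum_mono)
    fix E' assume E': "E' \<in> Pow E"
    show "real (card {xs. length xs = N \<and> ?P xs E'})
      \<le> (if E' = {} then 2 ^ N else 0) + real D * 2 ^ (N - 2 * 3 ^ k)"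
    proof (cases "E' = {}")
      case True
      then show ?thesis by (simp add: card_bool_lists)
    next
      case False
      then have "card {xs. length xs = N \<and> ?P xs E'} \<le> D * 2 ^ (N - 2 * 3 ^ k)"
        using card_dependent_seeds[of E' D N k] E E' N by blast
      then have "real (card {xs. length xs = N \<and> ?P xs E'}) \<le> real (D * 2 ^ (N - 2 * 3 ^ k))"
        by (simp only: of_nat_le_iff)
      then show ?thesis using False by simp
    qed
  qed
  also have "\<dots> = 2 ^ N + 2 ^ card E * (real D * 2 ^ (N - 2 * 3 ^ k))"
    using fin by (simp add: sum.distrib card_Pow)
  finally have *: "2 ^ card E * (\<Sum>xs\<in>?X.
      real (card {ys. length ys = N \<and> (\<forall>e\<in>E. dotp N (cpow N ((!) xs) e) ((!) ys) = t e)}))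
    \<le> 2 ^ N * (2 ^ N + 2 ^ card E * (real D * 2 ^ (N - 2 * 3 ^ k)))" by simp
  have "2 * 3 ^ k \<le> N" using N by simp
  then have "2 ^ (N - 2 * 3 ^ k) = (2::real) ^ N / 2 ^ (2 * 3 ^ k)" by (simp add: power_diff)
  then have "2 ^ N * (2 ^ N + 2 ^ card E * (real D * 2 ^ (N - 2 * 3 ^ k)))
    = 2 ^ card E * (2 ^ (2 * N) * (1 / 2 ^ card E + real D / 2 ^ (2 * 3 ^ k)))"
    by (simp add: field_simps mult_2 power_add mult_2_right)
  from *[unfolded this] show ?thesis by (subst (asm) mult_le_cancel_left_pos) simp_all
qed

section \<open>Spread families of terms\<close>

lemma prob_bind_pmf:
  "measure_pmf.prob (bind_pmf M f) A = measure_pmf.expectation M (\<lambda>x. measure_pmf.prob (f x) A)"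
proof -
  have "ennreal (measure_pmf.prob (bind_pmf M f) A) = emeasure (bind_pmf M f) A"
    by (simp add: measure_pmf.emeasure_eq_measure)
  also have "\<dots> = (\<integral>\<^sup>+x. emeasure (f x) A \<partial>M)" by (rule emeasure_bind_pmf)
  also have "\<dots> = (\<integral>\<^sup>+x. ennreal (measure_pmf.prob (f x) A) \<partial>M)"
    by (simp add: measure_pmf.emeasure_eq_measure)
  also have "\<dots> = ennreal (measure_pmf.expectation M (\<lambda>x. measure_pmf.prob (f x) A))"
    by (intro nn_integral_eq_integral measure_pmf.integrable_const_bound[where B = 1])
      (auto simp: measure_pmf.prob_le_1)
  finally show ?thesis by (simp add: integral_nonneg_AE)
qed

lemma prob_pair_pmf:
  "measure_pmf.prob (pair_pmf M N) A = measure_pmf.expectation M (\<lambda>x. measure_pmf.prob N {y. (x, y) \<in> A})"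
proof -
  have "pair_pmf M N = bind_pmf M (\<lambda>x. map_pmf (Pair x) N)"
    by (simp add: pair_pmf_def map_pmf_def)
  then show ?thesis by (simp add: prob_bind_pmf vimage_def)
qed

lemma prob_pair_indep:
  "measure_pmf.prob (pair_pmf M N) {z. P (fst z) \<and> Q (snd z)} =
    measure_pmf.prob M {x. P x} * measure_pmf.prob N {y. Q y}"
proof -
  have "measure_pmf.prob (pair_pmf M N) {z. P (fst z) \<and> Q (snd z)}
    = measure_pmf.expectation M (\<lambda>x. measure_pmf.prob N {y. P x \<and> Q y})"
    by (simp add: prob_pair_pmf)
  also have "\<dots> = measure_pmf.expectation M (\<lambda>x. indicator {x. P x} x * measure_pmf.prob N {y. Q y})"
    by (intro Bochner_Integration.integral_cong) (auto simp: indicator_def)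
  finally show ?thesis by simp
qed

lemma prob_mono_set_pmf:
  assumes "\<And>x. x \<in> set_pmf M \<Longrightarrow> x \<in> A \<Longrightarrow> x \<in> B"
  shows "measure_pmf.prob M A \<le> measure_pmf.prob M B"
proof -
  have "measure_pmf.prob M A = measure_pmf.prob M (A \<inter> set_pmf M)" by (rule measure_Int_set_pmf[symmetric])
  also have "\<dots> \<le> measure_pmf.prob M B" using assms by (intro measure_pmf.finite_measure_mono) auto
  finally show ?thesis .
qed

lemma prob_Un_le:
  "measure_pmf.prob M {x. P x \<or> Q x} \<le> measure_pmf.prob M {x. P x} + measure_pmf.prob M {x. Q x}"
proof -
  have "{x. P x \<or> Q x} = {x. P x} \<union> {x. Q x}" by auto
  then show ?thesis by (simp add: measure_Un_le)
qed

lemma prob_UN_le: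
  assumes "finite I"
  shows "measure_pmf.prob M {x. \<exists>i\<in>I. P i x} \<le> (\<Sum>i\<in>I. measure_pmf.prob M {x. P i x})"
proof -
  have "{x. \<exists>i\<in>I. P i x} = (\<Union>i\<in>I. {x. P i x})" by auto
  then show ?thesis using assms by (simp add: measure_pmf.finite_measure_subadditive_finite)
qed

lemma finite_cube: "finite V \<Longrightarrow> finite (cube V)"
  by (simp add: cube_def finite_PiE)

lemma cube_nonempty: "cube V \<noteq> {}"
  by (simp add: cube_def PiE_eq_empty_iff)

lemma set_unif: "finite V \<Longrightarrow> set_pmf (unif V) = cube V"
  unfolding unif_def by (rule set_pmf_of_set[OF cube_nonempty finite_cube])

lemma unif_conv_Pi_pmf:
  assumes "finite V"
  shows "unif V = Pi_pmf V undefined (\<lambda>_. pmf_of_set UNIV)"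
proof -
  have "PiE_dflt V undefined (\<lambda>_. UNIV :: bool set) = cube V"
    by (auto simp: PiE_dflt_def cube_def PiE_def extensional_def)
  then show ?thesis unfolding unif_def using Pi_pmf_of_set[OF assms, of "\<lambda>_. UNIV :: bool set" undefined] by simp
qed

definition merge :: "nat set \<Rightarrow> (nat \<Rightarrow> 'a) \<Rightarrow> (nat \<Rightarrow> 'a) \<Rightarrow> nat \<Rightarrow> 'a" where
  "merge L y z = (\<lambda>i. if i \<in> L then y i else z i)"

lemma unif_split:
  assumes "finite V" "U \<subseteq> V"
  shows "unif V = map_pmf (\<lambda>(u, v). merge U u v) (pair_pmf (unif U) (unif (V - U)))"
proof -
  have fin: "finite U" using assms finite_subset by blast
  have "V = U \<union> (V - U)" using assms by auto
  then show ?thesis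
    using Pi_pmf_union[OF fin, of "V - U" undefined "\<lambda>_. pmf_of_set (UNIV :: bool set)"] assms fin
    unfolding unif_conv_Pi_pmf[OF assms(1)] unif_conv_Pi_pmf[OF fin]
      unif_conv_Pi_pmf[OF finite_Diff[OF assms(1)]] merge_def
    by (simp add: case_prod_unfold)
qed

abbreviation pr :: "nat set \<Rightarrow> ((nat \<Rightarrow> bool) \<Rightarrow> bool) \<Rightarrow> real" where
  "pr V A \<equiv> measure_pmf.prob (unif V) {x. A x}"

definition dep :: "nat set \<Rightarrow> ((nat \<Rightarrow> 'a) \<Rightarrow> bool) \<Rightarrow> bool" where
  "dep U A \<longleftrightarrow> (\<forall>x y. (\<forall>i\<in>U. x i = y i) \<longrightarrow> A x = A y)"

lemma pr_indep:
  assumes V: "finite V" and U: "U \<subseteq> V" and A: "dep U A" and B: "dep W B" and W: "W \<inter> U = {}"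
  shows "pr V (\<lambda>x. A x \<and> B x) = pr V A * pr V B"
proof -
  let ?M = "pair_pmf (unif U) (unif (V - U))"
  have a: "A (merge U u v) = A u" for u v using A unfolding dep_def merge_def by simp
  have b: "B (merge U u v) = B v" for u v
    by (rule B[unfolded dep_def, rule_format]) (use W in \<open>auto simp: merge_def\<close>)
  have pr: "pr V P = measure_pmf.prob ?M {z. P (merge U (fst z) (snd z))}" for P
    by (subst unif_split[OF V U]) (simp add: vimage_def case_prod_unfold)
  have "pr V (\<lambda>x. A x \<and> B x) = measure_pmf.prob (unif U) {x. A x} * measure_pmf.prob (unif (V - U)) {x. B x}"
    unfolding pr a b by (rule prob_pair_indep)
  moreover have "pr V A = measure_pmf.prob (unif U) {x. A x}"
    unfolding pr a using prob_pair_indep[of "unif U" "unif (V - U)" A "\<lambda>_. True"] by simp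
  moreover have "pr V B = measure_pmf.prob (unif (V - U)) {x. B x}"
    unfolding pr b using prob_pair_indep[of "unif U" "unif (V - U)" "\<lambda>_. True" B] by simp
  ultimately show ?thesis by simp
qed

lemma pr_indep_finite:
  assumes V: "finite V" and P: "\<And>b::nat. b < B \<Longrightarrow> dep (U b) (A b)" "\<And>b. b < B \<Longrightarrow> U b \<subseteq> V"
    and disj: "\<And>b c. b < B \<Longrightarrow> c < B \<Longrightarrow> b \<noteq> c \<Longrightarrow> U b \<inter> U c = {}"
  shows "pr V (\<lambda>x. \<forall>b<B. A b x) = (\<Prod>b<B. pr V (A b))"
  using P disj
proof (induction B)
  case 0
  then show ?case by simp
next
  case (Suc B)
  have d: "dep (\<Union>b<B. U b) (\<lambda>x. \<forall>b<B. A b x)"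
    unfolding dep_def
  proof (intro allI impI)
    fix x y :: "nat \<Rightarrow> bool" assume "\<forall>i\<in>\<Union>b<B. U b. x i = y i"
    then have "A b x = A b y" if "b < B" for b using Suc.prems(1)[of b] that unfolding dep_def by auto
    then show "(\<forall>b<B. A b x) = (\<forall>b<B. A b y)" by blast
  qed
  have "U B \<inter> (\<Union>b<B. U b) = {}" 
  proof -
    have "i \<notin> U b" if "i \<in> U B" "b < B" for i b using Suc.prems(3)[of B b] that by auto
    then show ?thesis by blast
  qed
  then have "pr V (\<lambda>x. A B x \<and> (\<forall>b<B. A b x)) = pr V (A B) * pr V (\<lambda>x. \<forall>b<B. A b x)"
    using Suc.prems V by (intro pr_indep[OF V _ _ d, of "U B"]) auto
  moreover have "(\<lambda>x. \<forall>b<Suc B. A b x) = (\<lambda>x. A B x \<and> (\<forall>b<B. A b x))" by (auto simp: less_Suc_eq)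
  moreover have "pr V (\<lambda>x. \<forall>b<B. A b x) = (\<Prod>b<B. pr V (A b))" by (rule Suc.IH) (use Suc.prems in auto)
  ultimately show ?case by simp
qed

section \<open>Terms and their probabilities\<close>

definition satT :: "literal set \<Rightarrow> (nat \<Rightarrow> bool) \<Rightarrow> bool" where
  "satT T x \<longleftrightarrow> (\<forall>(i, b)\<in>T. x i = b)"

text \<open>The type \<open>dnf\<close> allows contradictory terms. Finite consistent terms have as
  many variables as literals, which is why their probability is exactly
  \<open>1 / 2 ^ card T\<close>.\<close>

definition consistent :: "literal set \<Rightarrow> bool" where
  "consistent T \<longleftrightarrow> inj_on fst T"

lemma eval_dnf_satT: "eval_dnf F x \<longleftrightarrow> (\<exists>T\<in>F. satT T x)"
  by (simp add: eval_dnf_def satT_def)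

lemma satT_Un: "satT (S \<union> T) x \<longleftrightarrow> satT S x \<and> satT T x"
  by (auto simp: satT_def)

lemma satT_mono: "S \<subseteq> T \<Longrightarrow> satT T x \<Longrightarrow> satT S x"
  by (auto simp: satT_def)

lemma satT_consistent:
  assumes "satT T x"
  shows "consistent T"
  unfolding consistent_def
proof (rule inj_onI)
  have "snd p = x (fst p)" if "p \<in> T" for p using assms that by (cases p) (auto simp: satT_def)
  then show "p = q" if "p \<in> T" "q \<in> T" "fst p = fst q" for p q using that by (simp add: prod_eq_iff)
qed

lemma dep_satT: "fst ` T \<subseteq> U \<Longrightarrow> dep U (satT T)"
  unfolding dep_def satT_def by force

text \<open>Covers random assignments, with \<open>S = UNIV\<close>, as well as random partitions,
  with \<open>S = {..<B}\<close>.\<close>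

lemma prob_Pi_eq:
  fixes c :: "'a" 
  assumes "finite V" "U \<subseteq> V" "finite S" "\<And>i. i \<in> U \<Longrightarrow> g i \<in> S"
  shows "measure_pmf.prob (pmf_of_set (V \<rightarrow>\<^sub>E S)) {h. \<forall>i\<in>U. h i = g i} = 1 / real (card S) ^ card U"
proof (cases "S = {}")
  case True
  then have "U = {}" using assms by auto
  then show ?thesis by simp
next
  case False
  have fin: "finite (V \<rightarrow>\<^sub>E S)" using assms by (intro finite_PiE) auto
  have ne: "V \<rightarrow>\<^sub>E S \<noteq> {}" using False by (simp add: PiE_eq_empty_iff)
  have c0: "card S > 0" using False assms by (simp add: card_gt_0_iff)
  have "(V \<rightarrow>\<^sub>E S) \<inter> {h. \<forall>i\<in>U. h i = g i} = (\<Pi>\<^sub>E i\<in>V. if i \<in> U then {g i} else S)"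
    using assms by (auto simp: PiE_def Pi_def split: if_splits)
  then have "card ((V \<rightarrow>\<^sub>E S) \<inter> {h. \<forall>i\<in>U. h i = g i}) = (\<Prod>i\<in>V. card (if i \<in> U then {g i} else S))"
    using assms by (simp add: card_PiE)
  also have "\<dots> = (\<Prod>i\<in>V. if i \<in> U then 1 else card S)" by (intro prod.cong) auto
  also have "\<dots> = card S ^ card (V - U)"
    using assms by (simp add: prod.If_cases Diff_eq)
  also have "card (V - U) = card V - card U" using assms by (simp add: card_Diff_subset finite_subset)
  finally have 1: "card ((V \<rightarrow>\<^sub>E S) \<inter> {h. \<forall>i\<in>U. h i = g i}) = card S ^ (card V - card U)" .
  have 2: "card (V \<rightarrow>\<^sub>E S) = card S ^ card V" using assms by (simp add: card_PiE)
  have le: "card U \<le> card V" using assms by (intro card_mono)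
  show ?thesis
    unfolding measure_pmf_of_set[OF ne fin] 1 2 of_nat_power using c0 le by (simp add: power_diff)
qed

lemma satT_iff_fun:
  assumes "consistent T"
  shows "satT T x \<longleftrightarrow> (\<forall>i\<in>fst ` T. x i = (THE b. (i, b) \<in> T))"
proof -
  have "(THE b. (i, b) \<in> T) = b" if "(i, b) \<in> T" for i b
    using that assms unfolding consistent_def inj_on_def by (intro the_equality) force+
  then show ?thesis unfolding satT_def by fastforce
qed

lemma card_fst_consistent: "consistent T \<Longrightarrow> card (fst ` T) = card T"
  unfolding consistent_def by (rule card_image)

lemma pr_satT:
  assumes "finite V" "fst ` T \<subseteq> V" "consistent T"
  shows "pr V (satT T) = 1 / 2 ^ card T"
proof -
  have "pr V (satT T) = 1 / real (card (UNIV :: bool set)) ^ card (fst ` T)"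
    unfolding unif_def cube_def satT_iff_fun[OF assms(3)] using assms by (intro prob_Pi_eq) auto
  then show ?thesis using card_fst_consistent[OF assms(3)] by simp
qed

section \<open>Second moments of spread families\<close>

text \<open>Chebyshev's inequality for the number of events that occur. Here \<open>r\<close> bounds
  joint probabilities relative to independent events, and the last hypothesis makes the variance at
  most half of the squared mean.\<close>

lemma second_moment:
  fixes M :: "'b pmf" and E :: "'a \<Rightarrow> 'b \<Rightarrow> bool"
  assumes fin: "finite \<G>" "\<G> \<noteq> {}" and mu: "\<mu> > 0"
    and E1: "\<And>T. T \<in> \<G> \<Longrightarrow> measure_pmf.prob M {x. E T x} = \<mu>"
    and E2: "\<And>T T'. T \<in> \<G> \<Longrightarrow> T' \<in> \<G> \<Longrightarrow> measure_pmf.prob M {x. E T x \<and> E T' x} \<le> \<mu>\<^sup>2 * r T T'"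
    and r: "\<And>T. T \<in> \<G> \<Longrightarrow> (\<Sum>T'\<in>\<G>. r T T' - 1) \<le> real (card \<G>) / 2"
  shows "measure_pmf.prob M {x. \<forall>T\<in>\<G>. \<not> E T x} \<le> 1 / 2"
proof -
  let ?e = "measure_pmf.expectation M"
  let ?I = "\<lambda>T x. of_bool (E T x) :: real"
  let ?X = "\<lambda>x. \<Sum>T\<in>\<G>. ?I T x" and ?m = "real (card \<G>)"
  have [simp]: "integrable M (\<lambda>x. of_bool (P x) :: real)" for P
    by (rule measure_pmf.integrable_const_bound[where B = 1]) auto
  have eI: "?e (\<lambda>x. of_bool (P x)) = measure_pmf.prob M {x. P x}" for P
  proof -
    have "(\<lambda>x. of_bool (P x) :: real) = indicator {x. P x}" by (auto simp: indicator_def)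
    then show ?thesis by simp
  qed
  have m0: "?m > 0" using fin by (simp add: card_gt_0_iff)
  have sq: "(?X x - ?m * \<mu>)\<^sup>2 = (\<Sum>T\<in>\<G>. \<Sum>T'\<in>\<G>. of_bool (E T x \<and> E T' x))
      - 2 * ?m * \<mu> * (\<Sum>T\<in>\<G>. ?I T x) + (?m * \<mu>)\<^sup>2" for x
  proof -
    have "?X x * ?X x = (\<Sum>T\<in>\<G>. \<Sum>T'\<in>\<G>. of_bool (E T x \<and> E T' x))"
      unfolding sum_product by (simp only: of_bool_conj)
    then show ?thesis by (simp add: power2_eq_square algebra_simps)
  qed
  have "(?m * \<mu>)\<^sup>2 * measure_pmf.prob M {x. \<forall>T\<in>\<G>. \<not> E T x} = ?e (\<lambda>x. (?m * \<mu>)\<^sup>2 * of_bool (\<forall>T\<in>\<G>. \<not> E T x))"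
    by (simp add: eI)
  also have "\<dots> \<le> ?e (\<lambda>x. (?X x - ?m * \<mu>)\<^sup>2)"
  proof (rule integral_mono)
    show "integrable M (\<lambda>x. (?X x - ?m * \<mu>)\<^sup>2)" unfolding sq by simp
    show "(?m * \<mu>)\<^sup>2 * of_bool (\<forall>T\<in>\<G>. \<not> E T x) \<le> (?X x - ?m * \<mu>)\<^sup>2" for x
    proof (cases "\<forall>T\<in>\<G>. \<not> E T x")
      case True
      then have "?X x = 0" by simp
      then show ?thesis using True by simp
    qed simp
  qed simp
  also have "\<dots> = (\<Sum>T\<in>\<G>. \<Sum>T'\<in>\<G>. measure_pmf.prob M {x. E T x \<and> E T' x}) - (?m * \<mu>)\<^sup>2"
  proof -
    have "?e (\<lambda>x. (?X x - ?m * \<mu>)\<^sup>2) = (\<Sum>T\<in>\<G>. \<Sum>T'\<in>\<G>. measure_pmf.prob M {x. E T x \<and> E T' x})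
      - 2 * ?m * \<mu> * (\<Sum>T\<in>\<G>. measure_pmf.prob M {x. E T x}) + (?m * \<mu>)\<^sup>2"
      unfolding sq by (simp add: eI del: of_bool_conj)
    then show ?thesis using E1 by (simp add: power2_eq_square algebra_simps)
  qed
  also have "\<dots> \<le> (\<Sum>T\<in>\<G>. \<Sum>T'\<in>\<G>. \<mu>\<^sup>2 * r T T') - (?m * \<mu>)\<^sup>2"
    by (intro diff_right_mono sum_mono E2)
  also have "\<dots> = \<mu>\<^sup>2 * (\<Sum>T\<in>\<G>. \<Sum>T'\<in>\<G>. r T T' - 1)"
    by (simp add: sum_subtractf sum_distrib_left algebra_simps power2_eq_square)
  also have "\<dots> \<le> \<mu>\<^sup>2 * (\<Sum>T\<in>\<G>. ?m / 2)"
    by (intro mult_left_mono sum_mono r) auto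
  also have "\<dots> = (?m * \<mu>)\<^sup>2 * (1 / 2)" by (simp add: power2_eq_square)
  finally show ?thesis using mu m0 by (subst (asm) mult_le_cancel_left_pos) auto
qed

lemma sum_Pow_power:
  fixes x :: real
  assumes "finite A"
  shows "(\<Sum>Y\<in>Pow A. x ^ card Y) = (1 + x) ^ card A"
  using prod_add[OF assms, of "\<lambda>_. x" "\<lambda>_. 1"] by (simp add: add.commute)

text \<open>\<open>(1 + q) ^ card (T \<inter> T')\<close> is the sum of \<open>q ^ card Y\<close>
  over the common subsets Y. After exchanging the sums, spreadness bounds the number of
  \<open>T'\<close> above each Y, and \<open>(1 + q / \<kappa>) ^ k - 1\<close> remains; by
  \<open>4 * q * k \<le> \<kappa>\<close> it is at most \<open>exp (1 / 4) - 1\<close>.\<close>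

lemma spread_overlap:
  fixes q \<kappa> :: real
  assumes T: "finite T" "card T = k" and fin: "finite \<G>" and q: "q \<ge> 0" and k: "\<kappa> > 0" "4 * q * k \<le> \<kappa>"
    and spread: "\<And>Z. Z \<noteq> {} \<Longrightarrow> real (card {T'\<in>\<G>. Z \<subseteq> T'}) \<le> real (card \<G>) / \<kappa> ^ card Z"
  shows "(\<Sum>T'\<in>\<G>. q ^ card (T \<inter> T') - 1) \<le> real (card \<G>) / 2"
proof -
  let ?P = "Pow T - {{}}"
  have finP: "finite ?P" using T by simp
  have "(\<Sum>T'\<in>\<G>. q ^ card (T \<inter> T') - 1) \<le> (\<Sum>T'\<in>\<G>. \<Sum>Y\<in>?P. if Y \<subseteq> T' then q ^ card Y else 0)"
  proof (intro sum_mono)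
    fix T' assume "T' \<in> \<G>"
    have f: "finite (T \<inter> T')" using T by simp
    have "(\<Sum>Y\<in>?P. if Y \<subseteq> T' then q ^ card Y else 0) = (\<Sum>Y\<in>Pow (T \<inter> T') - {{}}. q ^ card Y)"
      using finP by (intro sum.mono_neutral_cong_right) auto
    also have "\<dots> = (\<Sum>Y\<in>Pow (T \<inter> T'). q ^ card Y) - 1"
      using sum_diff1[OF finite_Pow_iff[THEN iffD2, OF f], of "\<lambda>Y. q ^ card Y" "{}"] by simp
    also have "\<dots> = (1 + q) ^ card (T \<inter> T') - 1" using sum_Pow_power[OF f] by simp
    finally show "q ^ card (T \<inter> T') - 1 \<le> (\<Sum>Y\<in>?P. if Y \<subseteq> T' then q ^ card Y else 0)"
      using q power_mono[of q "1 + q" "card (T \<inter> T')"] by simp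
  qed
  also have "\<dots> = (\<Sum>Y\<in>?P. \<Sum>T'\<in>\<G>. if Y \<subseteq> T' then q ^ card Y else 0)" by (rule sum.swap)
  also have "\<dots> = (\<Sum>Y\<in>?P. q ^ card Y * real (card {T'\<in>\<G>. Y \<subseteq> T'}))"
    using fin by (simp add: sum.If_cases Int_def mult.commute)
  also have "\<dots> \<le> (\<Sum>Y\<in>?P. q ^ card Y * (real (card \<G>) / \<kappa> ^ card Y))"
    using q by (intro sum_mono mult_left_mono spread) auto
  also have "\<dots> = real (card \<G>) * (\<Sum>Y\<in>?P. (q / \<kappa>) ^ card Y)"
    by (simp add: sum_distrib_left power_divide mult.commute)
  also have "(\<Sum>Y\<in>?P. (q / \<kappa>) ^ card Y) = (1 + q / \<kappa>) ^ k - 1"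
    using T sum_Pow_power[OF T(1), of "q / \<kappa>"] by (subst sum_diff1) auto
  also have "(1 + q / \<kappa>) ^ k - 1 \<le> 1 / 2"
  proof -
    have "(1 + q / \<kappa>) ^ k \<le> exp (q / \<kappa>) ^ k" using q k by (intro power_mono exp_ge_add_one_self) auto
    also have "\<dots> = exp (real k * (q / \<kappa>))" by (simp only: exp_of_nat_mult)
    also have "\<dots> \<le> exp (1 / 4)" using k by (simp add: field_simps)
    also have "\<dots> \<le> 1 + 1 / 4 + (1 / 4)\<^sup>2" by (rule exp_bound) auto
    finally show ?thesis by (simp add: power2_eq_square)
  qed
  finally show ?thesis by (simp add: mult_left_mono)
qed

text \<open>Inequality of arithmetic and geometric means. A single partition controls the failure
  probabilities of its parts only on average, but their product is what matters.\<close>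

lemma prod_le_power_mean:
  fixes x :: "nat \<Rightarrow> real"
  assumes "\<And>b. b < B \<Longrightarrow> 0 \<le> x b" "(\<Sum>b<B. x b) \<le> real B * c"
  shows "(\<Prod>b<B. x b) \<le> c ^ B"
proof (cases "B = 0")
  case True
  then show ?thesis by simp
next
  case False
  let ?P = "\<Prod>b<B. x b"
  have P: "?P \<ge> 0" using assms by (intro prod_nonneg) auto
  have "?P powr (1 / real B) \<le> (\<Sum>b<B. x b / real B)"
    using arith_geom_mean[of "{..<B}" x] assms False by auto
  also have "\<dots> = (\<Sum>b<B. x b) / real B" by (simp add: sum_divide_distrib)
  also have "\<dots> \<le> c" using assms(2) False by (simp add: divide_le_eq mult.commute)
  finally have le: "?P powr (1 / real B) \<le> c" .
  have root: "p = (p powr (1 / real B)) ^ B" if "p \<ge> 0" for p :: real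
  proof (cases "p = 0")
    case True
    then show ?thesis using False by simp
  next
    case nz: False
    then have "(p powr (1 / real B)) ^ B = (p powr (1 / real B)) powr real B"
      using that by (subst powr_realpow) auto
    then show ?thesis using nz that False by (simp add: powr_powr)
  qed
  have "?P = (?P powr (1 / real B)) ^ B" using P by (rule root)
  also have "\<dots> \<le> c ^ B" using le by (intro power_mono) auto
  finally show ?thesis .
qed

text \<open>Every literal costs a factor \<open>2 * B\<close>: its variable must fall into part b
  and its value must be right. Two terms together behave like their union, which has probability 0
  if it is contradictory.\<close>

lemma satT_Un_prob_le:
  assumes V: "finite V" "fst ` T \<subseteq> V" "fst ` T' \<subseteq> V" and b: "b < B"
    and fin: "finite T" "finite T'"
  defines "E \<equiv> \<lambda>T z. (\<forall>i\<in>fst ` T. fst z i = b) \<and> satT T (snd z)"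
  shows "measure_pmf.prob (pair_pmf (pmf_of_set (V \<rightarrow>\<^sub>E {..<B})) (unif V)) {z. E T z \<and> E T' z}
    \<le> 1 / real (2 * B) ^ card (T \<union> T')" (is "?p \<le> _")
    and "consistent T \<Longrightarrow> measure_pmf.prob (pair_pmf (pmf_of_set (V \<rightarrow>\<^sub>E {..<B})) (unif V)) {z. E T z}
      = 1 / real (2 * B) ^ card T"
proof -
  let ?M = "pair_pmf (pmf_of_set (V \<rightarrow>\<^sub>E {..<B})) (unif V)"
  have one: "measure_pmf.prob ?M {z. E S z} = 1 / real (2 * B) ^ card S"
    if S: "consistent S" "fst ` S \<subseteq> V" for S
  proof -
    have "measure_pmf.prob ?M {z. E S z} =
      measure_pmf.prob (pmf_of_set (V \<rightarrow>\<^sub>E {..<B})) {p. \<forall>i\<in>fst ` S. p i = b} * pr V (satT S)"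
      unfolding E_def by (rule prob_pair_indep)
    also have "measure_pmf.prob (pmf_of_set (V \<rightarrow>\<^sub>E {..<B})) {p. \<forall>i\<in>fst ` S. p i = b}
      = 1 / real (card {..<B}) ^ card (fst ` S)"
      using V S b by (intro prob_Pi_eq) auto
    also have "pr V (satT S) = 1 / 2 ^ card S" using V S by (intro pr_satT)
    finally show ?thesis using S by (simp add: card_fst_consistent power_mult_distrib)
  qed
  show "consistent T \<Longrightarrow> measure_pmf.prob ?M {z. E T z} = 1 / real (2 * B) ^ card T"
    using one V by blast
  have e: "E T z \<and> E T' z \<longleftrightarrow> E (T \<union> T') z" for z unfolding E_def by (auto simp: satT_Un)
  show "?p \<le> 1 / real (2 * B) ^ card (T \<union> T')"
  proof (cases "consistent (T \<union> T')")
    case True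
    then have "measure_pmf.prob ?M {z. E (T \<union> T') z} = 1 / real (2 * B) ^ card (T \<union> T')"
      using V by (intro one) auto
    then show ?thesis unfolding e by simp
  next
    case False
    then have z: "{z. E (T \<union> T') z} = {}" using satT_consistent unfolding E_def by blast
    show ?thesis unfolding e z by simp
  qed
qed

text \<open>A uniformly random partition of the variables into \<open>B\<close> parts leaves the family spread inside
  each part; the parts are independent, and by the second moment method each of them contains a
  satisfied term with probability at least 1/2.\<close>

lemma spread_family_satisfied:
  assumes V: "finite V" and G: "finite \<G>" "\<G> \<noteq> {}"
    and T: "\<And>T. T \<in> \<G> \<Longrightarrow> finite T \<and> fst ` T \<subseteq> V \<and> consistent T \<and> card T = k"
    and k: "\<kappa> > 0" "8 * real B * real k \<le> \<kappa>"
    and spread: "\<And>Z. Z \<noteq> {} \<Longrightarrow> real (card {T'\<in>\<G>. Z \<subseteq> T'}) \<le> real (card \<G>) / \<kappa> ^ card Z"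
  shows "pr V (\<lambda>x. \<forall>T\<in>\<G>. \<not> satT T x) \<le> 1 / 2 ^ B"
proof (cases "B = 0")
  case True
  then show ?thesis by (simp add: measure_pmf.prob_le_1)
next
  case False
  let ?S = "V \<rightarrow>\<^sub>E {..<B}" and ?U = "unif V"
  let ?M = "pair_pmf (pmf_of_set ?S) ?U"
  let ?E = "\<lambda>b T z. (\<forall>i\<in>fst ` T. fst z i = b) \<and> satT T (snd z)"
  have finS: "finite ?S" using V by (intro finite_PiE) auto
  have neS: "?S \<noteq> {}" using False by (auto simp: PiE_eq_empty_iff)
  have q: "real (2 * B) > 0" using False by simp
  have half: "measure_pmf.prob ?M {z. \<forall>T\<in>\<G>. \<not> ?E b T z} \<le> 1 / 2" if b: "b < B" for b
  proof (rule second_moment[where \<mu> = "1 / real (2 * B) ^ k" and r = "\<lambda>T T'. real (2 * B) ^ card (T \<inter> T')"])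
    show "0 < 1 / real (2 * B) ^ k" using q by simp
    show "measure_pmf.prob ?M {z. ?E b T z} = 1 / real (2 * B) ^ k" if "T \<in> \<G>" for T
      using satT_Un_prob_le(2)[OF V _ _ b, of T T] T[OF that] by simp
    show "measure_pmf.prob ?M {z. ?E b T z \<and> ?E b T' z}
      \<le> (1 / real (2 * B) ^ k)\<^sup>2 * real (2 * B) ^ card (T \<inter> T')" if "T \<in> \<G>" "T' \<in> \<G>" for T T'
    proof -
      have f: "finite T" "finite T'" and c: "card T = k" "card T' = k" using T that by auto
      have "card (T \<union> T') + card (T \<inter> T') = k + k" using card_Un_Int[OF f] c by simp
      then have "real (2 * B) ^ card (T \<union> T') * real (2 * B) ^ card (T \<inter> T') = real (2 * B) ^ (k + k)"
        by (simp only: power_add[symmetric])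
      then have "1 / real (2 * B) ^ card (T \<union> T') = (1 / real (2 * B) ^ k)\<^sup>2 * real (2 * B) ^ card (T \<inter> T')"
        using q by (simp add: field_simps power_add power2_eq_square)
      then show ?thesis using satT_Un_prob_le(1)[OF V _ _ b, of T T'] T that by simp
    qed
    \<comment> \<open>With \<open>q = 2 * B\<close> the condition
      \<open>4 * q * k \<le> \<kappa>\<close> becomes the assumption
      \<open>8 * real B * real k \<le> \<kappa>\<close>.\<close>
    show "(\<Sum>T'\<in>\<G>. real (2 * B) ^ card (T \<inter> T') - 1) \<le> real (card \<G>) / 2" if "T \<in> \<G>" for T
      by (rule spread_overlap[where k = k and \<kappa> = \<kappa>]) (use T[OF that] G k spread in auto)
  qed (use G in auto)
  let ?Z = "\<lambda>p b. pr V (\<lambda>x. \<forall>T\<in>\<G>. \<not> ?E b T (p, x))"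
  \<comment> \<open>So far the bound 1/2 is an average over partitions and assignments. Averaging
    fixes one partition whose parts fail with mean probability at most 1/2; once it is fixed, the
    parts read disjoint sets of variables.\<close>
  have "\<exists>p\<in>?S. (\<Sum>b<B. ?Z p b) \<le> real B * (1 / 2)"
  proof (rule ccontr)
    assume "\<not> ?thesis"
    then have lt: "real B * (1 / 2) < (\<Sum>b<B. ?Z p b)" if "p \<in> ?S" for p using that by auto
    have "(\<Sum>p\<in>?S. \<Sum>b<B. ?Z p b) > (\<Sum>p\<in>?S. real B * (1 / 2))"
      using finS neS lt by (intro sum_strict_mono) auto
    moreover have "(\<Sum>p\<in>?S. \<Sum>b<B. ?Z p b) = (\<Sum>b<B. \<Sum>p\<in>?S. ?Z p b)" by (rule sum.swap)
    moreover have "(\<Sum>p\<in>?S. ?Z p b) \<le> real (card ?S) * (1 / 2)" if "b < B" for b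
    proof -
      have "(\<Sum>p\<in>?S. ?Z p b) / real (card ?S) \<le> 1 / 2"
        using half[OF that] unfolding prob_pair_pmf integral_pmf_of_set[OF neS finS] by simp
      then show ?thesis using finS neS by (simp add: divide_le_eq card_gt_0_iff mult.commute)
    qed
    then have "(\<Sum>b<B. \<Sum>p\<in>?S. ?Z p b) \<le> (\<Sum>b<B. real (card ?S) * (1 / 2))" by (intro sum_mono) auto
    ultimately show False by (simp add: mult.commute)
  qed
  then obtain p where p: "p \<in> ?S" "(\<Sum>b<B. ?Z p b) \<le> real B * (1 / 2)" by blast
  let ?W = "\<lambda>b. {i\<in>V. p i = b}"
  have "pr V (\<lambda>x. \<forall>T\<in>\<G>. \<not> satT T x) \<le> pr V (\<lambda>x. \<forall>b<B. \<forall>T\<in>\<G>. \<not> ?E b T (p, x))"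
    by (intro measure_pmf.finite_measure_mono) auto
  also have "\<dots> = (\<Prod>b<B. ?Z p b)"
  proof (rule pr_indep_finite[OF V, where U = ?W])
    show "dep (?W b) (\<lambda>x. \<forall>T\<in>\<G>. \<not> ?E b T (p, x))" for b
      unfolding dep_def
    proof (intro allI impI)
      fix x y :: "nat \<Rightarrow> bool" assume xy: "\<forall>i\<in>?W b. x i = y i"
      have "?E b T (p, x) = ?E b T (p, y)" if "T \<in> \<G>" for T
      proof (cases "\<forall>i\<in>fst ` T. p i = b")
        case True
        then have "fst ` T \<subseteq> ?W b" using T[OF that] by auto
        then have "satT T x = satT T y" using dep_satT[of T "?W b"] xy unfolding dep_def by blast
        then show ?thesis by simp
      qed auto
      then show "(\<forall>T\<in>\<G>. \<not> ?E b T (p, x)) = (\<forall>T\<in>\<G>. \<not> ?E b T (p, y))" by blast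
    qed
  qed auto
  also have "\<dots> \<le> (1 / 2) ^ B" using p(2) by (intro prod_le_power_mean) auto
  finally show ?thesis by (simp add: power_one_over)
qed

definition terms_on :: "nat set \<Rightarrow> nat \<Rightarrow> literal set set" where
  "terms_on I w = {T. T \<subseteq> I \<times> UNIV \<and> consistent T \<and> card T \<le> w}"

lemma finite_terms_on: "finite I \<Longrightarrow> finite (terms_on I w)"
  by (rule finite_subset[of _ "Pow (I \<times> UNIV)"]) (auto simp: terms_on_def)

lemma consistent_subset: "consistent T \<Longrightarrow> S \<subseteq> T \<Longrightarrow> consistent S"
  unfolding consistent_def by (rule inj_on_subset)

section \<open>Sparse sandwiching DNFs of the same width\<close>

text \<open>K is the spread parameter and B the number of parts in the spread lemma.
  \<open>8 * B * w \<le> K\<close> lets that lemma apply to terms of size up to w; the inequality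
  for \<epsilon> makes its failure probability \<open>1 / 2 ^ B\<close> fit into half of the error
  allowed to any core.\<close>

locale sparsification =
  fixes V I :: "nat set" and F :: dnf and w B K :: nat and \<epsilon> :: real
  assumes V: "finite V" and I: "I \<subseteq> V" and F: "F \<subseteq> terms_on I w"
    and K0: "K > 0" and K: "8 * B * w \<le> K" and B: "2 * (2 * real K) ^ w \<le> \<epsilon> * 2 ^ B" and eps: "\<epsilon> > 0"
begin

text \<open>Both budgets shrink with the size of T. Passing to a core that is smaller by d joins
  \<open>K ^ d + 1\<close> parts, while the allowed number of terms grows by
  \<open>(2 * K) ^ d\<close> and the allowed error by \<open>(4 * K) ^ d\<close>. The joined parts
  use up at most half of that error; the other half is for the failure of the spread lemma.\<close>

definition covered_by :: "literal set \<Rightarrow> dnf \<Rightarrow> bool" where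
  "covered_by T G \<longleftrightarrow> G \<subseteq> F \<and> card G \<le> (2 * K) ^ (w - card T) \<and>
     pr V (\<lambda>x. satT T x \<and> \<not> eval_dnf G x) \<le> \<epsilon> / (4 * real K) ^ card T"

definition good :: "literal set \<Rightarrow> bool" where
  "good T \<longleftrightarrow> T \<in> terms_on I w \<and> (\<exists>G. covered_by T G)"

definition minimal :: "nat \<Rightarrow> literal set set" where
  "minimal k = {T. good T \<and> card T = k \<and> (\<forall>Y. Y \<subset> T \<longrightarrow> \<not> good Y)}"

lemma finI: "finite I" using V I finite_subset by blast

lemma good_term: "T \<in> F \<Longrightarrow> good T"
proof -
  assume T: "T \<in> F"
  have "{x. satT T x \<and> \<not> satT T x} = {}" by auto
  then have "covered_by T {T}"
    unfolding covered_by_def eval_dnf_satT using T K0 eps by (simp add: eval_dnf_satT)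
  then show ?thesis using T F unfolding good_def by blast
qed

lemma finite_good: "good T \<Longrightarrow> finite T"
  unfolding good_def terms_on_def using finI finite_subset[of T "I \<times> UNIV"] by simp

lemma finite_minimal: "finite (minimal k)"
  by (rule finite_subset[OF _ finite_terms_on[OF finI, of w]]) (auto simp: minimal_def good_def)

text \<open>The links \<open>T - Y\<close> form a spread family on variables outside of Y. Given Y,
  some T in A is satisfied except with probability \<open>1 / 2 ^ B\<close>, and this T almost
  implies its own part of F; the union of these parts serves for Y.\<close>

lemma core_good:
  assumes A: "A \<subseteq> minimal k" "card A = K ^ (k - card Y) + 1" and Y: "\<And>T. T \<in> A \<Longrightarrow> Y \<subset> T"
    and spread: "\<And>Z. Z \<noteq> {} \<Longrightarrow> Z \<inter> Y = {} \<Longrightarrow>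
      real (card {T\<in>A. Y \<union> Z \<subseteq> T}) \<le> real K ^ (k - card Y) / real K ^ card Z"
  shows "good Y"
proof -
  let ?k = "k - card Y"
  have finA: "finite A" using A(2) by (intro card_ge_0_finite) simp
  have neA: "A \<noteq> {}" using A(2) by auto
  have TA: "T \<in> terms_on I w" "finite T" "card T = k" "good T" if "T \<in> A" for T
    using that A(1) finite_good unfolding minimal_def good_def by blast+
  have kw: "k \<le> w" using neA TA(1,3) unfolding terms_on_def by blast
  obtain T0 where T0: "T0 \<in> A" using neA by blast
  have Yt: "Y \<subseteq> I \<times> UNIV" "consistent Y" "finite Y"
    using Y[OF T0] TA[OF T0] consistent_subset finite_subset unfolding terms_on_def by blast+
  have cY: "card Y < k" using psubset_card_mono[OF TA(2)[OF T0] Y[OF T0]] TA(3)[OF T0] by simp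
  define \<G> where "\<G> = (\<lambda>T. T - Y) ` A"
  have inj: "inj_on (\<lambda>T. T - Y) A" using Y by (intro inj_onI) blast
  have cG: "card \<G> = K ^ ?k + 1" unfolding \<G>_def using card_image[OF inj] A(2) by simp
  have sat: "pr V (\<lambda>x. \<forall>T\<in>\<G>. \<not> satT T x) \<le> 1 / 2 ^ B"
  proof (rule spread_family_satisfied[OF V, where \<kappa> = "real K" and k = ?k])
    show "finite \<G>" "\<G> \<noteq> {}" unfolding \<G>_def using finA neA by auto
    show "finite T \<and> fst ` T \<subseteq> V \<and> consistent T \<and> card T = ?k" if "T \<in> \<G>" for T
    proof -
      obtain S where S: "S \<in> A" "T = S - Y" using \<open>T \<in> \<G>\<close> unfolding \<G>_def by blast
      have "card T = ?k" using S Y[OF S(1)] TA[OF S(1)] Yt(3) by (simp add: card_Diff_subset psubset_imp_subset)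
      moreover have "fst ` T \<subseteq> V" using TA(1)[OF S(1)] S(2) I unfolding terms_on_def by force
      moreover have "consistent T" using TA(1)[OF S(1)] consistent_subset S(2) unfolding terms_on_def by blast
      ultimately show ?thesis using S(2) TA(2)[OF S(1)] by blast
    qed
    show "0 < real K" using K0 by simp
    have "8 * B * ?k \<le> 8 * B * w" using kw by (intro mult_left_mono) auto
    then have "8 * B * ?k \<le> K" using K by linarith
    then have "real (8 * B * ?k) \<le> real K" by (simp only: of_nat_le_iff)
    then show "8 * real B * real ?k \<le> real K" by simp
    show "real (card {T'\<in>\<G>. Z \<subseteq> T'}) \<le> real (card \<G>) / real K ^ card Z" if Z: "Z \<noteq> {}" for Z
    proof (cases "Z \<inter> Y = {}")
      case True
      have "{T'\<in>\<G>. Z \<subseteq> T'} = (\<lambda>T. T - Y) ` {T\<in>A. Y \<union> Z \<subseteq> T}"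
        unfolding \<G>_def using Y True by blast
      then have "card {T'\<in>\<G>. Z \<subseteq> T'} \<le> card {T\<in>A. Y \<union> Z \<subseteq> T}" using finA by (simp add: card_image_le)
      then have "real (card {T'\<in>\<G>. Z \<subseteq> T'}) \<le> real K ^ ?k / real K ^ card Z"
        using spread[OF Z True] by linarith
      also have "\<dots> \<le> real (card \<G>) / real K ^ card Z" unfolding cG by (intro divide_right_mono) auto
      finally show ?thesis .
    next
      case False
      then have z: "{T'\<in>\<G>. Z \<subseteq> T'} = {}" unfolding \<G>_def by blast
      show ?thesis unfolding z by simp
    qed
  qed
  have "\<exists>G. covered_by T G" if "T \<in> A" for T using TA(4)[OF that] unfolding good_def by blast
  then obtain G where G: "\<And>T. T \<in> A \<Longrightarrow> covered_by T (G T)" by metis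
  let ?G = "\<Union>T\<in>A. G T"
  have dY: "dep (fst ` Y) (satT Y)" by (rule dep_satT) simp
  have dG: "dep (\<Union>T\<in>\<G>. fst ` T) (\<lambda>x. \<forall>T\<in>\<G>. \<not> satT T x)"
    unfolding dep_def
  proof (intro allI impI)
    fix x y :: "nat \<Rightarrow> bool" assume xy: "\<forall>i\<in>\<Union>T\<in>\<G>. fst ` T. x i = y i"
    have "satT T x = satT T y" if "T \<in> \<G>" for T
      using dep_satT[of T "fst ` T"] xy that unfolding dep_def by blast
    then show "(\<forall>T\<in>\<G>. \<not> satT T x) = (\<forall>T\<in>\<G>. \<not> satT T y)" by blast
  qed
  \<comment> \<open>Consistency of the terms above Y keeps the variables of a link away from those
    of Y.\<close>
  have disj: "(\<Union>T\<in>\<G>. fst ` T) \<inter> fst ` Y = {}"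
  proof -
    have "fst l \<noteq> fst l'" if "T \<in> A" "l \<in> T - Y" "l' \<in> Y" for T l l'
      using TA(1)[OF that(1)] Y[OF that(1)] that(2,3) unfolding terms_on_def consistent_def inj_on_def by blast
    then show ?thesis unfolding \<G>_def by fastforce
  qed
  have YV: "fst ` Y \<subseteq> V" using Yt(1) I by force
  \<comment> \<open>Independence supplies the factor \<open>1 / 2 ^ card Y\<close>, which turns the
    \<open>(2 * K) ^ card Y\<close> from the choice of B into
    \<open>(4 * K) ^ card Y\<close>.\<close>
  have 1: "pr V (\<lambda>x. satT Y x \<and> (\<forall>T\<in>\<G>. \<not> satT T x)) \<le> (\<epsilon> / (4 * real K) ^ card Y) / 2"
  proof -
    have "1 / 2 ^ B \<le> \<epsilon> / (2 * (2 * real K) ^ w)" using B K0 by (simp add: field_simps)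
    also have "\<dots> \<le> \<epsilon> / (2 * (2 * real K) ^ card Y)"
      using K0 eps cY kw by (intro divide_left_mono mult_left_mono power_increasing) auto
    finally have b: "1 / 2 ^ B \<le> \<epsilon> / (2 * (2 * real K) ^ card Y)" .
    have "pr V (\<lambda>x. satT Y x \<and> (\<forall>T\<in>\<G>. \<not> satT T x)) = 1 / 2 ^ card Y * pr V (\<lambda>x. \<forall>T\<in>\<G>. \<not> satT T x)"
      using pr_indep[OF V YV dY dG disj] pr_satT[OF V YV Yt(2)] by simp
    also have "\<dots> \<le> 1 / 2 ^ card Y * (\<epsilon> / (2 * (2 * real K) ^ card Y))"
      using order_trans[OF sat b] by (intro mult_left_mono) auto
    also have "\<dots> = (\<epsilon> / (4 * real K) ^ card Y) / 2"
    proof -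
      have f: "(4 * real K) ^ card Y = 2 ^ card Y * (2 * real K) ^ card Y" by (subst power_mult_distrib[symmetric]) simp
      show ?thesis unfolding f by simp
    qed
    finally show ?thesis .
  qed
  have two: "real (K ^ ?k + 1) \<le> 2 * real K ^ ?k" using K0 by (simp add: one_le_power)
  have 2: "pr V (\<lambda>x. \<exists>T\<in>A. satT T x \<and> \<not> eval_dnf (G T) x) \<le> (\<epsilon> / (4 * real K) ^ card Y) / 2"
  proof -
    have "pr V (\<lambda>x. \<exists>T\<in>A. satT T x \<and> \<not> eval_dnf (G T) x)
      \<le> (\<Sum>T\<in>A. pr V (\<lambda>x. satT T x \<and> \<not> eval_dnf (G T) x))" by (rule prob_UN_le[OF finA])
    also have "\<dots> \<le> (\<Sum>T\<in>A. \<epsilon> / (4 * real K) ^ k)"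
      using G TA(3) unfolding covered_by_def by (intro sum_mono) auto
    also have "\<dots> = real (K ^ ?k + 1) * (\<epsilon> / (4 * real K) ^ k)" using A(2) by simp
    also have "\<dots> \<le> 2 * real K ^ ?k * (\<epsilon> / (4 * real K) ^ k)" using two eps by (intro mult_right_mono) auto
    also have "\<dots> = 2 / 4 ^ ?k * (\<epsilon> / (4 * real K) ^ card Y)"
    proof -
      have "(4 * real K) ^ k = (4 * real K) ^ card Y * (4 ^ ?k * real K ^ ?k)"
        using cY power_add[of "4 * real K" "card Y" ?k] power_mult_distrib[of 4 "real K" ?k] by simp
      then show ?thesis using K0 by (simp add: field_simps)
    qed
    \<comment> \<open>Y is smaller than the terms of A, so the exponent is at least 1, and
      \<open>2 / 4\<close> is the other half of the budget.\<close>
    also have "\<dots> \<le> 1 / 2 * (\<epsilon> / (4 * real K) ^ card Y)"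
    proof (intro mult_right_mono)
      have "(4::real) ^ 1 \<le> 4 ^ ?k" using cY by (intro power_increasing) auto
      then show "2 / 4 ^ ?k \<le> (1 / 2 :: real)" by (simp add: divide_le_eq)
    qed (use eps in auto)
    finally show ?thesis by simp
  qed
  have "covered_by Y ?G"
    unfolding covered_by_def
  proof (intro conjI)
    show "?G \<subseteq> F" using G unfolding covered_by_def by blast
    have "card ?G \<le> (\<Sum>T\<in>A. card (G T))" by (rule card_UN_le[OF finA])
    also have "\<dots> \<le> (\<Sum>T\<in>A. (2 * K) ^ (w - k))"
      using G TA(3) unfolding covered_by_def by (intro sum_mono) auto
    also have "\<dots> = (K ^ ?k + 1) * (2 * K) ^ (w - k)" using A(2) by simp
    also have "\<dots> \<le> (2 * K) ^ ?k * (2 * K) ^ (w - k)"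
    proof (intro mult_right_mono)
      have "K ^ ?k \<ge> 1" using K0 by simp
      then have "K ^ ?k + 1 \<le> 2 ^ 1 * K ^ ?k" by simp
      also have "\<dots> \<le> 2 ^ ?k * K ^ ?k" using cY by (intro mult_right_mono power_increasing) auto
      finally show "K ^ ?k + 1 \<le> (2 * K) ^ ?k" by (simp add: power_mult_distrib)
    qed simp
    also have "\<dots> = (2 * K) ^ (w - card Y)" using cY kw by (subst power_add[symmetric]) simp
    finally show "card ?G \<le> (2 * K) ^ (w - card Y)" .
    have "pr V (\<lambda>x. satT Y x \<and> \<not> eval_dnf ?G x) \<le>
      pr V (\<lambda>x. (satT Y x \<and> (\<forall>T\<in>\<G>. \<not> satT T x)) \<or> (\<exists>T\<in>A. satT T x \<and> \<not> eval_dnf (G T) x))"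
    proof (rule measure_pmf.finite_measure_mono, safe)
      fix x assume x: "satT Y x" "\<not> eval_dnf ?G x" "\<not> (\<exists>T\<in>A. satT T x \<and> \<not> eval_dnf (G T) x)"
      fix T assume "T \<in> \<G>" "satT T x"
      then obtain S where S: "S \<in> A" "T = S - Y" unfolding \<G>_def by blast
      have "S = T \<union> Y" using S Y[OF S(1)] by blast
      then have "satT S x" using \<open>satT T x\<close> x(1) by (simp add: satT_Un)
      then have "eval_dnf (G S) x" using x(3) S(1) by blast
      then show False using x(2) S(1) unfolding eval_dnf_satT by blast
    qed auto
    also have "\<dots> \<le> pr V (\<lambda>x. satT Y x \<and> (\<forall>T\<in>\<G>. \<not> satT T x))
      + pr V (\<lambda>x. \<exists>T\<in>A. satT T x \<and> \<not> eval_dnf (G T) x)" by (rule prob_Un_le)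
    also have "\<dots> \<le> \<epsilon> / (4 * real K) ^ card Y" using 1 2 by simp
    finally show "pr V (\<lambda>x. satT Y x \<and> \<not> eval_dnf ?G x) \<le> \<epsilon> / (4 * real K) ^ card Y" .
  qed
  then show ?thesis unfolding good_def terms_on_def using Yt cY kw by auto
qed

text \<open>Otherwise the empty core lies in more than \<open>K ^ k\<close> minimal terms. Take a
  core of greatest size m that lies in more than \<open>K ^ (k - m)\<close> of them: since no larger
  core does, its links are spread, so \<open>core_good\<close> makes it good, against the minimality
  of the terms above it.\<close>

lemma card_minimal: "card (minimal k) \<le> K ^ k"
proof (rule ccontr)
  assume big: "\<not> card (minimal k) \<le> K ^ k"
  let ?N = "\<lambda>Y. card {T\<in>minimal k. Y \<subseteq> T}"
  let ?Q = "\<lambda>m. \<exists>Y. finite Y \<and> card Y = m \<and> m \<le> k \<and> K ^ (k - m) < ?N Y"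
  have Q0: "?Q 0" using big by (intro exI[of _ "{}"]) auto
  have Qk: "m \<le> k" if "?Q m" for m using that by blast
  define m where "m = (GREATEST m. ?Q m)"
  have m: "?Q m" unfolding m_def by (rule GreatestI_nat[where P = ?Q and k = 0, OF Q0]) (rule Qk)
  have mmax: "m' \<le> m" if "?Q m'" for m' unfolding m_def by (rule Greatest_le_nat[where P = ?Q, OF that]) (rule Qk)
  obtain Y where Y: "finite Y" "card Y = m" "m \<le> k" "K ^ (k - m) < ?N Y" using m by blast
  have fin: "finite {T\<in>minimal k. Y \<subseteq> T}" using finite_minimal by simp
  have Tk: "finite T" "card T = k" if "T \<in> minimal k" for T
    using that finite_good unfolding minimal_def by auto
  \<comment> \<open>For \<open>m = k\<close> the only candidate above Y is Y itself, and 1 does not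
    exceed \<open>K ^ 0\<close>.\<close>
  have mk: "m < k"
  proof (rule ccontr)
    assume "\<not> m < k"
    then have "m = k" using Y by simp
    have "T = Y" if "T \<in> minimal k" "Y \<subseteq> T" for T
      using card_subset_eq[OF Tk(1)[OF that(1)] that(2)] Tk(2)[OF that(1)] Y(2) \<open>m = k\<close> by simp
    then have "{T\<in>minimal k. Y \<subseteq> T} \<subseteq> {Y}" by blast
    then have "?N Y \<le> card {Y}" by (intro card_mono) auto
    then have "?N Y \<le> 1" by simp
    then show False using Y(4) \<open>m = k\<close> by simp
  qed
  \<comment> \<open>A subfamily of exactly this size keeps the cover of Y small, and it inherits all
    upper bounds on the number of terms above larger cores.\<close>
  have "K ^ (k - m) + 1 \<le> ?N Y" using Y(4) by simp
  then obtain A where A: "A \<subseteq> {T\<in>minimal k. Y \<subseteq> T}" "card A = K ^ (k - m) + 1"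
    by (rule obtain_subset_with_card_n)
  have YT: "Y \<subset> T" if "T \<in> A" for T
  proof -
    have "T \<in> minimal k" "Y \<subseteq> T" using that A(1) by auto
    moreover have "Y \<noteq> T" using Tk(2)[OF \<open>T \<in> minimal k\<close>] Y(2) mk by auto
    ultimately show ?thesis by blast
  qed
  have "good Y"
  proof (rule core_good[of A k])
    show "A \<subseteq> minimal k" using A(1) by auto
    show "card A = K ^ (k - card Y) + 1" using A(2) Y(2) by simp
    show "\<And>T. T \<in> A \<Longrightarrow> Y \<subset> T" by (rule YT)
    show "real (card {T\<in>A. Y \<union> Z \<subseteq> T}) \<le> real K ^ (k - card Y) / real K ^ card Z"
      if Z: "Z \<noteq> {}" "Z \<inter> Y = {}" for Z
    proof (cases "finite Z \<and> m + card Z \<le> k")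
      case True
      have cYZ: "card (Y \<union> Z) = m + card Z" using True Y Z(2) by (subst card_Un_disjoint) auto
      have cZ: "card Z > 0" using True Z(1) by (simp add: card_gt_0_iff)
      have "\<not> ?Q (m + card Z)" using mmax[of "m + card Z"] cZ by auto
      then have "?N (Y \<union> Z) \<le> K ^ (k - (m + card Z))" using cYZ True Y(1) by (meson finite_UnI not_less)
      moreover have "card {T\<in>A. Y \<union> Z \<subseteq> T} \<le> ?N (Y \<union> Z)"
        using A(1) finite_minimal by (intro card_mono) auto
      ultimately have "card {T\<in>A. Y \<union> Z \<subseteq> T} \<le> K ^ (k - m - card Z)" by simp
      then have "real (card {T\<in>A. Y \<union> Z \<subseteq> T}) \<le> real K ^ (k - m - card Z)"
        by (metis of_nat_le_iff of_nat_power)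
      also have "\<dots> = real K ^ (k - m) / real K ^ card Z"
        using True K0 by (intro power_diff) auto
      finally show ?thesis using Y(2) by simp
    next
      case False
      have z: "{T\<in>A. Y \<union> Z \<subseteq> T} = {}"
      proof (rule ccontr)
        assume "\<not> ?thesis"
        then obtain T where T: "T \<in> A" "Y \<union> Z \<subseteq> T" by blast
        have fT: "finite T" "card T = k" using Tk A(1) T(1) by auto
        have fZ: "finite Z" using T(2) fT(1) finite_subset by blast
        have "card (Y \<union> Z) = m + card Z" using fZ Y Z(2) by (subst card_Un_disjoint) auto
        then have "m + card Z \<le> k" using card_mono[OF fT(1) T(2)] fT(2) by simp
        then show False using False fZ by blast
      qed
      show ?thesis unfolding z by simp
    qed
  qed
  moreover obtain T where "T \<in> A" using A(2) by fastforce
  ultimately show False using YT A(1) unfolding minimal_def by blast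
qed

text \<open>Sizes and errors add up by levels: there are at most \<open>K ^ k\<close> minimal terms
  of size k, each with a part of at most \<open>(2 * K) ^ (w - k)\<close> terms and an error of at
  most \<open>\<epsilon> / (4 * K) ^ k\<close>. So every level contributes at most
  \<open>(2 * K) ^ w\<close> terms, and the gap is a geometric series with ratio 1/4.\<close>

lemma sparse_sandwich:
  obtains Fl Fu where "Fl \<subseteq> F" "Fu \<subseteq> terms_on I w"
    "card Fl \<le> (w + 1) * (2 * K) ^ w" "card Fu \<le> (w + 1) * (2 * K) ^ w"
    "\<And>x. eval_dnf Fl x \<Longrightarrow> eval_dnf F x" "\<And>x. eval_dnf F x \<Longrightarrow> eval_dnf Fu x"
    "pr V (\<lambda>x. eval_dnf Fu x \<and> \<not> eval_dnf Fl x) \<le> 2 * \<epsilon>"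
proof -
  define Fu where "Fu = (\<Union>k\<le>w. minimal k)"
  have ex: "\<exists>G. covered_by T G" if "T \<in> minimal k" for T k using that unfolding minimal_def good_def by blast
  then obtain G where G: "\<And>T k. T \<in> minimal k \<Longrightarrow> covered_by T (G T)" by metis
  define Fl where "Fl = (\<Union>T\<in>Fu. G T)"
  have finu: "finite Fu" unfolding Fu_def using finite_minimal by simp
  have Gs: "G T \<subseteq> F" "card (G T) \<le> (2 * K) ^ (w - k)"
    "pr V (\<lambda>x. satT T x \<and> \<not> eval_dnf (G T) x) \<le> \<epsilon> / (4 * real K) ^ k" if "T \<in> minimal k" for T k
    using G[OF that] that unfolding covered_by_def minimal_def by auto
  have min_ex: "\<exists>S\<in>Fu. S \<subseteq> T" if gT: "good T" for T
  proof -
    let ?P = "\<lambda>S. good S \<and> S \<subseteq> T"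
    obtain S where S: "?P S" and Smin: "\<And>S'. ?P S' \<Longrightarrow> card S \<le> card S'"
      using ex_has_least_nat[of ?P T card] gT by blast
    have "\<not> good Y" if YS: "Y \<subset> S" for Y
    proof
      assume "good Y"
      then have "card S \<le> card Y" using Smin S YS by blast
      then show False using psubset_card_mono[OF finite_good[of S] YS] S by simp
    qed
    then have "S \<in> minimal (card S)" using S unfolding minimal_def by blast
    moreover have "card S \<le> w" using S unfolding good_def terms_on_def by blast
    ultimately show ?thesis using S unfolding Fu_def by blast
  qed
  show ?thesis
  proof (rule that[of Fl Fu])
    show "Fl \<subseteq> F" unfolding Fl_def Fu_def using Gs(1) by blast
    show "Fu \<subseteq> terms_on I w" unfolding Fu_def minimal_def good_def by blast
    have "card Fu \<le> (\<Sum>k\<le>w. card (minimal k))" unfolding Fu_def by (rule card_UN_le) simp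
    also have "\<dots> \<le> (\<Sum>k\<le>w. (2 * K) ^ w)"
    proof (intro sum_mono)
      fix k assume "k \<in> {..w}"
      have "card (minimal k) \<le> K ^ k" by (rule card_minimal)
      also have "\<dots> \<le> (2 * K) ^ k" by (intro power_mono) auto
      also have "\<dots> \<le> (2 * K) ^ w" using \<open>k \<in> {..w}\<close> K0 by (intro power_increasing) auto
      finally show "card (minimal k) \<le> (2 * K) ^ w" .
    qed
    finally show "card Fu \<le> (w + 1) * (2 * K) ^ w" by simp
    have "Fl = (\<Union>k\<le>w. \<Union>T\<in>minimal k. G T)" unfolding Fl_def Fu_def by blast
    then have "card Fl \<le> (\<Sum>k\<le>w. card (\<Union>T\<in>minimal k. G T))" by (simp add: card_UN_le)
    also have "\<dots> \<le> (\<Sum>k\<le>w. (2 * K) ^ w)"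
    proof (intro sum_mono)
      fix k assume k: "k \<in> {..w}"
      have "card (\<Union>T\<in>minimal k. G T) \<le> (\<Sum>T\<in>minimal k. card (G T))" by (rule card_UN_le[OF finite_minimal])
      also have "\<dots> \<le> (\<Sum>T\<in>minimal k. (2 * K) ^ (w - k))" using Gs(2) by (intro sum_mono)
      also have "\<dots> \<le> K ^ k * (2 * K) ^ (w - k)" using card_minimal[of k] by simp
      also have "\<dots> \<le> (2 * K) ^ k * (2 * K) ^ (w - k)" by (intro mult_right_mono power_mono) auto
      also have "\<dots> = (2 * K) ^ w" using k by (subst power_add[symmetric]) simp
      finally show "card (\<Union>T\<in>minimal k. G T) \<le> (2 * K) ^ w" .
    qed
    finally show "card Fl \<le> (w + 1) * (2 * K) ^ w" by simp
    show "\<And>x. eval_dnf Fl x \<Longrightarrow> eval_dnf F x"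
      using \<open>Fl \<subseteq> F\<close> unfolding eval_dnf_satT by blast
    show "eval_dnf Fu x" if ev: "eval_dnf F x" for x
    proof -
      obtain T where T: "T \<in> F" "satT T x" using ev unfolding eval_dnf_satT by blast
      obtain S where "S \<in> Fu" "S \<subseteq> T" using min_ex[OF good_term[OF T(1)]] by blast
      then show ?thesis using satT_mono[of S T x] T(2) unfolding eval_dnf_satT by blast
    qed
    have "pr V (\<lambda>x. eval_dnf Fu x \<and> \<not> eval_dnf Fl x)
      \<le> pr V (\<lambda>x. \<exists>k\<in>{..w}. \<exists>T\<in>minimal k. satT T x \<and> \<not> eval_dnf (G T) x)"
      by (rule measure_pmf.finite_measure_mono) (unfold eval_dnf_satT Fl_def Fu_def, blast, simp)
    also have "\<dots> \<le> (\<Sum>k\<in>{..w}. pr V (\<lambda>x. \<exists>T\<in>minimal k. satT T x \<and> \<not> eval_dnf (G T) x))"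
      by (rule prob_UN_le) simp
    also have "\<dots> \<le> (\<Sum>k\<in>{..w}. \<epsilon> * (1 / 4) ^ k)"
    proof (intro sum_mono)
      fix k assume k: "k \<in> {..w}"
      have "pr V (\<lambda>x. \<exists>T\<in>minimal k. satT T x \<and> \<not> eval_dnf (G T) x)
        \<le> (\<Sum>T\<in>minimal k. pr V (\<lambda>x. satT T x \<and> \<not> eval_dnf (G T) x))"
        by (rule prob_UN_le[OF finite_minimal])
      also have "\<dots> \<le> (\<Sum>T\<in>minimal k. \<epsilon> / (4 * real K) ^ k)" by (intro sum_mono Gs(3))
      also have "\<dots> = real (card (minimal k)) * (\<epsilon> / (4 * real K) ^ k)" by simp
      also have "\<dots> \<le> real (K ^ k) * (\<epsilon> / (4 * real K) ^ k)"
        using card_minimal[of k] eps by (intro mult_right_mono) (auto simp del: of_nat_power)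
      also have "\<dots> = \<epsilon> * (1 / 4) ^ k" using K0 by (simp add: power_mult_distrib power_one_over)
      finally show "pr V (\<lambda>x. \<exists>T\<in>minimal k. satT T x \<and> \<not> eval_dnf (G T) x) \<le> \<epsilon> * (1 / 4) ^ k" .
    qed
    also have "\<dots> = \<epsilon> * (\<Sum>k\<le>w. (1 / 4) ^ k)" by (simp add: sum_distrib_left)
    also have "\<dots> \<le> \<epsilon> * 2"
    proof (intro mult_left_mono)
      have "(\<Sum>k\<le>w. (1 / 4 :: real) ^ k) = (1 - (1 / 4) ^ Suc w) / (1 - 1 / 4)"
        using sum_gp_strict[of "1 / 4 :: real" "Suc w"] by (simp only: lessThan_Suc_atMost) simp
      also have "\<dots> \<le> 1 / (1 - 1 / 4)"
        using zero_le_power[of "1 / 4 :: real" "Suc w"] by (intro divide_right_mono) linarith+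
      also have "\<dots> \<le> (2 :: real)" by simp
      finally show "(\<Sum>k\<le>w. (1 / 4 :: real) ^ k) \<le> 2" .
    qed (use eps in simp)
    finally show "pr V (\<lambda>x. eval_dnf Fu x \<and> \<not> eval_dnf Fl x) \<le> 2 * \<epsilon>" by simp
  qed
qed

end

section \<open>Composing random restrictions\<close>

definition restrict_dnf :: "dnf \<Rightarrow> nat set \<Rightarrow> (nat \<Rightarrow> bool) \<Rightarrow> dnf" where
  "restrict_dnf F L z = (\<lambda>T. T \<inter> (L \<times> UNIV)) ` {T\<in>F. satT (T - L \<times> UNIV) z}"

lemma eval_restrict_dnf: "eval_dnf (restrict_dnf F L z) y \<longleftrightarrow> eval_dnf F (merge L y z)"
proof -
  have "satT (T \<inter> (L \<times> UNIV)) y \<and> satT (T - L \<times> UNIV) z \<longleftrightarrow> satT T (merge L y z)" for T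
  proof -
    have "satT T x \<longleftrightarrow> (\<forall>p\<in>T. x (fst p) = snd p)" for T x by (auto simp: satT_def)
    then show ?thesis by (auto simp: merge_def mem_Times_iff)
  qed
  then show ?thesis unfolding eval_dnf_satT restrict_dnf_def by blast
qed

lemma restrict_dnf_terms_on:
  assumes "F \<subseteq> terms_on I v" "\<And>T. T \<in> F \<Longrightarrow> card (T \<inter> (L \<times> UNIV)) \<le> t"
  shows "restrict_dnf F L z \<subseteq> terms_on (I \<inter> L) t"
  using assms consistent_subset unfolding restrict_dnf_def terms_on_def by fastforce

lemma width_dnf_terms_on:
  assumes "finite I" "F \<subseteq> terms_on I w"
  shows "width_dnf I w F"
proof -
  have "finite T" if "T \<in> F" for T
    using assms that finite_subset[of T "I \<times> UNIV"] unfolding terms_on_def by auto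
  then show ?thesis
    using assms finite_subset[OF assms(2) finite_terms_on] unfolding width_dnf_def terms_on_def by auto
qed

lemma merge_merge: "merge (L1 \<inter> L) y (merge L1 z2 z1) = merge L1 (merge L y z2) z1"
  by (auto simp: merge_def)

lemma merge_merge_right: "merge L y (merge L u v) = merge L y v"
  by (auto simp: merge_def)

lemma merge_merge_left: "merge L (merge L u v) x = merge L u x"
  by (auto simp: merge_def)

text \<open>Redrawing some coordinates of a uniform point leaves it uniform. This equates the
  average error after a random restriction with the error before it, and it splits one restriction
  into two successive ones.\<close>

lemma unif_merge:
  assumes V: "finite V"
  shows "map_pmf (\<lambda>(y, z). merge L y z) (pair_pmf (unif V) (unif V)) = unif V"
proof -
  let ?U = "L \<inter> V" and ?W = "V - L \<inter> V"
  have split: "unif V = map_pmf (\<lambda>(u, v). merge ?U u v) (pair_pmf (unif ?U) (unif ?W))"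
    by (rule unif_split[OF V]) simp
  \<comment> \<open>Outside of V both points have the value \<open>undefined\<close>, so only
    \<open>L \<inter> V\<close> matters.\<close>
  have "map_pmf (\<lambda>(y, z). merge L y z) (pair_pmf (unif V) (unif V))
    = map_pmf (\<lambda>(y, z). merge ?U y z) (pair_pmf (unif V) (unif V))"
  proof (intro map_pmf_cong refl)
    fix p assume "p \<in> set_pmf (pair_pmf (unif V) (unif V))"
    then obtain y z where p: "p = (y, z)" "y \<in> cube V" "z \<in> cube V" by (auto simp: set_unif[OF V])
    have "merge L y z i = merge ?U y z i" for i
      using p(2,3) by (cases "i \<in> V") (auto simp: merge_def cube_def PiE_def extensional_def)
    then show "(\<lambda>(y, z). merge L y z) p = (\<lambda>(y, z). merge ?U y z) p" using p(1) by auto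
  qed
  also have "\<dots> = map_pmf (\<lambda>((u, v), (u', v')). merge ?U u v')
      (pair_pmf (pair_pmf (unif ?U) (unif ?W)) (pair_pmf (unif ?U) (unif ?W)))"
    by (subst (1 2) split)
      (simp add: map_pair[symmetric] map_pmf_comp case_prod_unfold merge_merge_left merge_merge_right)
  also have "\<dots> = map_pmf (\<lambda>(u, v). merge ?U u v) (pair_pmf (unif ?U) (unif ?W))"
    by (simp add: pair_pmf_def map_bind_pmf bind_assoc_pmf bind_return_pmf)
  also have "\<dots> = unif V" by (rule split[symmetric])
  finally show ?thesis .
qed

text \<open>The approximators are formulae over \<open>J\<close>, but their errors are measured on the whole cube \<open>V\<close>, so
  that the probability space does not change from stage to stage.\<close>

definition sandw ::
  "nat set \<Rightarrow> nat set \<Rightarrow> nat \<Rightarrow> real \<Rightarrow> ((nat \<Rightarrow> bool) \<Rightarrow> bool) \<Rightarrow> bool" where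
  "sandw V J s e g \<longleftrightarrow> (\<exists>Gl Gu. width_dnf J s Gl \<and> width_dnf J s Gu \<and>
     (\<forall>y. eval_dnf Gl y \<longrightarrow> g y) \<and> (\<forall>y. g y \<longrightarrow> eval_dnf Gu y) \<and>
     pr V (\<lambda>y. g y \<and> \<not> eval_dnf Gl y) \<le> e \<and> pr V (\<lambda>y. eval_dnf Gu y \<and> \<not> g y) \<le> e)"

text \<open>The values \<open>z\<close> are drawn on all of V although only those outside of L
  enter; successive restrictions then compose by \<open>merge\<close>. I stands for the variables
  that F may contain.\<close>

definition fails :: "nat set \<Rightarrow> nat set pmf \<Rightarrow> nat set \<Rightarrow> dnf \<Rightarrow> nat \<Rightarrow> real \<Rightarrow> real" where
  "fails V Q I F s e = measure_pmf.prob (pair_pmf Q (unif V))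
     {(L, z). \<not> sandw V (I \<inter> L) s e (\<lambda>y. eval_dnf F (merge L y z))}"

lemma sandw_exact: "width_dnf J s G \<Longrightarrow> 0 \<le> e \<Longrightarrow> sandw V J s e (eval_dnf G)"
  unfolding sandw_def by (intro exI[of _ G]) auto

lemma fails_narrow:
  assumes "finite I" "F \<subseteq> terms_on I s" "0 \<le> e"
  shows "fails V Q I F s e = 0"
proof -
  have "sandw V (I \<inter> L) s e (\<lambda>y. eval_dnf F (merge L y z))" for L z
  proof -
    have "card (T \<inter> (L \<times> UNIV)) \<le> s" if "T \<in> F" for T
    proof -
      have "finite T" using that assms finite_subset[of T "I \<times> UNIV"] by (auto simp: terms_on_def)
      then have "card (T \<inter> (L \<times> UNIV)) \<le> card T" by (intro card_mono) auto
      also have "\<dots> \<le> s" using that assms(2) by (auto simp: terms_on_def)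
      finally show ?thesis .
    qed
    then have "restrict_dnf F L z \<subseteq> terms_on (I \<inter> L) s" by (rule restrict_dnf_terms_on[OF assms(2)])
    then have "width_dnf (I \<inter> L) s (restrict_dnf F L z)" using assms(1) by (intro width_dnf_terms_on) auto
    then show ?thesis using sandw_exact[OF _ assms(3)] by (simp add: eval_restrict_dnf[symmetric])
  qed
  then have "{(L, z). \<not> sandw V (I \<inter> L) s e (\<lambda>y. eval_dnf F (merge L y z))} = {}" by auto
  then show ?thesis unfolding fails_def by (simp only: measure_empty)
qed

text \<open>A lower approximator of \<open>gl\<close> and an upper approximator of \<open>gu\<close>
  serve every function in between, at the price of the gap.\<close>

lemma sandw_between:
  assumes "sandw V J s e gl" "sandw V J s e gu"
    and "\<And>y. gl y \<Longrightarrow> g y" "\<And>y. g y \<Longrightarrow> gu y" "pr V (\<lambda>y. gu y \<and> \<not> gl y) \<le> e'"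
  shows "sandw V J s (e + e') g"
proof -
  obtain Gl where l: "width_dnf J s Gl" "\<And>y. eval_dnf Gl y \<Longrightarrow> gl y" "pr V (\<lambda>y. gl y \<and> \<not> eval_dnf Gl y) \<le> e"
    using assms(1) unfolding sandw_def by blast
  obtain Gu where u: "width_dnf J s Gu" "\<And>y. gu y \<Longrightarrow> eval_dnf Gu y" "pr V (\<lambda>y. eval_dnf Gu y \<and> \<not> gu y) \<le> e"
    using assms(2) unfolding sandw_def by blast
  have "pr V (\<lambda>y. g y \<and> \<not> eval_dnf Gl y) \<le> pr V (\<lambda>y. (gl y \<and> \<not> eval_dnf Gl y) \<or> (gu y \<and> \<not> gl y))"
    using assms(4) by (intro measure_pmf.finite_measure_mono) auto
  also have "\<dots> \<le> e + e'" using prob_Un_le[of "unif V"] l(3) assms(5) by (meson add_mono order_trans)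
  finally have 1: "pr V (\<lambda>y. g y \<and> \<not> eval_dnf Gl y) \<le> e + e'" .
  have "pr V (\<lambda>y. eval_dnf Gu y \<and> \<not> g y) \<le> pr V (\<lambda>y. (eval_dnf Gu y \<and> \<not> gu y) \<or> (gu y \<and> \<not> gl y))"
    using assms(3) by (intro measure_pmf.finite_measure_mono) auto
  also have "\<dots> \<le> e + e'" using prob_Un_le[of "unif V"] u(3) assms(5) by (meson add_mono order_trans)
  finally have 2: "pr V (\<lambda>y. eval_dnf Gu y \<and> \<not> g y) \<le> e + e'" .
  show ?thesis unfolding sandw_def using l(1,2) u(1,2) assms(3,4) 1 2 by blast
qed

section \<open>One halving step\<close>

lemma prob_pair_le:
  assumes "\<And>x. x \<in> set_pmf M \<Longrightarrow> measure_pmf.prob N {y. (x, y) \<in> A} \<le> c"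
  shows "measure_pmf.prob (pair_pmf M N) A \<le> c"
proof -
  have "measure_pmf.prob (pair_pmf M N) A = measure_pmf.expectation M (\<lambda>x. measure_pmf.prob N {y. (x, y) \<in> A})"
    by (rule prob_pair_pmf)
  also have "\<dots> \<le> measure_pmf.expectation M (\<lambda>_. c)"
  proof (rule integral_mono_AE)
    show "integrable M (\<lambda>x. measure_pmf.prob N {y. (x, y) \<in> A})"
      by (rule measure_pmf.integrable_const_bound[where B = 1]) (auto simp: measure_pmf.prob_le_1)
    show "integrable M (\<lambda>_. c)" by simp
  qed (auto simp: AE_measure_pmf_iff assms)
  finally show ?thesis by simp
qed

text \<open>By \<open>unif_merge\<close> the error averaged over z is the original error, so
  Markov's inequality applies.\<close>

lemma markov_restriction:
  assumes V: "finite V" and D: "pr V D \<le> d" and mu: "0 < \<mu>" and d: "0 < d"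
  shows "pr V (\<lambda>z. pr V (\<lambda>y. D (merge L y z)) > d / \<mu>) \<le> \<mu>"
proof -
  let ?X = "\<lambda>z. pr V (\<lambda>y. D (merge L y z))"
  have int: "integrable (unif V) f" for f :: "_ \<Rightarrow> real"
    by (rule integrable_measure_pmf_finite) (simp add: set_unif[OF V] finite_cube[OF V])
  have "d / \<mu> * pr V (\<lambda>z. ?X z > d / \<mu>) = measure_pmf.expectation (unif V) (\<lambda>z. d / \<mu> * indicator {z. ?X z > d / \<mu>} z)"
    by simp
  also have "\<dots> \<le> measure_pmf.expectation (unif V) ?X"
    using mu d by (intro integral_mono int) (auto simp: indicator_def)
  also have "\<dots> = measure_pmf.prob (pair_pmf (unif V) (unif V)) {(z, y). D (merge L y z)}"
    unfolding prob_pair_pmf by simp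
  also have "\<dots> = measure_pmf.prob (map_pmf (\<lambda>(y, z). merge L y z) (pair_pmf (unif V) (unif V))) {x. D x}"
    by (subst pair_commute_pmf) (simp add: vimage_def case_prod_unfold)
  also have "\<dots> = pr V D" by (simp only: unif_merge[OF V])
  also have "\<dots> \<le> d" by (rule D)
  finally show ?thesis using mu d by (simp add: field_simps)
qed

text \<open>A term with more than t live literals has t variables that are all live. So only the
  events \<open>W \<subseteq> L\<close> with \<open>card W = t\<close> enter, at most
  \<open>2 ^ v\<close> of them for each term; this is why approximate t-wise independence is
  enough.\<close>

lemma prob_wide:
  assumes F: "F \<subseteq> terms_on V v" and V: "finite V" and q0: "0 \<le> q"
    and q: "\<And>W. W \<subseteq> V \<Longrightarrow> card W = t \<Longrightarrow> measure_pmf.prob S {L. W \<subseteq> L} \<le> q"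
  shows "measure_pmf.prob S {L. \<exists>T\<in>F. card (T \<inter> (L \<times> UNIV)) > t} \<le> real (card F) * (2 ^ v * q)"
proof -
  have one: "measure_pmf.prob S {L. card (T \<inter> (L \<times> UNIV)) > t} \<le> 2 ^ v * q" if T: "T \<in> F" for T
  proof -
    have TV: "T \<subseteq> V \<times> UNIV" and cT: "consistent T" "card T \<le> v"
      using T F unfolding terms_on_def by auto
    have fT: "finite T" using finite_subset[OF TV] V by simp
    have sT: "fst ` T \<subseteq> V" using TV by force
    let ?W = "{W. W \<subseteq> fst ` T \<and> card W = t}"
    have finW: "finite ?W" using fT by (intro finite_subset[of ?W "Pow (fst ` T)"]) auto
    have "card ?W \<le> card (Pow (fst ` T))" using fT by (intro card_mono) auto
    also have "\<dots> \<le> 2 ^ v" using fT cT by (simp add: card_Pow card_fst_consistent)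
    finally have cW: "card ?W \<le> 2 ^ v" .
    have "measure_pmf.prob S {L. card (T \<inter> (L \<times> UNIV)) > t} \<le> measure_pmf.prob S {L. \<exists>W\<in>?W. W \<subseteq> L}"
    proof (rule measure_pmf.finite_measure_mono, rule subsetI)
      fix L assume "L \<in> {L. card (T \<inter> (L \<times> UNIV)) > t}"
      then have "t < card (fst ` (T \<inter> (L \<times> UNIV)))"
        using card_fst_consistent[OF consistent_subset[OF cT(1)], of "T \<inter> (L \<times> UNIV)"] by simp
      then obtain W where "W \<subseteq> fst ` (T \<inter> (L \<times> UNIV))" "card W = t"
        by (meson less_imp_le obtain_subset_with_card_n)
      then show "L \<in> {L. \<exists>W\<in>?W. W \<subseteq> L}" by (auto intro!: exI[of _ W])
    qed simp
    also have "\<dots> \<le> (\<Sum>W\<in>?W. measure_pmf.prob S {L. W \<subseteq> L})" by (rule prob_UN_le[OF finW])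
    also have "\<dots> \<le> (\<Sum>W\<in>?W. q)" using sT by (intro sum_mono q) auto
    also have "\<dots> = real (card ?W) * q" by simp
    also have "\<dots> \<le> real (2 ^ v) * q" using cW q0 by (intro mult_right_mono) (auto simp only: of_nat_le_iff)
    finally show ?thesis by simp
  qed
  have finF: "finite F" using F finite_subset finite_terms_on[OF V] by blast
  have "measure_pmf.prob S {L. \<exists>T\<in>F. card (T \<inter> (L \<times> UNIV)) > t}
    \<le> (\<Sum>T\<in>F. measure_pmf.prob S {L. card (T \<inter> (L \<times> UNIV)) > t})" by (rule prob_UN_le[OF finF])
  also have "\<dots> \<le> (\<Sum>T\<in>F. 2 ^ v * q)" by (intro sum_mono one)
  finally show ?thesis by simp
qed

text \<open>Values outside of L1 come from \<open>z1\<close> and the others from \<open>z2\<close>;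
  the mixture is again uniform, so a restriction to \<open>L1 \<inter> L\<close> can be performed in
  two steps.\<close>

lemma pair_split_restriction:
  assumes V: "finite V"
  shows "pair_pmf Q (unif V) =
    map_pmf (\<lambda>(z1, (L, z2)). (L, merge L1 z2 z1)) (pair_pmf (unif V) (pair_pmf Q (unif V)))"
proof -
  have "map_pmf (\<lambda>(z1, (L, z2)). (L, merge L1 z2 z1)) (pair_pmf (unif V) (pair_pmf Q (unif V)))
    = bind_pmf (unif V) (\<lambda>z1. bind_pmf Q (\<lambda>L. bind_pmf (unif V) (\<lambda>z2. return_pmf (L, merge L1 z2 z1))))"
    by (simp add: pair_pmf_def map_bind_pmf bind_assoc_pmf bind_return_pmf)
  also have "\<dots> = bind_pmf Q (\<lambda>L. bind_pmf (unif V) (\<lambda>z1. bind_pmf (unif V) (\<lambda>z2. return_pmf (L, merge L1 z2 z1))))"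
    by (rule bind_commute_pmf)
  also have "\<dots> = bind_pmf Q (\<lambda>L. map_pmf (Pair L) (map_pmf (\<lambda>(y, z). merge L1 y z) (pair_pmf (unif V) (unif V))))"
  proof (intro bind_pmf_cong refl)
    fix L
    have "bind_pmf (unif V) (\<lambda>z1. bind_pmf (unif V) (\<lambda>z2. return_pmf (L, merge L1 z2 z1)))
      = bind_pmf (unif V) (\<lambda>z2. bind_pmf (unif V) (\<lambda>z1. return_pmf (L, merge L1 z2 z1)))"
      by (rule bind_commute_pmf)
    then show "bind_pmf (unif V) (\<lambda>z1. bind_pmf (unif V) (\<lambda>z2. return_pmf (L, merge L1 z2 z1)))
      = map_pmf (Pair L) (map_pmf (\<lambda>(y, z). merge L1 y z) (pair_pmf (unif V) (unif V)))"
      by (simp add: pair_pmf_def map_bind_pmf bind_assoc_pmf bind_return_pmf)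
  qed
  also have "\<dots> = pair_pmf Q (unif V)"
    unfolding unif_merge[OF V] by (simp add: pair_pmf_def map_pmf_def)
  finally show ?thesis by simp
qed

lemma restricted_fails:
  assumes V: "finite V"
    and IH: "\<And>G. G \<subseteq> terms_on (I \<inter> L1) t \<Longrightarrow> fails V Q (I \<inter> L1) G s e \<le> \<beta>"
    and F: "F \<subseteq> terms_on I v" "\<And>T. T \<in> F \<Longrightarrow> card (T \<inter> (L1 \<times> UNIV)) \<le> t"
  shows "measure_pmf.prob (pair_pmf Q (unif V))
    {(L, z). \<not> sandw V (I \<inter> (L1 \<inter> L)) s e (\<lambda>y. eval_dnf F (merge (L1 \<inter> L) y z))} \<le> \<beta>"
proof -
  let ?G = "restrict_dnf F L1"
  have "measure_pmf.prob (pair_pmf Q (unif V))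
    {(L, z). \<not> sandw V (I \<inter> (L1 \<inter> L)) s e (\<lambda>y. eval_dnf F (merge (L1 \<inter> L) y z))}
    = measure_pmf.prob (pair_pmf (unif V) (pair_pmf Q (unif V)))
      {(z1, (L, z2)). \<not> sandw V (I \<inter> (L1 \<inter> L)) s e (\<lambda>y. eval_dnf (?G z1) (merge L y z2))}"
    by (subst pair_split_restriction[OF V, of Q L1])
      (simp add: vimage_def case_prod_unfold merge_merge eval_restrict_dnf)
  also have "\<dots> \<le> \<beta>"
  proof (rule prob_pair_le)
    fix z1
    have "?G z1 \<subseteq> terms_on (I \<inter> L1) t" by (rule restrict_dnf_terms_on[OF F])
    from IH[OF this] show "measure_pmf.prob (pair_pmf Q (unif V)) {y. (z1, y) \<in> {(z1, (L, z2)).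
      \<not> sandw V (I \<inter> (L1 \<inter> L)) s e (\<lambda>y. eval_dnf (?G z1) (merge L y z2))}} \<le> \<beta>"
      unfolding fails_def by (simp add: Int_assoc case_prod_unfold)
  qed
  finally show ?thesis .
qed

text \<open>There are three ways to fail. A term of one of the two sparse formulae stays wide under
  the first set, which gives the last summand. The gap between them exceeds
  \<open>2 * \<epsilon> / \<mu>\<close> under the whole restriction, with probability at most \<mu>.
  Or one of the two formulae, now of width t, is not approximable under the later restriction, which
  gives \<open>2 * \<beta>\<close>.\<close>

lemma fails_step:
  assumes V: "finite V" and I: "I \<subseteq> V" and F: "F \<subseteq> terms_on I (2 * t)"
    and sp: "sparsification V I F (2 * t) B K \<epsilon>"
    and q0: "0 \<le> q" and q: "\<And>W. W \<subseteq> V \<Longrightarrow> card W = t \<Longrightarrow> measure_pmf.prob S {L. W \<subseteq> L} \<le> q"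
    and IH: "\<And>I' G. I' \<subseteq> V \<Longrightarrow> G \<subseteq> terms_on I' t \<Longrightarrow> fails V Q I' G s e \<le> \<beta>"
    and mu: "0 < \<mu>"
  shows "fails V (map_pmf (\<lambda>(L1, L). L1 \<inter> L) (pair_pmf S Q)) I F s (e + 2 * \<epsilon> / \<mu>)
    \<le> 2 * \<beta> + \<mu> + 2 * (real ((2 * t + 1) * (2 * K) ^ (2 * t)) * (4 ^ t * q))"
proof -
  interpret sparsification V I F "2 * t" B K \<epsilon> by (rule sp)
  obtain Fl Fu where Fl: "Fl \<subseteq> F" and Fu: "Fu \<subseteq> terms_on I (2 * t)"
    and cFl: "card Fl \<le> (2 * t + 1) * (2 * K) ^ (2 * t)" and cFu: "card Fu \<le> (2 * t + 1) * (2 * K) ^ (2 * t)"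
    and le: "\<And>x. eval_dnf Fl x \<Longrightarrow> eval_dnf F x" "\<And>x. eval_dnf F x \<Longrightarrow> eval_dnf Fu x"
    and gap: "pr V (\<lambda>x. eval_dnf Fu x \<and> \<not> eval_dnf Fl x) \<le> 2 * \<epsilon>"
    by (rule sparse_sandwich, rule that; assumption)
  have Fl': "Fl \<subseteq> terms_on I (2 * t)" using Fl F by blast
  have IV: "terms_on I (2 * t) \<subseteq> terms_on V (2 * t)" using I unfolding terms_on_def by blast
  let ?D = "\<lambda>x. eval_dnf Fu x \<and> \<not> eval_dnf Fl x"
  let ?M = "pair_pmf S (pair_pmf Q (unif V))"
  let ?wide = "\<lambda>G L1. \<exists>T\<in>G. card (T \<inter> (L1 \<times> UNIV)) > t"
  let ?bad = "\<lambda>G e L1 L z. \<not> sandw V (I \<inter> (L1 \<inter> L)) s e (\<lambda>y. eval_dnf G (merge (L1 \<inter> L) y z))"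
  let ?far = "\<lambda>L1 L z. pr V (\<lambda>y. ?D (merge (L1 \<inter> L) y z)) > 2 * \<epsilon> / \<mu>"
  have mpair: "pair_pmf (map_pmf (\<lambda>(L1, L). L1 \<inter> L) (pair_pmf S Q)) (unif V)
    = map_pmf (\<lambda>(L1, (L, z)). (L1 \<inter> L, z)) ?M"
    by (simp add: pair_pmf_def map_pmf_def bind_assoc_pmf bind_return_pmf)
  have "fails V (map_pmf (\<lambda>(L1, L). L1 \<inter> L) (pair_pmf S Q)) I F s (e + 2 * \<epsilon> / \<mu>)
    = measure_pmf.prob ?M {m. case m of (L1, (L, z)) \<Rightarrow> ?bad F (e + 2 * \<epsilon> / \<mu>) L1 L z}"
    unfolding fails_def mpair by (simp add: vimage_def case_prod_unfold)
  also have "\<dots> \<le> measure_pmf.prob ?M {m. (((case m of (L1, (L, z)) \<Rightarrow> ?wide Fl L1) \<or> (case m of (L1, (L, z)) \<Rightarrow> ?wide Fu L1))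
      \<or> (case m of (L1, (L, z)) \<Rightarrow> ?far L1 L z))
      \<or> ((case m of (L1, (L, z)) \<Rightarrow> \<not> ?wide Fl L1 \<and> ?bad Fl e L1 L z)
        \<or> (case m of (L1, (L, z)) \<Rightarrow> \<not> ?wide Fu L1 \<and> ?bad Fu e L1 L z))}"
  proof (rule measure_pmf.finite_measure_mono, rule subsetI)
    fix m assume m: "m \<in> {m. case m of (L1, (L, z)) \<Rightarrow> ?bad F (e + 2 * \<epsilon> / \<mu>) L1 L z}"
    obtain L1 L z where e: "m = (L1, (L, z))" by (cases m) auto
    have "?far L1 L z \<or> ?bad Fl e L1 L z \<or> ?bad Fu e L1 L z"
    proof (rule ccontr)
      assume n: "\<not> ?thesis"
      have "sandw V (I \<inter> (L1 \<inter> L)) s (e + 2 * \<epsilon> / \<mu>) (\<lambda>y. eval_dnf F (merge (L1 \<inter> L) y z))"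
        by (rule sandw_between[where gl = "\<lambda>y. eval_dnf Fl (merge (L1 \<inter> L) y z)"
              and gu = "\<lambda>y. eval_dnf Fu (merge (L1 \<inter> L) y z)"]) (use n le in \<open>auto simp: not_less\<close>)
      then show False using m e by simp
    qed
    then show "m \<in> {m. (((case m of (L1, (L, z)) \<Rightarrow> ?wide Fl L1) \<or> (case m of (L1, (L, z)) \<Rightarrow> ?wide Fu L1))
      \<or> (case m of (L1, (L, z)) \<Rightarrow> ?far L1 L z))
      \<or> ((case m of (L1, (L, z)) \<Rightarrow> \<not> ?wide Fl L1 \<and> ?bad Fl e L1 L z)
        \<or> (case m of (L1, (L, z)) \<Rightarrow> \<not> ?wide Fu L1 \<and> ?bad Fu e L1 L z))}"
      unfolding e mem_Collect_eq prod.case by blast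
  qed simp
  also have "\<dots> \<le> (measure_pmf.prob ?M {m. case m of (L1, (L, z)) \<Rightarrow> ?wide Fl L1}
      + measure_pmf.prob ?M {m. case m of (L1, (L, z)) \<Rightarrow> ?wide Fu L1}
      + measure_pmf.prob ?M {m. case m of (L1, (L, z)) \<Rightarrow> ?far L1 L z})
      + (measure_pmf.prob ?M {m. case m of (L1, (L, z)) \<Rightarrow> \<not> ?wide Fl L1 \<and> ?bad Fl e L1 L z}
      + measure_pmf.prob ?M {m. case m of (L1, (L, z)) \<Rightarrow> \<not> ?wide Fu L1 \<and> ?bad Fu e L1 L z})"
    by (intro order_trans[OF prob_Un_le] add_mono order_refl)
  also have "\<dots> \<le> (real ((2 * t + 1) * (2 * K) ^ (2 * t)) * (4 ^ t * q)
      + real ((2 * t + 1) * (2 * K) ^ (2 * t)) * (4 ^ t * q) + \<mu>) + (\<beta> + \<beta>)"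
  proof (intro add_mono)
    have wide: "measure_pmf.prob ?M {m. case m of (L1, (L, z)) \<Rightarrow> ?wide G L1}
      \<le> real ((2 * t + 1) * (2 * K) ^ (2 * t)) * (4 ^ t * q)"
      if G: "G \<subseteq> terms_on I (2 * t)" "card G \<le> (2 * t + 1) * (2 * K) ^ (2 * t)" for G
    proof -
      have "measure_pmf.prob ?M {m. case m of (L1, (L, z)) \<Rightarrow> ?wide G L1}
        = measure_pmf.prob S {L1. ?wide G L1}"
        using prob_pair_indep[of S "pair_pmf Q (unif V)" "?wide G" "\<lambda>_. True"] by (simp add: case_prod_unfold)
      also have "\<dots> \<le> real (card G) * (2 ^ (2 * t) * q)"
        using G(1) IV by (intro prob_wide[OF _ V q0 q]) auto
      also have "\<dots> \<le> real ((2 * t + 1) * (2 * K) ^ (2 * t)) * (2 ^ (2 * t) * q)"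
        using G(2) q0 by (intro mult_right_mono) (simp_all only: of_nat_le_iff mult_nonneg_nonneg zero_le_power zero_le_numeral)
      finally show ?thesis by (simp add: power_mult)
    qed
    show "measure_pmf.prob ?M {m. case m of (L1, (L, z)) \<Rightarrow> ?wide Fl L1}
      \<le> real ((2 * t + 1) * (2 * K) ^ (2 * t)) * (4 ^ t * q)" by (rule wide[OF Fl' cFl])
    show "measure_pmf.prob ?M {m. case m of (L1, (L, z)) \<Rightarrow> ?wide Fu L1}
      \<le> real ((2 * t + 1) * (2 * K) ^ (2 * t)) * (4 ^ t * q)" by (rule wide[OF Fu cFu])
    show "measure_pmf.prob ?M {m. case m of (L1, (L, z)) \<Rightarrow> ?far L1 L z} \<le> \<mu>"
    proof (rule prob_pair_le)
      fix L1
      have "measure_pmf.prob (pair_pmf Q (unif V)) {(L, z). ?far L1 L z} \<le> \<mu>"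
      proof (rule prob_pair_le)
        fix L
        show "pr V (\<lambda>z. (L, z) \<in> {(L, z). ?far L1 L z}) \<le> \<mu>"
          using markov_restriction[OF V gap mu, of "L1 \<inter> L"] eps by simp
      qed
      then show "measure_pmf.prob (pair_pmf Q (unif V)) {y. (L1, y) \<in> {m. case m of (L1, (L, z)) \<Rightarrow> ?far L1 L z}} \<le> \<mu>"
        by (simp add: case_prod_unfold)
    qed
    \<comment> \<open>The induction hypothesis for the empty formula shows that \<beta> is not
      negative, as needed when a wide term makes the event empty.\<close>
    have b0: "0 \<le> \<beta>"
    proof -
      have "fails V Q {} {} s e \<le> \<beta>" by (rule IH) auto
      then show ?thesis unfolding fails_def by (meson measure_nonneg order_trans)
    qed
    have bad: "measure_pmf.prob ?M {m. case m of (L1, (L, z)) \<Rightarrow> \<not> ?wide G L1 \<and> ?bad G e L1 L z} \<le> \<beta>"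
      if G: "G \<subseteq> terms_on I (2 * t)" for G
    proof (rule prob_pair_le)
      fix L1
      show "measure_pmf.prob (pair_pmf Q (unif V)) {y. (L1, y) \<in>
        {m. case m of (L1, (L, z)) \<Rightarrow> \<not> ?wide G L1 \<and> ?bad G e L1 L z}} \<le> \<beta>"
      proof (cases "?wide G L1")
        case True
        then have e: "{y. (L1, y) \<in> {m. case m of (L1, (L, z)) \<Rightarrow> \<not> ?wide G L1 \<and> ?bad G e L1 L z}} = {}"
          by blast
        show ?thesis unfolding e using b0 by simp
      next
        case False
        have "measure_pmf.prob (pair_pmf Q (unif V)) {(L, z). ?bad G e L1 L z} \<le> \<beta>"
          by (rule restricted_fails[OF V IH G]) (use I False in \<open>auto simp: not_less\<close>)
        then show ?thesis using False by (simp add: case_prod_unfold)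
      qed
    qed
    show "measure_pmf.prob ?M {m. case m of (L1, (L, z)) \<Rightarrow> \<not> ?wide Fl L1 \<and> ?bad Fl e L1 L z} \<le> \<beta>"
      by (rule bad[OF Fl'])
    show "measure_pmf.prob ?M {m. case m of (L1, (L, z)) \<Rightarrow> \<not> ?wide Fu L1 \<and> ?bad Fu e L1 L z} \<le> \<beta>"
      by (rule bad[OF Fu])
  qed
  finally show ?thesis by linarith
qed

section \<open>From the cube on all variables to the live cube\<close>

lemma dep_eval_dnf: "\<forall>T\<in>G. T \<subseteq> J \<times> UNIV \<Longrightarrow> dep J (eval_dnf G)"
  unfolding dep_def
proof (intro allI impI)
  fix x y :: "nat \<Rightarrow> bool" assume G: "\<forall>T\<in>G. T \<subseteq> J \<times> UNIV" and xy: "\<forall>i\<in>J. x i = y i"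
  have "satT T x = satT T y" if "T \<in> G" for T
  proof -
    have "fst ` T \<subseteq> J" using G that by force
    then show ?thesis using dep_satT xy unfolding dep_def by blast
  qed
  then show "eval_dnf G x = eval_dnf G y" unfolding eval_dnf_satT by blast
qed

lemma pr_restrict:
  assumes V: "finite V" and L: "L \<subseteq> V" and R: "\<And>u v. R (merge L u v) = R u"
  shows "pr V R = pr L R"
proof -
  have "pr V R = measure_pmf.prob (pair_pmf (unif L) (unif (V - L))) {z. R (merge L (fst z) (snd z))}"
    by (subst unif_split[OF V L]) (simp add: vimage_def case_prod_unfold)
  also have "\<dots> = pr L R"
    using prob_pair_indep[of "unif L" "unif (V - L)" R "\<lambda>_. True"] by (simp add: R)
  finally show ?thesis .
qed

lemma pr_restrict_compl:
  assumes V: "finite V" and L: "L \<subseteq> V" and R: "\<And>u v. R (merge L u v) = R v"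
  shows "pr V R = pr (V - L) R"
proof -
  have "pr V R = measure_pmf.prob (pair_pmf (unif L) (unif (V - L))) {z. R (merge L (fst z) (snd z))}"
    by (subst unif_split[OF V L]) (simp add: vimage_def case_prod_unfold)
  also have "\<dots> = pr (V - L) R"
    using prob_pair_indep[of "unif L" "unif (V - L)" "\<lambda>_. True" R] by (simp add: R)
  finally show ?thesis .
qed

text \<open>Both approximators and the restricted function read live variables only, so the errors
  on the whole cube and on the live cube agree.\<close>

lemma sandw_imp_has_dnf_sandwich:
  assumes L: "L \<subseteq> {..<n}" and F: "width_dnf {..<n} w F" and x: "x \<in> cube ({..<n} - L)"
    and sw: "sandw {..<n} L s \<epsilon> (\<lambda>y. eval_dnf F (merge L y x))"
  shows "has_dnf_sandwich (live n (mk_restriction L x)) \<epsilon> s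
    (restrict_fun n (mk_restriction L x) (eval_dnf F))"
proof -
  let ?V = "{..<n}" and ?g = "\<lambda>y. eval_dnf F (merge L y x)"
  have lv: "live n (mk_restriction L x) = L" using L by (auto simp: live_def mk_restriction_def)
  have FV: "dep ?V (eval_dnf F)" using F by (intro dep_eval_dnf) (auto simp: width_dnf_def)
  have g: "restrict_fun n (mk_restriction L x) (eval_dnf F) = ?g"
    unfolding restrict_fun_def mk_restriction_def
    by (rule ext, rule FV[unfolded dep_def, rule_format]) (auto simp: merge_def)
  obtain Gl Gu where G: "width_dnf L s Gl" "width_dnf L s Gu"
      "\<And>y. eval_dnf Gl y \<Longrightarrow> ?g y" "\<And>y. ?g y \<Longrightarrow> eval_dnf Gu y"
      "pr ?V (\<lambda>y. ?g y \<and> \<not> eval_dnf Gl y) \<le> \<epsilon>" "pr ?V (\<lambda>y. eval_dnf Gu y \<and> \<not> ?g y) \<le> \<epsilon>"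
    using sw unfolding sandw_def by blast
  have inv: "eval_dnf H (merge L u v) = eval_dnf H u" if "width_dnf L s H" for H u v
    by (rule dep_eval_dnf[of H L, unfolded dep_def, rule_format])
      (use that in \<open>auto simp: width_dnf_def merge_def\<close>)
  have "pr ?V (\<lambda>y. ?g y \<and> \<not> eval_dnf Gl y) = pr L (\<lambda>y. ?g y \<and> \<not> eval_dnf Gl y)"
    by (rule pr_restrict[OF _ L]) (simp_all add: inv[OF G(1)] merge_merge_left)
  moreover have "{y. eval_dnf Gl y \<noteq> ?g y} = {y. ?g y \<and> \<not> eval_dnf Gl y}" using G(3) by auto
  moreover have "pr ?V (\<lambda>y. eval_dnf Gu y \<and> \<not> ?g y) = pr L (\<lambda>y. eval_dnf Gu y \<and> \<not> ?g y)"
    by (rule pr_restrict[OF _ L]) (simp_all add: inv[OF G(2)] merge_merge_left)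
  moreover have "{y. eval_dnf Gu y \<noteq> ?g y} = {y. eval_dnf Gu y \<and> \<not> ?g y}" using G(4) by auto
  ultimately have "sandwiching L \<epsilon> ?g (eval_dnf Gl) (eval_dnf Gu)"
    unfolding sandwiching_def using G(3-6) by (simp add: le_bool_def)
  then show ?thesis unfolding has_dnf_sandwich_def lv g using G(1,2) by blast
qed

text \<open>\<open>merge\<close> ignores the fixed values on live variables, so the random
  assignment may be extended to a uniform point of the whole cube.\<close>

lemma prob_random_restriction_le:
  assumes F: "width_dnf {..<n} w F" and D: "set_pmf D \<subseteq> Pow {..<n}"
  shows "measure_pmf.prob (random_restriction n D)
      {\<rho>. \<not> has_dnf_sandwich (live n \<rho>) \<epsilon> s (restrict_fun n \<rho> (eval_dnf F))}
    \<le> fails {..<n} D {..<n} F s \<epsilon>"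
proof -
  let ?V = "{..<n}"
  let ?R = "\<lambda>L z. \<not> sandw ?V L s \<epsilon> (\<lambda>y. eval_dnf F (merge L y z))"
  let ?B = "{\<rho>. \<not> has_dnf_sandwich (live n \<rho>) \<epsilon> s (restrict_fun n \<rho> (eval_dnf F))}"
  have "measure_pmf.prob (random_restriction n D) ?B
    = measure_pmf.expectation D (\<lambda>L. measure_pmf.prob (unif (?V - L)) (mk_restriction L -` ?B))"
    unfolding random_restriction_def prob_bind_pmf by simp
  also have "\<dots> \<le> measure_pmf.expectation D (\<lambda>L. pr ?V (\<lambda>z. (L, z) \<in>
      {(L, z). \<not> sandw ?V (?V \<inter> L) s \<epsilon> (\<lambda>y. eval_dnf F (merge L y z))}))"
  proof (intro integral_mono_AE measure_pmf.integrable_const_bound[where B = 1])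
    show "AE L in D. measure_pmf.prob (unif (?V - L)) (mk_restriction L -` ?B)
      \<le> pr ?V (\<lambda>z. (L, z) \<in> {(L, z). \<not> sandw ?V (?V \<inter> L) s \<epsilon> (\<lambda>y. eval_dnf F (merge L y z))})"
      unfolding AE_measure_pmf_iff
    proof
      fix L assume "L \<in> set_pmf D"
      then have L: "L \<subseteq> ?V" using D by blast
      then have VL: "?V \<inter> L = L" by blast
      have "measure_pmf.prob (unif (?V - L)) (mk_restriction L -` ?B) \<le> pr (?V - L) (?R L)"
        by (rule prob_mono_set_pmf)
          (use sandw_imp_has_dnf_sandwich[OF L F] in \<open>auto simp: set_unif\<close>)
      also have "\<dots> = pr ?V (?R L)"
        by (rule pr_restrict_compl[OF _ L, symmetric]) (simp_all add: merge_merge_right)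
      finally show "measure_pmf.prob (unif (?V - L)) (mk_restriction L -` ?B)
        \<le> pr ?V (\<lambda>z. (L, z) \<in> {(L, z). \<not> sandw ?V (?V \<inter> L) s \<epsilon> (\<lambda>y. eval_dnf F (merge L y z))})"
        by (simp add: VL)
    qed
  qed (auto simp: measure_pmf.prob_le_1)
  also have "\<dots> = fails ?V D ?V F s \<epsilon>" unfolding fails_def prob_pair_pmf ..
  finally show ?thesis .
qed

section \<open>The sampler as a program\<close>

text \<open>An upper bound in place of the exact number of steps lets the bounds for branches and
  loops compose.\<close>

definition runs :: "com \<Rightarrow> state \<Rightarrow> nat \<Rightarrow> state \<Rightarrow> bool" where
  "runs C st T st' \<longleftrightarrow> (\<exists>t\<le>T. exec C st t st')"

text \<open>Loop-free programs are executed symbolically: the simplifier evaluates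
  \<open>result\<close> and \<open>cost\<close>.\<close>

fun straight :: "com \<Rightarrow> bool" where
  "straight (Seq P Q) \<longleftrightarrow> straight P \<and> straight Q"
| "straight (Ite i P Q) \<longleftrightarrow> straight P \<and> straight Q"
| "straight (While i P) \<longleftrightarrow> False"
| "straight _ \<longleftrightarrow> True"

fun result :: "com \<Rightarrow> state \<Rightarrow> state" where
  "result (SetC i c) (R, M) = (R(i := c), M)"
| "result (Add i j k) (R, M) = (R(i := R j + R k), M)"
| "result (Sub i j k) (R, M) = (R(i := R j - R k), M)"
| "result (Load i j) (R, M) = (R(i := M (R j)), M)"
| "result (Store i j) (R, M) = (R, M(R i := R j))"
| "result (Seq P Q) st = result Q (result P st)"
| "result (Ite i P Q) st = (if fst st i \<noteq> 0 then result P st else result Q st)"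
| "result (While i P) st = st"

fun cost :: "com \<Rightarrow> nat" where
  "cost (Seq P Q) = cost P + cost Q"
| "cost (Ite i P Q) = max (cost P) (cost Q) + 1"
| "cost (While i P) = 0"
| "cost _ = 1"

lemma runs_one: "exec C st 1 st' \<Longrightarrow> runs C st 1 st'"
  unfolding runs_def by blast

lemma runs_Seq: "runs P st T st1 \<Longrightarrow> runs Q st1 T' st2 \<Longrightarrow> runs (Seq P Q) st (T + T') st2"
  unfolding runs_def by (meson add_mono exec.Seq)

lemma runs_mono: "runs P st T st1 \<Longrightarrow> T \<le> T' \<Longrightarrow> runs P st T' st1"
  unfolding runs_def by (meson order_trans)

lemma runs_IteT: "fst st i \<noteq> 0 \<Longrightarrow> runs P st T st' \<Longrightarrow> runs (Ite i P Q) st (T + 1) st'"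
  unfolding runs_def by (metis add_le_mono1 exec.IteT)

lemma runs_IteF: "fst st i = 0 \<Longrightarrow> runs Q st T st' \<Longrightarrow> runs (Ite i P Q) st (T + 1) st'"
  unfolding runs_def by (metis add_le_mono1 exec.IteF)

lemma runs_straight: "straight C \<Longrightarrow> runs C st (cost C) (result C st)"
proof (induction C arbitrary: st)
  case (SetC i c)
  show ?case using runs_one[OF exec.SetC] by (cases st) simp
next
  case (Add i j k)
  show ?case using runs_one[OF exec.Add] by (cases st) simp
next
  case (Sub i j k)
  show ?case using runs_one[OF exec.Sub] by (cases st) simp
next
  case (Load i j)
  show ?case using runs_one[OF exec.Load] by (cases st) simp
next
  case (Store i j)
  show ?case using runs_one[OF exec.Store] by (cases st) simp
next
  case (Seq P Q)
  have "runs (Seq P Q) st (cost P + cost Q) (result Q (result P st))"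
    by (rule runs_Seq[OF Seq.IH(1) Seq.IH(2)]) (use Seq.prems in simp_all)
  then show ?case by simp
next
  case (Ite i P Q)
  show ?case
  proof (cases "fst st i = 0")
    case True
    have "runs (Ite i P Q) st (cost Q + 1) (result Q st)" using Ite True by (intro runs_IteF) auto
    then show ?thesis using True by (auto elim: runs_mono)
  next
    case False
    have "runs (Ite i P Q) st (cost P + 1) (result P st)" using Ite False by (intro runs_IteT) auto
    then show ?thesis using False by (auto elim: runs_mono)
  qed
qed simp

lemma runs_straightI: "straight C \<Longrightarrow> cost C \<le> T \<Longrightarrow> result C st = st' \<Longrightarrow> runs C st T st'"
  using runs_straight[of C st] unfolding runs_def by (blast intro: order_trans)

text \<open>Each of the N rounds takes at most T steps and one test, and a last test ends the loop.
  The induction is on the number of rounds that are left.\<close>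

lemma while_inv:
  assumes "Inv 0 st"
    and step: "\<And>i st. i < N \<Longrightarrow> Inv i st \<Longrightarrow> fst st c \<noteq> 0 \<and> (\<exists>st'. runs body st T st' \<and> Inv (Suc i) st')"
    and fin: "\<And>st. Inv N st \<Longrightarrow> fst st c = 0"
  shows "\<exists>st'. runs (While c body) st (N * (T + 1) + 1) st' \<and> Inv N st'"
proof -
  have "\<exists>st'. runs (While c body) st (d * (T + 1) + 1) st' \<and> Inv N st'" if "d \<le> N" "Inv (N - d) st" for d st
    using that
  proof (induction d arbitrary: st)
    case 0
    then have "exec (While c body) st 1 st" using fin by (intro exec.WhileF) simp
    then show ?case using 0 unfolding runs_def by (intro exI[of _ st] conjI exI[of _ 1]) auto
  next
    case (Suc d)
    then have "N - Suc d < N" by simp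
    from step[OF this Suc.prems(2)] obtain st' where
      st': "fst st c \<noteq> 0" "runs body st T st'" "Inv (Suc (N - Suc d)) st'" by blast
    have "Suc (N - Suc d) = N - d" using Suc.prems by simp
    then obtain st'' where st'': "runs (While c body) st' (d * (T + 1) + 1) st''" "Inv N st''"
      using Suc.IH[of st'] Suc.prems st' by auto
    obtain t t' where t: "t \<le> T" "exec body st t st'" "t' \<le> d * (T + 1) + 1" "exec (While c body) st' t' st''"
      using st' st'' unfolding runs_def by blast
    have "exec (While c body) st (t + t' + 1) st''" by (rule exec.WhileT[OF st'(1) t(2,4)])
    moreover have "t + t' + 1 \<le> Suc d * (T + 1) + 1" using t by simp
    ultimately show ?case using st''(2) unfolding runs_def by blast
  qed
  from this[of N st] show ?thesis using assms(1) by simp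
qed

lemma while_straight:
  assumes body: "straight body" "cost body \<le> T" and init: "Inv 0 R M"
    and step: "\<And>i R M. i < N \<Longrightarrow> Inv i R M \<Longrightarrow>
      R c \<noteq> 0 \<and> Inv (Suc i) (fst (result body (R, M))) (snd (result body (R, M)))"
    and fin: "\<And>R M. Inv N R M \<Longrightarrow> R c = 0"
  shows "\<exists>R' M'. runs (While c body) (R, M) (N * (T + 1) + 1) (R', M') \<and> Inv N R' M'"
proof -
  have "\<exists>st'. runs (While c body) (R, M) (N * (T + 1) + 1) st' \<and> Inv N (fst st') (snd st')"
  proof (rule while_inv[where Inv = "\<lambda>i st. Inv i (fst st) (snd st)"])
    fix i st assume i: "i < N" "Inv i (fst st) (snd st)"
    obtain R' M' where st: "st = (R', M')" by (cases st)
    have "runs body st T (result body st)" by (rule runs_straightI[OF body refl])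
    then show "fst st c \<noteq> 0 \<and> (\<exists>st'. runs body st T st' \<and> Inv (Suc i) (fst st') (snd st'))"
      using step[of i R' M'] i unfolding st fst_conv snd_conv
      by (intro conjI exI[of _ "result body (R', M')"]) blast+
  qed (use init fin in auto)
  then show ?thesis by (metis prod.collapse)
qed

lemma while_rule:
  assumes init: "Inv 0 R M"
    and pos: "\<And>i R M. i < N \<Longrightarrow> Inv i R M \<Longrightarrow> R c \<noteq> 0"
    and step: "\<And>i R M. i < N \<Longrightarrow> Inv i R M \<Longrightarrow> \<exists>R' M'. runs body (R, M) T (R', M') \<and> Inv (Suc i) R' M'"
    and fin: "\<And>R M. Inv N R M \<Longrightarrow> R c = 0"
  shows "\<exists>R' M'. runs (While c body) (R, M) (N * (T + 1) + 1) (R', M') \<and> Inv N R' M'"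
proof -
  have "\<exists>st'. runs (While c body) (R, M) (N * (T + 1) + 1) st' \<and> Inv N (fst st') (snd st')"
  proof (rule while_inv[where Inv = "\<lambda>i st. Inv i (fst st) (snd st)"])
    fix i st assume i: "i < N" "Inv i (fst st) (snd st)"
    obtain R' M' where st: "st = (R', M')" by (cases st)
    then obtain R'' M'' where "runs body st T (R'', M'')" "Inv (Suc i) R'' M''"
      using step[of i R' M'] i by auto
    then show "fst st c \<noteq> 0 \<and> (\<exists>st'. runs body st T st' \<and> Inv (Suc i) (fst st') (snd st'))"
      using pos[OF i] by (intro conjI exI[of _ "(R'', M'')"]) simp_all
  qed (use init fin in auto)
  then show ?thesis by (metis prod.collapse)
qed

text \<open>Register 41 is never read, so \<open>SetC 41 0\<close> acts as the empty program, here
  and in the branches of \<open>main_prog\<close>.\<close>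

fun seqs :: "com list \<Rightarrow> com" where
  "seqs [] = SetC 41 0"
| "seqs [c] = c"
| "seqs (c # cs) = Seq c (seqs cs)"

text \<open>The binary logarithm rounded up, as a doubling loop finds it; the values at 0 and 1 are
  0.\<close>

definition clog :: "nat \<Rightarrow> nat" where
  "clog x = (LEAST q. x \<le> 2 ^ q)"

lemma le_power_clog: "x \<le> 2 ^ clog x"
  unfolding clog_def by (rule LeastI[of _ x]) (simp add: less_imp_le)

lemma clog_least: "q < clog x \<Longrightarrow> 2 ^ q < x"
  unfolding clog_def using not_less_Least[of q "\<lambda>q. x \<le> 2 ^ q"] by simp

abbreviation same :: "nat set \<Rightarrow> (nat \<Rightarrow> nat) \<Rightarrow> (nat \<Rightarrow> nat) \<Rightarrow> bool" where
  "same A R R' \<equiv> (\<forall>j. j \<notin> A \<longrightarrow> R' j = R j)"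

text \<open>Registers: 0--7 the parameters \<open>n, w, s, e, dlt, m, k, r\<close>; 8 the constant 1; 9 \<open>b\<close>;
  10 \<open>clog n\<close>; 11 \<open>t\<close>; 12 \<open>4 * 2 ^ j\<close>; 13 the position in the seed; 14 the sum of the \<open>a\<close>;
  15 \<open>a\<close>; 16 the lower bound for \<open>N\<close>; 17 \<open>N\<close>; 18 the condition of the main loop; 19 and 20 the
  addresses of the current power and of a buffer; 30, 33, 34 the addresses of \<open>x\<close>, \<open>y\<close>, \<open>u\<close>;
  40 is never written and holds 0.\<close>

definition clog_prog :: com where
  "clog_prog = seqs [SetC 21 1, Sub 22 23 21,
     While 22 (seqs [Add 21 21 21, Add 25 25 24, Sub 22 23 21])]"

text \<open>Adding register 24 in every round accumulates a multiple of the logarithm, so the factor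
  48 of \<open>b\<close> needs no multiplication.\<close>

lemma runs_clog_prog:
  "\<exists>R'. runs clog_prog (R, M) (4 * clog (R 23) + 3) (R', M) \<and>
    R' 25 = R 25 + clog (R 23) * R 24 \<and> same {21, 22, 25} R R'"
proof -
  let ?body = "seqs [Add 21 21 21, Add 25 25 24, Sub 22 23 21]"
  let ?x = "R 23" and ?R0 = "R(21 := 1, 22 := R 23 - 1)"
  let ?Inv = "\<lambda>i R' M'. M' = M \<and> same {21, 22, 25} R R' \<and> R' 21 = 2 ^ i \<and>
    R' 25 = R 25 + i * R 24 \<and> R' 22 = ?x - 2 ^ i"
  have "\<exists>R' M'. runs (While 22 ?body) (?R0, M) (clog ?x * (3 + 1) + 1) (R', M') \<and> ?Inv (clog ?x) R' M'"
  proof (rule while_straight[where Inv = ?Inv])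
    fix i R' M' assume i: "i < clog ?x" and inv: "?Inv i R' M'"
    show "R' 22 \<noteq> 0 \<and> ?Inv (Suc i) (fst (result ?body (R', M'))) (snd (result ?body (R', M')))"
      using clog_least[OF i] inv by simp
  qed (use le_power_clog[of ?x] in auto)
  then obtain R' where R': "runs (While 22 ?body) (?R0, M) (clog ?x * (3 + 1) + 1) (R', M)"
    "?Inv (clog ?x) R' M" by blast
  have "runs clog_prog (R, M) (1 + (1 + (clog ?x * (3 + 1) + 1))) (R', M)"
    unfolding clog_prog_def seqs.simps
    by (rule runs_Seq[OF runs_straightI[OF _ _ refl] runs_Seq[OF runs_straightI[OF _ _ refl]]])
      (use R'(1) in simp_all)
  then have "runs clog_prog (R, M) (4 * clog ?x + 3) (R', M)" by (rule runs_mono) simp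
  then show ?thesis using R'(2) by blast
qed

section \<open>Inner products and cyclic products in memory\<close>

definition bits_at :: "(nat \<Rightarrow> nat) \<Rightarrow> nat \<Rightarrow> nat \<Rightarrow> (nat \<Rightarrow> bool) \<Rightarrow> bool" where
  "bits_at M p N v \<longleftrightarrow> (\<forall>i<N. M (p + i) = of_bool (v i))"

text \<open>Register 24 holds the parity, flipped by subtracting it from 1. The index into the
  second vector starts at register 23 and wraps around at N: start 0 gives an inner product, other
  starts give the coefficients of a cyclic product. After N rounds the index is back where it
  began.\<close>

definition dot_prog :: com where
  "dot_prog = seqs [SetC 24 0, Add 25 17 40, Add 26 19 40,
     While 25 (seqs [Load 27 26,
       Ite 27 (seqs [Add 28 22 23, Load 27 28, Ite 27 (Sub 24 8 24) (SetC 27 0)]) (SetC 27 0),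
       Add 26 26 8, Add 23 23 8, Sub 29 17 23, Ite 29 (SetC 29 0) (SetC 23 0), Sub 25 25 8])]"

lemma card_less_Suc: "card {i. i < Suc n \<and> P i} = card {i. i < n \<and> P i} + of_bool (P n)"
proof -
  have "{i. i < Suc n \<and> P i} = (if P n then insert n {i. i < n \<and> P i} else {i. i < n \<and> P i})"
    by (auto simp: less_Suc_eq)
  then show ?thesis by auto
qed

lemma runs_dot_prog:
  assumes R: "R 17 = N" "R 8 = 1" "R 40 = 0" "R 19 = A" "R 22 = B" "R 23 = p" and p: "p < N"
    and c: "bits_at M A N c" and y: "bits_at M B N y" and Z: "N \<le> Z" "1 \<le> Z"
  shows "\<exists>R'. runs dot_prog (R, M) (20 * Z) (R', M) \<and> same {23, 24, 25, 26, 27, 28, 29} R R' \<and>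
    R' 23 = p \<and> R' 24 = of_bool (odd (card {i. i < N \<and> c i \<and> y ((p + i) mod N)}))"
proof -
  let ?body = "seqs [Load 27 26,
       Ite 27 (seqs [Add 28 22 23, Load 27 28, Ite 27 (Sub 24 8 24) (SetC 27 0)]) (SetC 27 0),
       Add 26 26 8, Add 23 23 8, Sub 29 17 23, Ite 29 (SetC 29 0) (SetC 23 0), Sub 25 25 8]"
  let ?S = "{23, 24, 25, 26, 27, 28, 29}"
  let ?R0 = "R(24 := 0, 25 := N, 26 := A)"
  let ?P = "\<lambda>i. c i \<and> y ((p + i) mod N)"
  let ?Inv = "\<lambda>i R' M'. M' = M \<and> same ?S R R' \<and> R' 25 = N - i \<and> R' 26 = A + i \<and>
    R' 23 = (p + i) mod N \<and> R' 24 = of_bool (odd (card {i'. i' < i \<and> ?P i'}))"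
  have "\<exists>R' M'. runs (While 25 ?body) (?R0, M) (N * (12 + 1) + 1) (R', M') \<and> ?Inv N R' M'"
  proof (rule while_straight[where Inv = ?Inv])
    show "?Inv 0 ?R0 M" using R p by auto
    fix i R' M' assume i: "i < N" and inv: "?Inv i R' M'"
    have v: "R' 17 = N" "R' 8 = 1" "R' 22 = B" using inv R by simp_all
    have c': "M (A + i) = of_bool (c i)" using c i unfolding bits_at_def by blast
    have "(p + i) mod N < N" using i by simp
    then have y': "M (B + (p + i) mod N) = of_bool (y ((p + i) mod N))" using y unfolding bits_at_def by blast
    have step: "(p + Suc i) mod N = (if Suc ((p + i) mod N) < N then Suc ((p + i) mod N) else 0)"
      using \<open>(p + i) mod N < N\<close> by (auto simp: mod_Suc)
    have odd: "odd (card {i'. i' < Suc i \<and> ?P i'}) = (odd (card {i'. i' < i \<and> ?P i'}) \<noteq> ?P i)"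
      unfolding card_less_Suc by (cases "c i"; cases "y ((p + i) mod N)") simp_all
    show "R' 25 \<noteq> 0 \<and> ?Inv (Suc i) (fst (result ?body (R', M'))) (snd (result ?body (R', M')))"
      unfolding step odd using inv v c' y' i by (cases "c i"; cases "y ((p + i) mod N)") simp_all
  qed auto
  then obtain R' where R': "runs (While 25 ?body) (?R0, M) (N * (12 + 1) + 1) (R', M)" "?Inv N R' M" by blast
  have "runs dot_prog (R, M) (1 + (1 + (1 + (N * (12 + 1) + 1)))) (R', M)"
    unfolding dot_prog_def seqs.simps
    by (rule runs_Seq[OF runs_straightI[OF _ _ refl]
          runs_Seq[OF runs_straightI[OF _ _ refl] runs_Seq[OF runs_straightI[OF _ _ refl]]]])
      (use R R'(1) in simp_all)
  then have "runs dot_prog (R, M) (20 * Z) (R', M)" by (rule runs_mono) (use Z in simp)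
  then show ?thesis using R'(2) p by (intro exI[of _ R']) simp
qed

lemma all_less_Suc: "(\<forall>l<Suc i. P l) \<longleftrightarrow> (\<forall>l<i. P l) \<and> P i"
  by (auto simp: less_Suc_eq)

lemma runs_prefixI:
  assumes "straight P" "cost P \<le> T1" "result P st = st1" "runs Q st1 T st'" "T1 + T \<le> T'"
  shows "runs (Seq P Q) st T' st'"
  using runs_mono[OF runs_Seq[OF runs_straightI[OF assms(1-3)] assms(4)] assms(5)] .

text \<open>Coefficient l uses the starting index \<open>(N - l) mod N\<close>, so the start runs
  backwards through one cycle. The result goes to a buffer because every coefficient reads all of
  the old vector.\<close>

definition conv_prog :: com where
  "conv_prog = Seq (seqs [Add 22 30 40, Add 31 17 40, Add 32 20 40, SetC 23 0])
     (While 31 (Seq dot_prog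
       (seqs [Store 32 24, Add 32 32 8, Ite 23 (Sub 23 23 8) (Sub 23 17 8), Sub 31 31 8])))"

lemma runs_conv_prog:
  assumes R: "R 17 = N" "R 8 = 1" "R 40 = 0" "R 19 = A" "R 20 = B" "R 30 = X"
    and c: "bits_at M A N c" and x: "bits_at M X N x" and lay: "A + N \<le> B" "X + N \<le> B"
    and Z: "N \<le> Z" "2 \<le> Z"
  shows "\<exists>R' M'. runs conv_prog (R, M) (30 * Z ^ 2) (R', M') \<and>
    same {22, 23, 24, 25, 26, 27, 28, 29, 31, 32} R R' \<and> (\<forall>j<B. M' j = M j) \<and>
    bits_at M' B N (\<lambda>l. odd (card {i. i < N \<and> c i \<and> x ((i + (N - l)) mod N)}))"
proof -
  let ?S = "{22, 23, 24, 25, 26, 27, 28, 29, 31, 32}"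
  define v where "v = (\<lambda>l. odd (card {i. i < N \<and> c i \<and> x ((i + (N - l)) mod N)}))"
  let ?post = "seqs [Store 32 24, Add 32 32 8, Ite 23 (Sub 23 23 8) (Sub 23 17 8), Sub 31 31 8]"
  let ?R0 = "R(22 := X, 31 := N, 32 := B, 23 := 0)"
  define Inv where "Inv = (\<lambda>i R' M'. same ?S R R' \<and> R' 22 = X \<and> R' 31 = N - i \<and> R' 32 = B + i \<and>
    R' 23 = (N - i) mod N \<and> (\<forall>j<B. M' j = M j) \<and> (\<forall>l<i. M' (B + l) = of_bool (v l)))"
  have "\<exists>R' M'. runs (While 31 (Seq dot_prog ?post)) (?R0, M) (N * ((20 * Z + 5) + 1) + 1) (R', M') \<and> Inv N R' M'"
  proof (rule while_rule)
    show "Inv 0 ?R0 M" by (simp add: Inv_def)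
    fix i R1 M1 assume i: "i < N" and inv: "Inv i R1 M1"
    show "R1 31 \<noteq> 0" using inv i by (simp add: Inv_def)
    have M1: "\<forall>j<B. M1 j = M j" using inv by (simp add: Inv_def)
    have r1: "R1 17 = N" "R1 8 = 1" "R1 40 = 0" "R1 19 = A" "R1 22 = X" "R1 23 = (N - i) mod N"
      using inv R by (simp_all add: Inv_def)
    have c1: "bits_at M1 A N c" using c M1 lay unfolding bits_at_def by simp
    have x1: "bits_at M1 X N x" using x M1 lay unfolding bits_at_def by simp
    have p1: "(N - i) mod N < N" using i by simp
    have Z1: "1 \<le> Z" using Z by simp
    obtain R2 where R2: "runs dot_prog (R1, M1) (20 * Z) (R2, M1)"
      "same {23, 24, 25, 26, 27, 28, 29} R1 R2" "R2 23 = (N - i) mod N"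
      "R2 24 = of_bool (odd (card {i'. i' < N \<and> c i' \<and> x (((N - i) mod N + i') mod N)}))"
      using runs_dot_prog[OF r1 p1 c1 x1 Z(1) Z1] by blast
    have "((N - i) mod N + i') mod N = (i' + (N - i)) mod N" for i'
      by (subst mod_add_left_eq) (simp only: add.commute)
    then have acc: "R2 24 = of_bool (v i)" using R2(4) unfolding v_def by simp
    have r2: "R2 17 = N" "R2 8 = 1" "R2 32 = B + i" "R2 31 = N - i" "R2 22 = X" "same ?S R R2"
      using R2(2) r1 inv by (simp_all add: Inv_def)
    have dec: "(N - Suc i) mod N = (if (N - i) mod N = 0 then N - 1 else (N - i) mod N - 1)"
      using i by (cases "i = 0") auto
    let ?R3 = "R2(32 := B + i + 1, 23 := (N - Suc i) mod N, 31 := N - i - 1)"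
    let ?M3 = "M1(B + i := of_bool (v i))"
    have res: "result ?post (R2, M1) = (?R3, ?M3)"
      unfolding dec using acc r2 R2(3) by (simp add: fun_eq_iff)
    have "runs (Seq dot_prog ?post) (R1, M1) (20 * Z + 5) (?R3, ?M3)"
      by (rule runs_Seq[OF R2(1)], rule runs_straightI[OF _ _ res]) simp_all
    moreover have "Inv (Suc i) ?R3 ?M3"
      using inv r2(5,6) unfolding Inv_def all_less_Suc by simp
    ultimately show "\<exists>R' M'. runs (Seq dot_prog ?post) (R1, M1) (20 * Z + 5) (R', M') \<and> Inv (Suc i) R' M'"
      by blast
  qed (simp add: Inv_def)
  then obtain R' M' where R': "runs (While 31 (Seq dot_prog ?post)) (?R0, M) (N * ((20 * Z + 5) + 1) + 1) (R', M')"
    and inv: "Inv N R' M'" by blast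
  have "runs conv_prog (R, M) (4 + (N * ((20 * Z + 5) + 1) + 1)) (R', M')"
    unfolding conv_prog_def by (rule runs_prefixI[OF _ order_refl _ R']) (use R in simp_all)
  moreover have "4 + (N * ((20 * Z + 5) + 1) + 1) \<le> 30 * Z ^ 2"
  proof -
    have "N * ((20 * Z + 5) + 1) \<le> Z * ((20 * Z + 5) + 1)" using Z by (intro mult_right_mono) auto
    also have "\<dots> = 20 * (Z * Z) + 6 * Z" by (simp add: algebra_simps)
    finally have "N * ((20 * Z + 5) + 1) \<le> 20 * (Z * Z) + 6 * Z" .
    moreover have "2 * Z \<le> Z * Z" using Z by (intro mult_right_mono) auto
    ultimately show ?thesis unfolding power2_eq_square using Z by linarith
  qed
  ultimately have "runs conv_prog (R, M) (30 * Z ^ 2) (R', M')" by (rule runs_mono)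
  moreover have "same ?S R R'" "\<forall>j<B. M' j = M j" "bits_at M' B N v"
    using inv by (simp_all add: Inv_def bits_at_def)
  ultimately show ?thesis unfolding v_def by blast
qed

definition copy_prog :: com where
  "copy_prog = Seq (seqs [Add 25 17 40, Add 26 19 40, Add 28 20 40])
     (While 25 (seqs [Load 27 28, Store 26 27, Add 26 26 8, Add 28 28 8, Sub 25 25 8]))"

lemma runs_copy_prog:
  assumes R: "R 17 = N" "R 8 = 1" "R 40 = 0" "R 19 = A" "R 20 = B"
    and v: "bits_at M B N v" and lay: "A + N \<le> B" and Z: "N \<le> Z" "1 \<le> Z"
  shows "\<exists>R' M'. runs copy_prog (R, M) (20 * Z) (R', M') \<and>
    same {25, 26, 27, 28} R R' \<and> (\<forall>j<A. M' j = M j) \<and> bits_at M' A N v"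
proof -
  let ?body = "seqs [Load 27 28, Store 26 27, Add 26 26 8, Add 28 28 8, Sub 25 25 8]"
  let ?R0 = "R(25 := N, 26 := A, 28 := B)"
  let ?Inv = "\<lambda>i R' M'. same {25, 26, 27, 28} R R' \<and> R' 25 = N - i \<and> R' 26 = A + i \<and> R' 28 = B + i \<and>
    (\<forall>j<A. M' j = M j) \<and> (\<forall>j\<ge>A + i. M' j = M j) \<and> (\<forall>l<i. M' (A + l) = of_bool (v l))"
  have "\<exists>R' M'. runs (While 25 ?body) (?R0, M) (N * (5 + 1) + 1) (R', M') \<and> ?Inv N R' M'"
  proof (rule while_straight[where Inv = ?Inv])
    fix i R' M' assume i: "i < N" and inv: "?Inv i R' M'"
    have "M' (B + i) = of_bool (v i)" using v i inv lay unfolding bits_at_def by simp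
    moreover have "R' 8 = 1" using inv R by simp
    ultimately show "R' 25 \<noteq> 0 \<and> ?Inv (Suc i) (fst (result ?body (R', M'))) (snd (result ?body (R', M')))"
      using inv i by (auto simp: less_Suc_eq)
  qed auto
  then obtain R' M' where R': "runs (While 25 ?body) (?R0, M) (N * (5 + 1) + 1) (R', M')" "?Inv N R' M'" by blast
  have "runs copy_prog (R, M) (3 + (N * (5 + 1) + 1)) (R', M')"
    unfolding copy_prog_def by (rule runs_prefixI[OF _ order_refl _ R'(1)]) (use R in simp_all)
  then have "runs copy_prog (R, M) (20 * Z) (R', M')" by (rule runs_mono) (use Z in simp)
  then show ?thesis using R'(2) unfolding bits_at_def by (intro exI[of _ R'] exI[of _ M']) simp
qed

text \<open>The sum of the two truncated differences is non-zero exactly when the generated bit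
  differs from the bit of the third block; then the mark that deselects the variable is set. After
  that the current power is advanced by one.\<close>

definition bit_prog :: com where
  "bit_prog = Seq (seqs [SetC 23 0, Add 22 33 40]) (Seq dot_prog
     (Seq (seqs [Load 27 35, Sub 28 24 27, Sub 29 27 24, Add 28 28 29, Ite 28 (Store 36 8) (SetC 29 0)])
       (Seq conv_prog (Seq copy_prog (seqs [Add 35 35 8, Sub 37 37 8])))))"

lemma runs_bit_prog:
  assumes R: "R 17 = N" "R 8 = 1" "R 40 = 0" "R 19 = A" "R 20 = A + N" "R 30 = X" "R 33 = Y"
    and c: "bits_at M A N c" and x: "bits_at M X N x" and y: "bits_at M Y N y"
    and u: "M (R 35) = of_bool u"
    and lay: "X + N \<le> R 36" "R 36 < A" and N: "0 < N"
    and Z: "N \<le> Z" "2 \<le> Z"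
  shows "\<exists>R' M'. runs bit_prog (R, M) (70 * Z ^ 2) (R', M') \<and>
    same {22, 23, 24, 25, 26, 27, 28, 29, 31, 32, 35, 37} R R' \<and>
    R' 35 = R 35 + 1 \<and> R' 37 = R 37 - 1 \<and>
    (\<forall>j<A. M' j = (if j = R 36 \<and> dotp N c y \<noteq> u then 1 else M j)) \<and>
    bits_at M' A N (\<lambda>l. odd (card {i. i < N \<and> c i \<and> x ((i + (N - l)) mod N)}))"
proof -
  let ?mid = "seqs [Load 27 35, Sub 28 24 27, Sub 29 27 24, Add 28 28 29, Ite 28 (Store 36 8) (SetC 29 0)]"
  let ?v = "\<lambda>l. odd (card {i. i < N \<and> c i \<and> x ((i + (N - l)) mod N)})"
  let ?R0 = "R(23 := 0, 22 := Y)"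
  have Z1: "1 \<le> Z" using Z by simp
  have r0: "?R0 17 = N" "?R0 8 = 1" "?R0 40 = 0" "?R0 19 = A" "?R0 22 = Y" "?R0 23 = 0" using R by simp_all
  obtain R1 where R1: "runs dot_prog (?R0, M) (20 * Z) (R1, M)"
    "same {23, 24, 25, 26, 27, 28, 29} ?R0 R1"
    "R1 24 = of_bool (odd (card {i. i < N \<and> c i \<and> y ((0 + i) mod N)}))"
    using runs_dot_prog[OF r0 N c y Z(1) Z1] by blast
  have "{i. i < N \<and> c i \<and> y ((0 + i) mod N)} = {i. i < N \<and> c i \<and> y i}" by auto
  then have acc: "R1 24 = of_bool (dotp N c y)" using R1(3) unfolding dotp_def by simp
  obtain R2 M2 where m2: "result ?mid (R1, M) = (R2, M2)" by fastforce
  have k1: "R1 35 = R 35" "R1 36 = R 36" "R1 8 = 1" using R1(2) R by simp_all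
  have R2: "same {22, 23, 24, 25, 26, 27, 28, 29} R R2" 
    using R1(2) m2 acc u k1 by (cases "dotp N c y"; cases u) auto
  have M2: "M2 = (if dotp N c y \<noteq> u then M(R 36 := 1) else M)"
    using m2 acc u k1 by (cases "dotp N c y"; cases u) auto
  have v2: "R2 17 = N" "R2 8 = 1" "R2 40 = 0" "R2 19 = A" "R2 20 = A + N" "R2 30 = X"
    using R2 R by simp_all
  have c2: "bits_at M2 A N c" using c lay unfolding M2 bits_at_def by simp
  have x2: "bits_at M2 X N x" using x lay unfolding M2 bits_at_def by simp
  have XA: "X + N \<le> A + N" using lay by simp
  obtain R3 M3 where R3: "runs conv_prog (R2, M2) (30 * Z ^ 2) (R3, M3)"
    "same {22, 23, 24, 25, 26, 27, 28, 29, 31, 32} R2 R3" "\<forall>j<A + N. M3 j = M2 j" "bits_at M3 (A + N) N ?v"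
    using runs_conv_prog[OF v2 c2 x2 order_refl XA Z] by blast
  have v3: "R3 17 = N" "R3 8 = 1" "R3 40 = 0" "R3 19 = A" "R3 20 = A + N"
    using R3(2) v2 by simp_all
  obtain R4 M4 where R4: "runs copy_prog (R3, M3) (20 * Z) (R4, M4)" "same {25, 26, 27, 28} R3 R4"
    "\<forall>j<A. M4 j = M3 j" "bits_at M4 A N ?v"
    using runs_copy_prog[OF v3 R3(4) order_refl Z(1) Z1] by blast
  let ?R5 = "R4(35 := R4 35 + 1, 37 := R4 37 - 1)"
  have s4: "same {22, 23, 24, 25, 26, 27, 28, 29, 31, 32} R R4" using R4(2) R3(2) R2 by simp
  have "runs bit_prog (R, M) (2 + (20 * Z + (6 + (30 * Z ^ 2 + (20 * Z + 2))))) (?R5, M4)"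
    unfolding bit_prog_def
  proof (rule runs_Seq[OF runs_straightI runs_Seq[OF R1(1) runs_Seq[OF runs_straightI runs_Seq[OF R3(1) runs_Seq[OF R4(1) runs_straightI]]]]])
    show "result (seqs [SetC 23 0, Add 22 33 40]) (R, M) = (?R0, M)" using R by simp
    show "result ?mid (R1, M) = (R2, M2)" by (rule m2)
    show "result (seqs [Add 35 35 8, Sub 37 37 8]) (R4, M4) = (?R5, M4)" using s4 R by simp
  qed simp_all
  moreover have "2 + (20 * Z + (6 + (30 * Z ^ 2 + (20 * Z + 2)))) \<le> 70 * Z ^ 2"
  proof -
    have "2 * Z \<le> Z * Z" using Z by (intro mult_right_mono) auto
    then show ?thesis unfolding power2_eq_square using Z by linarith
  qed
  ultimately have run: "runs bit_prog (R, M) (70 * Z ^ 2) (?R5, M4)" by (rule runs_mono)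
  have M4: "\<forall>j<A. M4 j = (if j = R 36 \<and> dotp N c y \<noteq> u then 1 else M j)"
    using R4(3) R3(3) unfolding M2 by simp
  show ?thesis
    by (intro exI[of _ ?R5] exI[of _ M4] conjI run M4 R4(4)) (use s4 in simp_all)
qed

definition elem_prog :: com where
  "elem_prog = Seq (seqs [Add 35 34 40, Add 37 15 40])
     (Seq (While 37 bit_prog) (seqs [Add 36 36 8, Sub 38 38 8]))"

lemma runs_elem_prog:
  assumes R: "R 17 = N" "R 8 = 1" "R 40 = 0" "R 19 = A" "R 20 = A + N" "R 30 = X" "R 33 = Y"
      "R 34 = U" "R 15 = a"
    and c: "bits_at M A N (cpow N x e)" and x: "bits_at M X N x" and y: "bits_at M Y N y"
    and u: "bits_at M U a u"
    and lay: "X + N \<le> R 36" "Y + N \<le> R 36" "U + a \<le> R 36" "R 36 < A" and N: "0 < N"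
    and Z: "N \<le> Z" "a \<le> Z" "2 \<le> Z"
  shows "\<exists>R' M'. runs elem_prog (R, M) (80 * Z ^ 3) (R', M') \<and>
    same {22, 23, 24, 25, 26, 27, 28, 29, 31, 32, 35, 36, 37, 38} R R' \<and>
    R' 36 = R 36 + 1 \<and> R' 38 = R 38 - 1 \<and>
    (\<forall>j<A. M' j = (if j = R 36 \<and> (\<exists>b<a. dotp N (cpow N x (e + b)) y \<noteq> u b) then 1 else M j)) \<and>
    bits_at M' A N (cpow N x (e + a))"
proof -
  let ?S = "{22, 23, 24, 25, 26, 27, 28, 29, 31, 32, 35, 37}"
  let ?R0 = "R(35 := U, 37 := a)"
  define bad where "bad = (\<lambda>b. dotp N (cpow N x (e + b)) y \<noteq> u b)"
  define Inv where "Inv = (\<lambda>b R' M'. same ?S R R' \<and> R' 35 = U + b \<and> R' 37 = a - b \<and>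
    (\<forall>j<A. M' j = (if j = R 36 \<and> (\<exists>b'<b. bad b') then 1 else M j)) \<and> bits_at M' A N (cpow N x (e + b)))"
  have "\<exists>R' M'. runs (While 37 bit_prog) (?R0, M) (a * (70 * Z ^ 2 + 1) + 1) (R', M') \<and> Inv a R' M'"
  proof (rule while_rule)
    show "Inv 0 ?R0 M" using c by (simp add: Inv_def)
    fix b R1 M1 assume b: "b < a" and inv: "Inv b R1 M1"
    show "R1 37 \<noteq> 0" using inv b by (simp add: Inv_def)
    have r1: "R1 17 = N" "R1 8 = 1" "R1 40 = 0" "R1 19 = A" "R1 20 = A + N" "R1 30 = X" "R1 33 = Y"
      and r36: "R1 36 = R 36" "R1 35 = U + b" "R1 37 = a - b" and s1: "same ?S R R1"
      using inv R by (simp_all add: Inv_def)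
    have M1: "M1 j = (if j = R 36 \<and> (\<exists>b'<b. bad b') then 1 else M j)" if "j < A" for j
      using inv that by (simp add: Inv_def)
    have c1: "bits_at M1 A N (cpow N x (e + b))" using inv by (simp add: Inv_def)
    have x1: "bits_at M1 X N x" using x lay M1 unfolding bits_at_def by simp
    have y1: "bits_at M1 Y N y" using y lay M1 unfolding bits_at_def by simp
    have u1: "M1 (R1 35) = of_bool (u b)" using u lay M1 b unfolding bits_at_def r36 by simp
    have lay1: "X + N \<le> R1 36" "R1 36 < A" using lay r36 by simp_all
    obtain R2 M2 where R2: "runs bit_prog (R1, M1) (70 * Z ^ 2) (R2, M2)" "same ?S R1 R2"
      "R2 35 = R1 35 + 1" "R2 37 = R1 37 - 1"
      "\<forall>j<A. M2 j = (if j = R1 36 \<and> dotp N (cpow N x (e + b)) y \<noteq> u b then 1 else M1 j)"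
      "bits_at M2 A N (\<lambda>l. odd (card {i. i < N \<and> cpow N x (e + b) i \<and> x ((i + (N - l)) mod N)}))"
      using runs_bit_prog[OF r1 c1 x1 y1 u1 lay1 N Z(1) Z(3)] by blast
    have "M2 j = (if j = R 36 \<and> (\<exists>b'<Suc b. bad b') then 1 else M j)" if "j < A" for j
    proof -
      have "M2 j = (if j = R 36 \<and> bad b then 1 else M1 j)"
        using R2(5) that r36 unfolding bad_def by simp
      then show ?thesis using M1[OF that] by (auto simp: less_Suc_eq)
    qed
    moreover have "bits_at M2 A N (cpow N x (e + Suc b))" using R2(6) by simp
    ultimately have "Inv (Suc b) R2 M2" using R2(2-4) s1 r36 unfolding Inv_def by simp
    then show "\<exists>R' M'. runs bit_prog (R1, M1) (70 * Z ^ 2) (R', M') \<and> Inv (Suc b) R' M'"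
      using R2(1) by blast
  qed (simp add: Inv_def)
  then obtain R1 M1 where R1: "runs (While 37 bit_prog) (?R0, M) (a * (70 * Z ^ 2 + 1) + 1) (R1, M1)"
    and inv: "Inv a R1 M1" by blast
  let ?R2 = "R1(36 := R 36 + 1, 38 := R 38 - 1)"
  have s1: "same ?S R R1" using inv by (simp add: Inv_def)
  have res: "result (seqs [Add 36 36 8, Sub 38 38 8]) (R1, M1) = (?R2, M1)" using s1 R by simp
  have "runs elem_prog (R, M) (2 + ((a * (70 * Z ^ 2 + 1) + 1) + 2)) (?R2, M1)"
    unfolding elem_prog_def
    by (rule runs_prefixI[OF _ order_refl _ runs_Seq[OF R1 runs_straightI[OF _ order_refl res]]]) (use R in simp_all)
  moreover have "2 + ((a * (70 * Z ^ 2 + 1) + 1) + 2) \<le> 80 * Z ^ 3"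
  proof -
    have "a * (70 * Z ^ 2 + 1) \<le> Z * (70 * Z ^ 2 + 1)" using Z by (intro mult_right_mono) auto
    also have "\<dots> = 70 * Z ^ 3 + Z" by (simp add: power2_eq_square power3_eq_cube algebra_simps)
    finally have "a * (70 * Z ^ 2 + 1) \<le> 70 * Z ^ 3 + Z" .
    moreover have "Z ^ 1 \<le> Z ^ 3" using Z by (intro power_increasing) auto
    ultimately show ?thesis using Z by simp
  qed
  ultimately have "runs elem_prog (R, M) (80 * Z ^ 3) (?R2, M1)" by (rule runs_mono)
  moreover have "same {22, 23, 24, 25, 26, 27, 28, 29, 31, 32, 35, 36, 37, 38} R ?R2" using s1 by simp
  moreover have "\<forall>j<A. M1 j = (if j = R 36 \<and> (\<exists>b<a. bad b) then 1 else M j)"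
    "bits_at M1 A N (cpow N x (e + a))" using inv by (simp_all add: Inv_def)
  ultimately show ?thesis unfolding bad_def by (intro exI[of _ ?R2] exI[of _ M1] conjI) (assumption | simp)+
qed

text \<open>Memory holds the seed below r, the marks of the variables from r on, the current power
  from \<open>r + n\<close> on and behind it the buffer. Vectors of an earlier stage may remain
  there, so the area is cleared before the power with exponent 0 is written. Marks are only ever
  set, hence they accumulate the intersection over the stages.\<close>

definition gen_prog :: com where
  "gen_prog = Seq (seqs [Add 25 17 40, Add 26 19 40])
     (Seq (While 25 (seqs [Store 26 40, Add 26 26 8, Sub 25 25 8]))
       (Seq (seqs [Store 19 8, Add 36 7 40, Add 38 0 40]) (While 38 elem_prog)))"

lemma runs_gen_prog:
  assumes R: "R 17 = N" "R 8 = 1" "R 40 = 0" "R 19 = r + n" "R 20 = r + n + N" "R 30 = X" "R 33 = Y"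
      "R 34 = U" "R 15 = a" "R 0 = n" "R 7 = r"
    and x: "bits_at M X N x" and y: "bits_at M Y N y" and u: "bits_at M U a u"
    and lay: "X + N \<le> r" "Y + N \<le> r" "U + a \<le> r" and N: "0 < N"
    and Z: "N \<le> Z" "a \<le> Z" "n \<le> Z" "2 \<le> Z"
  shows "\<exists>R' M'. runs gen_prog (R, M) (100 * Z ^ 4) (R', M') \<and>
    same {22, 23, 24, 25, 26, 27, 28, 29, 31, 32, 35, 36, 37, 38} R R' \<and> (\<forall>j<r. M' j = M j) \<and>
    (\<forall>i<n. M' (r + i) = (if \<exists>b<a. dotp N (cpow N x (a * i + b)) y \<noteq> u b then 1 else M (r + i)))"
proof -
  let ?S = "{22, 23, 24, 25, 26, 27, 28, 29, 31, 32, 35, 36, 37, 38}"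
  let ?A = "r + n"
  let ?clear = "seqs [Store 26 40, Add 26 26 8, Sub 25 25 8]"
  let ?R0 = "R(25 := N, 26 := ?A)"
  define Inv0 where "Inv0 = (\<lambda>i R' M'. same {25, 26} R R' \<and> R' 25 = N - i \<and> R' 26 = ?A + i \<and>
    (\<forall>j<?A. M' j = M j) \<and> (\<forall>l<i. M' (?A + l) = (0::nat)))"
  have "\<exists>R' M'. runs (While 25 ?clear) (?R0, M) (N * (3 + 1) + 1) (R', M') \<and> Inv0 N R' M'"
  proof (rule while_straight)
    show "Inv0 0 ?R0 M" by (simp add: Inv0_def)
    fix i R' M' assume i: "i < N" and inv: "Inv0 i R' M'"
    show "R' 25 \<noteq> 0 \<and> Inv0 (Suc i) (fst (result ?clear (R', M'))) (snd (result ?clear (R', M')))"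
      using inv i R unfolding Inv0_def all_less_Suc by simp
  qed (simp_all add: Inv0_def)
  then obtain R1 M1 where R1: "runs (While 25 ?clear) (?R0, M) (N * (3 + 1) + 1) (R1, M1)"
    and inv1: "Inv0 N R1 M1" by blast
  let ?R2 = "R1(36 := r, 38 := n)" and ?M2 = "M1(?A := 1)"
  have s1: "same {25, 26} R R1" and M1: "\<forall>j<?A. M1 j = M j" "\<forall>l<N. M1 (?A + l) = 0"
    using inv1 by (simp_all add: Inv0_def)
  have res: "result (seqs [Store 19 8, Add 36 7 40, Add 38 0 40]) (R1, M1) = (?R2, ?M2)" using s1 R by simp
  define bad where "bad = (\<lambda>i. \<exists>b<a. dotp N (cpow N x (a * i + b)) y \<noteq> u b)"
  define Inv where "Inv = (\<lambda>i R' M'. same ?S R R' \<and> R' 36 = r + i \<and> R' 38 = n - i \<and>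
    (\<forall>j<r. M' j = M j) \<and> (\<forall>i'<n. M' (r + i') = (if i' < i \<and> bad i' then 1 else M (r + i'))) \<and>
    bits_at M' ?A N (cpow N x (a * i)))"
  have "\<exists>R' M'. runs (While 38 elem_prog) (?R2, ?M2) (n * (80 * Z ^ 3 + 1) + 1) (R', M') \<and> Inv n R' M'"
  proof (rule while_rule)
    show "Inv 0 ?R2 ?M2" using s1 M1 unfolding Inv_def bits_at_def by simp
    fix i R3 M3 assume i: "i < n" and inv: "Inv i R3 M3"
    show "R3 38 \<noteq> 0" using inv i by (simp add: Inv_def)
    have r3: "R3 17 = N" "R3 8 = 1" "R3 40 = 0" "R3 19 = ?A" "R3 20 = ?A + N" "R3 30 = X" "R3 33 = Y"
      "R3 34 = U" "R3 15 = a" and r36: "R3 36 = r + i" "R3 38 = n - i" and s3: "same ?S R R3"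
      using inv R by (simp_all add: Inv_def)
    have M3: "\<forall>j<r. M3 j = M j" and M3': "\<forall>i'<n. M3 (r + i') = (if i' < i \<and> bad i' then 1 else M (r + i'))"
      and c3: "bits_at M3 ?A N (cpow N x (a * i))"
      using inv by (simp_all add: Inv_def)
    have x3: "bits_at M3 X N x" and y3: "bits_at M3 Y N y" and u3: "bits_at M3 U a u"
      using x y u lay M3 unfolding bits_at_def by simp_all
    have lay3: "X + N \<le> R3 36" "Y + N \<le> R3 36" "U + a \<le> R3 36" "R3 36 < ?A"
      using lay i r36 by simp_all
    obtain R4 M4 where R4: "runs elem_prog (R3, M3) (80 * Z ^ 3) (R4, M4)" "same ?S R3 R4"
      "R4 36 = R3 36 + 1" "R4 38 = R3 38 - 1"
      "\<forall>j<?A. M4 j = (if j = R3 36 \<and> (\<exists>b<a. dotp N (cpow N x (a * i + b)) y \<noteq> u b) then 1 else M3 j)"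
      "bits_at M4 ?A N (cpow N x (a * i + a))"
      using runs_elem_prog[OF r3 c3 x3 y3 u3 lay3 N Z(1,2,4)] by blast
    have M4: "M4 j = (if j = r + i \<and> bad i then 1 else M3 j)" if "j < ?A" for j
      using R4(5) that unfolding bad_def r36 by blast
    have "\<forall>j<r. M4 j = M j" using M4 M3 by simp
    moreover have "\<forall>i'<n. M4 (r + i') = (if i' < Suc i \<and> bad i' then 1 else M (r + i'))"
      using M4 M3' by (auto simp: less_Suc_eq)
    moreover have "bits_at M4 ?A N (cpow N x (a * Suc i))" using R4(6) by (simp add: add.commute)
    ultimately have "Inv (Suc i) R4 M4" using R4(2-4) s3 r36 unfolding Inv_def by simp
    then show "\<exists>R' M'. runs elem_prog (R3, M3) (80 * Z ^ 3) (R', M') \<and> Inv (Suc i) R' M'"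
      using R4(1) by blast
  qed (simp add: Inv_def)
  then obtain R3 M3 where R3: "runs (While 38 elem_prog) (?R2, ?M2) (n * (80 * Z ^ 3 + 1) + 1) (R3, M3)"
    and inv: "Inv n R3 M3" by blast
  have tail: "runs (Seq (seqs [Store 19 8, Add 36 7 40, Add 38 0 40]) (While 38 elem_prog)) (R1, M1)
    (3 + (n * (80 * Z ^ 3 + 1) + 1)) (R3, M3)"
    by (rule runs_prefixI[OF _ order_refl res R3]) simp_all
  have "runs gen_prog (R, M) (2 + ((N * (3 + 1) + 1) + (3 + (n * (80 * Z ^ 3 + 1) + 1)))) (R3, M3)"
    unfolding gen_prog_def
    by (rule runs_prefixI[OF _ order_refl _ runs_Seq[OF R1 tail]]) (use R in simp_all)
  moreover have "2 + ((N * (3 + 1) + 1) + (3 + (n * (80 * Z ^ 3 + 1) + 1))) \<le> 100 * Z ^ 4"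
  proof -
    have "n * (80 * Z ^ 3 + 1) \<le> Z * (80 * Z ^ 3 + 1)" using Z by (intro mult_right_mono) auto
    also have "\<dots> = 80 * Z ^ 4 + Z" by (simp add: power_Suc numeral_eq_Suc algebra_simps)
    finally have "n * (80 * Z ^ 3 + 1) \<le> 80 * Z ^ 4 + Z" .
    moreover have "Z * 2 ^ 3 \<le> Z * Z ^ 3" using Z by (intro mult_left_mono power_mono) auto
    then have "Z * 8 \<le> Z ^ 4" by (simp add: numeral_eq_Suc)
    moreover have "p \<le> 80 * Q + Z \<Longrightarrow> Z * 8 \<le> Q \<Longrightarrow> 2 + ((N * (3 + 1) + 1) + (3 + (p + 1))) \<le> 100 * Q"
      for p Q using Z by simp
    ultimately show ?thesis by blast
  qed
  ultimately have "runs gen_prog (R, M) (100 * Z ^ 4) (R3, M3)" by (rule runs_mono)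
  moreover have "same ?S R R3" "\<forall>j<r. M3 j = M j"
    "\<forall>i<n. M3 (r + i) = (if bad i then 1 else M (r + i))" using inv by (simp_all add: Inv_def)
  ultimately show ?thesis unfolding bad_def by blast
qed

section \<open>Parameters and program of one stage\<close>

text \<open>For positive \<open>pw\<close> this is the quotient rounded up, in the form that
  repeated addition computes.\<close>

definition dpart :: "nat \<Rightarrow> nat \<Rightarrow> nat" where
  "dpart dlt pw = (LEAST q. dlt \<le> q * pw)"

lemma le_dpart: "0 < pw \<Longrightarrow> dlt \<le> dpart dlt pw * pw"
  unfolding dpart_def by (rule LeastI[of _ dlt]) simp

lemma dpart_least: "q < dpart dlt pw \<Longrightarrow> q * pw < dlt"
  unfolding dpart_def using not_less_Least[of q "\<lambda>q. dlt \<le> q * pw"] by simp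

definition acount_prog :: com where
  "acount_prog = Seq (seqs [Add 15 9 40, SetC 21 0, Sub 22 4 21])
     (While 22 (seqs [Add 21 21 12, Add 15 15 8, Sub 22 4 21]))"

lemma runs_acount_prog:
  assumes R: "R 8 = 1" "R 40 = 0" "R 12 = pw" "R 4 = dlt" and pw: "0 < pw"
  shows "\<exists>R'. runs acount_prog (R, M) (3 + (dpart dlt pw * (3 + 1) + 1)) (R', M) \<and> same {15, 21, 22} R R' \<and>
    R' 15 = R 9 + dpart dlt pw"
proof -
  let ?body = "seqs [Add 21 21 12, Add 15 15 8, Sub 22 4 21]"
  let ?R0 = "R(15 := R 9, 21 := 0, 22 := dlt)"
  define Inv where "Inv = (\<lambda>i R' M'. M' = M \<and> same {15, 21, 22} R R' \<and> R' 21 = i * pw \<and>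
    R' 15 = R 9 + i \<and> R' 22 = dlt - i * pw)"
  have "\<exists>R' M'. runs (While 22 ?body) (?R0, M) (dpart dlt pw * (3 + 1) + 1) (R', M') \<and> Inv (dpart dlt pw) R' M'"
  proof (rule while_straight)
    show "Inv 0 ?R0 M" by (simp add: Inv_def)
    fix i R' M' assume i: "i < dpart dlt pw" and inv: "Inv i R' M'"
    show "R' 22 \<noteq> 0 \<and> Inv (Suc i) (fst (result ?body (R', M'))) (snd (result ?body (R', M')))"
      using inv dpart_least[OF i] R unfolding Inv_def by (simp add: add.commute)
  next
    show "R' 22 = 0" if "Inv (dpart dlt pw) R' M'" for R' M'
      using that le_dpart[OF pw, of dlt] by (simp add: Inv_def)
  qed simp_all
  then obtain R' where R': "runs (While 22 ?body) (?R0, M) (dpart dlt pw * (3 + 1) + 1) (R', M)"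
    and inv: "Inv (dpart dlt pw) R' M" unfolding Inv_def by blast
  have "runs acount_prog (R, M) (3 + (dpart dlt pw * (3 + 1) + 1)) (R', M)"
    unfolding acount_prog_def by (rule runs_prefixI[OF _ order_refl _ R']) (use R in simp_all)
  then show ?thesis using inv unfolding Inv_def by blast
qed

text \<open>Products by repeated addition. The value \<open>2 * lg + t * (6 * a)\<close> as a lower
  bound for N makes the error of the generator at most \<open>1 / 2 ^ (a * t)\<close>, as
  \<open>live_bound\<close> shows.\<close>

definition xbound_prog :: com where
  "xbound_prog = Seq (seqs [Add 16 10 10, Add 21 15 15, Add 22 21 15, Add 21 22 22, Add 22 11 40])
     (While 22 (seqs [Add 16 16 21, Sub 22 22 8]))"

lemma runs_xbound_prog:
  assumes R: "R 8 = 1" "R 40 = 0" "R 11 = t" "R 15 = a"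
  shows "\<exists>R'. runs xbound_prog (R, M) (5 + (t * (2 + 1) + 1)) (R', M) \<and> same {16, 21, 22} R R' \<and>
    R' 16 = 2 * R 10 + t * (6 * a)"
proof -
  let ?body = "seqs [Add 16 16 21, Sub 22 22 8]"
  let ?R0 = "R(16 := 2 * R 10, 21 := 6 * a, 22 := t)"
  define Inv where "Inv = (\<lambda>i R' M'. M' = M \<and> same {16, 21, 22} R R' \<and> R' 21 = 6 * a \<and>
    R' 16 = 2 * R 10 + i * (6 * a) \<and> R' 22 = t - i)"
  have "\<exists>R' M'. runs (While 22 ?body) (?R0, M) (t * (2 + 1) + 1) (R', M') \<and> Inv t R' M'"
  proof (rule while_straight)
    show "Inv 0 ?R0 M" by (simp add: Inv_def)
    fix i R' M' assume i: "i < t" and inv: "Inv i R' M'"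
    show "R' 22 \<noteq> 0 \<and> Inv (Suc i) (fst (result ?body (R', M'))) (snd (result ?body (R', M')))"
      using inv i R unfolding Inv_def by simp
  qed (simp_all add: Inv_def)
  then obtain R' where R': "runs (While 22 ?body) (?R0, M) (t * (2 + 1) + 1) (R', M)"
    and inv: "Inv t R' M" unfolding Inv_def by blast
  have res: "result (seqs [Add 16 10 10, Add 21 15 15, Add 22 21 15, Add 21 22 22, Add 22 11 40]) (R, M) = (?R0, M)"
    using R by (simp add: fun_eq_iff)
  have "runs xbound_prog (R, M) (5 + (t * (2 + 1) + 1)) (R', M)"
    unfolding xbound_prog_def by (rule runs_prefixI[OF _ order_refl res R']) simp_all
  then show ?thesis using inv unfolding Inv_def by blast
qed

text \<open>The offset by one gives N the form \<open>3 ^ Suc k\<close> that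
  \<open>cyclotomic_bprime\<close> requires, also for small x.\<close>

definition tlog :: "nat \<Rightarrow> nat" where
  "tlog x = (LEAST q. x \<le> 3 ^ Suc q)"

lemma le_power_tlog: "x \<le> 3 ^ Suc (tlog x)"
  unfolding tlog_def
proof (rule LeastI)
  have "x \<le> 2 ^ x" by (simp add: less_imp_le)
  also have "\<dots> \<le> (3::nat) ^ x" by (rule power_mono) auto
  also have "\<dots> \<le> 3 ^ Suc x" by simp
  finally show "x \<le> 3 ^ Suc x" .
qed

lemma tlog_least: "q < tlog x \<Longrightarrow> 3 ^ Suc q < x"
  unfolding tlog_def using not_less_Least[of q "\<lambda>q. x \<le> 3 ^ Suc q"] by simp

definition npow_prog :: com where
  "npow_prog = Seq (seqs [SetC 17 3, Sub 22 16 17])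
     (While 22 (seqs [Add 21 17 17, Add 17 17 21, Sub 22 16 17]))"

lemma runs_npow_prog:
  assumes R: "R 16 = x"
  shows "\<exists>R'. runs npow_prog (R, M) (2 + (tlog x * (3 + 1) + 1)) (R', M) \<and> same {17, 21, 22} R R' \<and>
    R' 17 = 3 ^ Suc (tlog x)"
proof -
  let ?body = "seqs [Add 21 17 17, Add 17 17 21, Sub 22 16 17]"
  let ?R0 = "R(17 := 3, 22 := x - 3)"
  define Inv where "Inv = (\<lambda>i R' M'. M' = M \<and> same {17, 21, 22} R R' \<and> R' 17 = 3 ^ Suc i \<and>
    R' 22 = x - 3 ^ Suc i)"
  have "\<exists>R' M'. runs (While 22 ?body) (?R0, M) (tlog x * (3 + 1) + 1) (R', M') \<and> Inv (tlog x) R' M'"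
  proof (rule while_straight)
    show "Inv 0 ?R0 M" by (simp add: Inv_def)
    fix i R' M' assume i: "i < tlog x" and inv: "Inv i R' M'"
    show "R' 22 \<noteq> 0 \<and> Inv (Suc i) (fst (result ?body (R', M'))) (snd (result ?body (R', M')))"
      using inv tlog_least[OF i] R unfolding Inv_def by simp
  next
    show "R' 22 = 0" if "Inv (tlog x) R' M'" for R' M'
      using that le_power_tlog[of x] by (simp add: Inv_def)
  qed simp_all
  then obtain R' where R': "runs (While 22 ?body) (?R0, M) (tlog x * (3 + 1) + 1) (R', M)"
    and inv: "Inv (tlog x) R' M" unfolding Inv_def by blast
  have "runs npow_prog (R, M) (2 + (tlog x * (3 + 1) + 1)) (R', M)"
    unfolding npow_prog_def by (rule runs_prefixI[OF _ order_refl _ R']) (use R in simp_all)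
  then show ?thesis using inv unfolding Inv_def by blast
qed

text \<open>Variable \<open>i\<close> owns the bits \<open>a * i, \<dots>, a * i + a - 1\<close> of the generator with seed \<open>x, y\<close>, where \<open>x\<close> and
  \<open>y\<close> are the first two blocks of \<open>N\<close> bits of \<open>\<sigma>\<close>.  The third block makes its selection probability exactly
  \<open>1 / 2 ^ a\<close>.\<close>

definition selected :: "nat \<Rightarrow> nat \<Rightarrow> (nat \<Rightarrow> bool) \<Rightarrow> nat \<Rightarrow> bool" where
  "selected N a \<sigma> i \<longleftrightarrow>
     (\<forall>b<a. dotp N (cpow N (\<lambda>l. \<sigma> l) (a * i + b)) (\<lambda>l. \<sigma> (N + l)) = \<sigma> (2 * N + b))"

definition stage_prog :: com where
  "stage_prog = Seq acount_prog (Seq xbound_prog (Seq npow_prog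
     (Seq (seqs [Add 30 13 40, Add 33 13 17, Add 34 33 17, Add 20 19 17])
       (Seq gen_prog (seqs [Add 13 34 15, Add 14 14 15, Add 11 11 11, Add 12 12 12, Sub 18 1 11])))))"

lemma runs_stage_prog:
  assumes R: "R 0 = n" "R 4 = dlt" "R 7 = r" "R 8 = 1" "R 40 = 0" "R 19 = r + n"
      "R 9 = b" "R 10 = lg" "R 11 = t" "R 12 = pw" "R 13 = pos" and pw: "0 < pw"
    and a: "a = b + dpart dlt pw" and N: "N = 3 ^ Suc (tlog (2 * lg + t * (6 * a)))"
    and lay: "pos + (2 * N + a) \<le> r" and M: "\<forall>j<r. M j = of_bool (\<sigma> j)"
    and Z: "r \<le> Z" "n \<le> Z" "t \<le> Z" "2 \<le> Z"
  shows "\<exists>R' M'. runs stage_prog (R, M) (150 * Z ^ 4) (R', M') \<and>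
    same {11, 12, 13, 14, 15, 16, 17, 18, 20, 21, 22, 23, 24, 25, 26, 27, 28, 29, 30, 31, 32, 33, 34, 35, 36, 37, 38} R R' \<and>
    R' 11 = 2 * t \<and> R' 12 = 2 * pw \<and> R' 13 = pos + (2 * N + a) \<and> R' 14 = R 14 + a \<and> R' 18 = R 1 - 2 * t \<and>
    (\<forall>j<r. M' j = M j) \<and>
    (\<forall>i<n. M' (r + i) = (if selected N a (\<lambda>l. \<sigma> (pos + l)) i then M (r + i) else 1))"
proof -
  let ?X = "2 * lg + t * (6 * a)"
  let ?S = "{22, 23, 24, 25, 26, 27, 28, 29, 31, 32, 35, 36, 37, 38}"
  have N0: "0 < N" unfolding N by simp
  \<comment> \<open>The loop that finds N must have its number of rounds bounded in terms of the
    seed length.\<close>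
  have q: "tlog ?X \<le> N"
  proof -
    have "tlog ?X < 2 ^ tlog ?X" by simp
    also have "\<dots> \<le> (3::nat) ^ tlog ?X" by (rule power_mono) auto
    also have "\<dots> \<le> N" unfolding N by simp
    finally show ?thesis by simp
  qed
  obtain R1 where R1: "runs acount_prog (R, M) (3 + (dpart dlt pw * (3 + 1) + 1)) (R1, M)"
    "same {15, 21, 22} R R1" "R1 15 = a"
    using runs_acount_prog[of R pw dlt M] R pw a by auto
  have "R1 8 = 1" "R1 40 = 0" "R1 11 = t" using R1(2) R by simp_all
  then obtain R2 where R2: "runs xbound_prog (R1, M) (5 + (t * (2 + 1) + 1)) (R2, M)"
    "same {16, 21, 22} R1 R2" "R2 16 = 2 * R1 10 + t * (6 * a)"
    using runs_xbound_prog[of R1 t a M] R1(3) by auto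
  have "R2 16 = ?X" using R2(3) R1(2) R by simp
  then obtain R3 where R3: "runs npow_prog (R2, M) (2 + (tlog ?X * (3 + 1) + 1)) (R3, M)"
    "same {17, 21, 22} R2 R3" "R3 17 = N"
    using runs_npow_prog[of R2 ?X M] N by auto
  have s3: "same {15, 16, 17, 21, 22} R R3" and r3: "R3 15 = a"
    using R1(2,3) R2(2) R3(2) by simp_all
  let ?R4 = "R3(30 := pos, 33 := pos + N, 34 := pos + 2 * N, 20 := r + n + N)"
  have res4: "result (seqs [Add 30 13 40, Add 33 13 17, Add 34 33 17, Add 20 19 17]) (R3, M) = (?R4, M)"
    using s3 R R3(3) by (simp add: fun_eq_iff)
  have r4: "?R4 17 = N" "?R4 8 = 1" "?R4 40 = 0" "?R4 19 = r + n" "?R4 20 = r + n + N" "?R4 30 = pos"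
    "?R4 33 = pos + N" "?R4 34 = pos + 2 * N" "?R4 15 = a" "?R4 0 = n" "?R4 7 = r"
    using s3 R R3(3) r3 by simp_all
  have x: "bits_at M pos N (\<lambda>l. \<sigma> (pos + l))" and y: "bits_at M (pos + N) N (\<lambda>l. \<sigma> (pos + (N + l)))"
    and u: "bits_at M (pos + 2 * N) a (\<lambda>l. \<sigma> (pos + (2 * N + l)))"
    unfolding bits_at_def using M lay by (simp_all add: add.assoc)
  have lay4: "pos + N \<le> r" "pos + N + N \<le> r" "pos + 2 * N + a \<le> r" using lay by simp_all
  have Z4: "N \<le> Z" "a \<le> Z" using lay Z by simp_all
  obtain R5 M5 where R5: "runs gen_prog (?R4, M) (100 * Z ^ 4) (R5, M5)" "same ?S ?R4 R5" "\<forall>j<r. M5 j = M j"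
    "\<forall>i<n. M5 (r + i) = (if \<exists>b<a. dotp N (cpow N (\<lambda>l. \<sigma> (pos + l)) (a * i + b)) (\<lambda>l. \<sigma> (pos + (N + l)))
      \<noteq> \<sigma> (pos + (2 * N + b)) then 1 else M (r + i))"
    using runs_gen_prog[OF r4 x y u lay4 N0 Z4 Z(2,4)] by blast
  let ?R6 = "R5(13 := pos + (2 * N + a), 14 := R 14 + a, 11 := 2 * t, 12 := 2 * pw, 18 := R 1 - 2 * t)"
  have res6: "result (seqs [Add 13 34 15, Add 14 14 15, Add 11 11 11, Add 12 12 12, Sub 18 1 11]) (R5, M5) = (?R6, M5)"
    using s3 R R5(2) r3 by (simp add: fun_eq_iff mult_2)
  have dZ: "dpart dlt pw \<le> Z" using Z4(2) a by simp
  have "runs stage_prog (R, M) ((3 + (dpart dlt pw * (3 + 1) + 1)) + ((5 + (t * (2 + 1) + 1))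
    + ((2 + (tlog ?X * (3 + 1) + 1)) + (4 + (100 * Z ^ 4 + 5))))) (?R6, M5)"
    unfolding stage_prog_def
    by (rule runs_mono[OF runs_Seq[OF R1(1) runs_Seq[OF R2(1) runs_Seq[OF R3(1)
            runs_Seq[OF runs_straightI[OF _ order_refl res4] runs_Seq[OF R5(1) runs_straightI[OF _ order_refl res6]]]]]]]) simp_all
  moreover have "(3 + (dpart dlt pw * (3 + 1) + 1)) + ((5 + (t * (2 + 1) + 1))
    + ((2 + (tlog ?X * (3 + 1) + 1)) + (4 + (100 * Z ^ 4 + 5)))) \<le> 150 * Z ^ 4"
  proof -
    have "Z * 2 ^ 3 \<le> Z * Z ^ 3" using Z by (intro mult_left_mono power_mono) auto
    then have "Z * 8 \<le> Z ^ 4" by (simp add: numeral_eq_Suc)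
    moreover have "tlog ?X \<le> Z" using q Z4 by simp
    moreover have "Z * 8 \<le> Q \<Longrightarrow> q' \<le> Z \<Longrightarrow> (3 + (dpart dlt pw * (3 + 1) + 1)) + ((5 + (t * (2 + 1) + 1))
      + ((2 + (q' * (3 + 1) + 1)) + (4 + (100 * Q + 5)))) \<le> 150 * Q" for Q q'
      using Z(3,4) dZ by simp
    ultimately show ?thesis by blast
  qed
  ultimately have "runs stage_prog (R, M) (150 * Z ^ 4) (?R6, M5)" by (rule runs_mono)
  moreover have "same {11, 12, 13, 14, 15, 16, 17, 18, 20, 21, 22, 23, 24, 25, 26, 27, 28, 29, 30, 31, 32, 33, 34, 35, 36, 37, 38} R ?R6"
    using s3 R5(2) by simp
  moreover have "\<forall>i<n. M5 (r + i) = (if selected N a (\<lambda>l. \<sigma> (pos + l)) i then M (r + i) else 1)"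
    using R5(4) unfolding selected_def by auto
  ultimately show ?thesis using R5(3) by (intro exI[of _ ?R6] exI[of _ M5] conjI) (assumption | simp)+
qed

section \<open>The whole program\<close>

definition init_prog :: com where
  "init_prog = Seq (seqs [SetC 24 48, SetC 25 0, Add 23 1 40]) (Seq clog_prog (Seq (Add 23 3 40)
     (Seq clog_prog (Seq (seqs [Add 9 25 40, SetC 25 0, Add 23 0 40, SetC 24 1])
       (Seq clog_prog (seqs [Add 10 25 40, Add 11 2 40, SetC 12 4, Add 19 7 0]))))))"

lemma runs_init_prog:
  assumes R: "R 40 = 0"
  shows "\<exists>R'. runs init_prog (R, M) (4 * clog (R 1) + 4 * clog (R 3) + 4 * clog (R 0) + 25) (R', M) \<and>
    same {9, 10, 11, 12, 19, 21, 22, 23, 24, 25} R R' \<and>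
    R' 9 = 48 * clog (R 1) + 48 * clog (R 3) \<and> R' 10 = clog (R 0) \<and> R' 11 = R 2 \<and> R' 12 = 4 \<and>
    R' 19 = R 7 + R 0"
proof -
  let ?R0 = "R(24 := 48, 25 := 0, 23 := R 1)"
  obtain R1 where R1: "runs clog_prog (?R0, M) (4 * clog (R 1) + 3) (R1, M)"
    "R1 25 = clog (R 1) * 48" "same {21, 22, 25} ?R0 R1"
    using runs_clog_prog[of ?R0 M] by auto
  let ?R2 = "R1(23 := R 3)"
  obtain R3 where R3: "runs clog_prog (?R2, M) (4 * clog (R 3) + 3) (R3, M)"
    "R3 25 = clog (R 1) * 48 + clog (R 3) * 48" "same {21, 22, 25} ?R2 R3"
    using runs_clog_prog[of ?R2 M] R1(2,3) by auto
  let ?b = "48 * clog (R 1) + 48 * clog (R 3)"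
  let ?R4 = "R3(9 := ?b, 25 := 0, 23 := R 0, 24 := 1)"
  obtain R5 where R5: "runs clog_prog (?R4, M) (4 * clog (R 0) + 3) (R5, M)"
    "R5 25 = clog (R 0)" "same {21, 22, 25} ?R4 R5"
    using runs_clog_prog[of ?R4 M] by auto
  let ?R6 = "R5(10 := clog (R 0), 11 := R 2, 12 := 4, 19 := R 7 + R 0)"
  have s1: "same {21, 22, 23, 24, 25} R R1" using R1(3) by simp
  have s3: "same {21, 22, 23, 24, 25} R R3" using R3(3) s1 by simp
  have s5: "same {9, 21, 22, 23, 24, 25} R R5" "R5 9 = ?b" using R5(3) s3 by simp_all
  have res0: "result (seqs [SetC 24 48, SetC 25 0, Add 23 1 40]) (R, M) = (?R0, M)" using R by simp
  have res2: "result (Add 23 3 40) (R1, M) = (?R2, M)" using R s1 by simp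
  have res4: "result (seqs [Add 9 25 40, SetC 25 0, Add 23 0 40, SetC 24 1]) (R3, M) = (?R4, M)"
    using R s3 R3(2) by (simp add: mult.commute)
  have res6: "result (seqs [Add 10 25 40, Add 11 2 40, SetC 12 4, Add 19 7 0]) (R5, M) = (?R6, M)"
    using R s5 R5(2) by simp
  have "runs init_prog (R, M) (4 * clog (R 1) + 4 * clog (R 3) + 4 * clog (R 0) + 25) (?R6, M)"
    unfolding init_prog_def
    by (rule runs_mono[OF runs_Seq[OF runs_straightI[OF _ order_refl res0] runs_Seq[OF R1(1)
          runs_Seq[OF runs_straightI[OF _ order_refl res2] runs_Seq[OF R3(1)
          runs_Seq[OF runs_straightI[OF _ order_refl res4] runs_Seq[OF R5(1)
          runs_straightI[OF _ order_refl res6]]]]]]]]) simp_all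
  then show ?thesis using s5 by (intro exI[of _ ?R6] conjI) (assumption | simp)+
qed

text \<open>Binary value with the first bit most significant, so that it can be computed by doubling
  while reading forwards.\<close>

primrec bval :: "(nat \<Rightarrow> bool) \<Rightarrow> nat \<Rightarrow> nat" where
  "bval f 0 = 0"
| "bval f (Suc i) = 2 * bval f i + of_bool (f i)"

text \<open>The stages have used up as many factors 1/2 as register 14 says. The remaining bits of k
  are read as a number, and register 22 becomes m minus this number, which is non-zero exactly when
  the coin succeeds.\<close>

definition flag_prog :: com where
  "flag_prog = Seq (seqs [Sub 25 6 14, SetC 21 0, Add 26 13 40])
     (Seq (While 25 (seqs [Load 27 26, Add 21 21 21, Add 21 21 27, Add 26 26 8, Sub 25 25 8])) (Sub 22 5 21))"

lemma runs_flag_prog: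
  assumes R: "R 8 = 1" "R 40 = 0" "R 6 - R 14 = q" "R 13 = pos"
    and M: "\<forall>l<q. M (pos + l) = of_bool (f l)"
  shows "\<exists>R'. runs flag_prog (R, M) (6 * q + 5) (R', M) \<and> same {21, 22, 25, 26, 27} R R' \<and>
    R' 22 = R 5 - bval f q"
proof -
  let ?body = "seqs [Load 27 26, Add 21 21 21, Add 21 21 27, Add 26 26 8, Sub 25 25 8]"
  let ?R0 = "R(25 := q, 21 := 0, 26 := pos)"
  define Inv where "Inv = (\<lambda>i R' M'. M' = M \<and> same {21, 25, 26, 27} R R' \<and> R' 21 = bval f i \<and>
    R' 25 = q - i \<and> R' 26 = pos + i)"
  have "\<exists>R' M'. runs (While 25 ?body) (?R0, M) (q * (5 + 1) + 1) (R', M') \<and> Inv q R' M'"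
  proof (rule while_straight)
    show "Inv 0 ?R0 M" by (simp add: Inv_def)
    fix i R' M' assume i: "i < q" and inv: "Inv i R' M'"
    show "R' 25 \<noteq> 0 \<and> Inv (Suc i) (fst (result ?body (R', M'))) (snd (result ?body (R', M')))"
      using inv i R M unfolding Inv_def by simp
  qed (simp_all add: Inv_def)
  then obtain R' where R': "runs (While 25 ?body) (?R0, M) (q * (5 + 1) + 1) (R', M)"
    and inv: "Inv q R' M" unfolding Inv_def by blast
  let ?R2 = "R'(22 := R 5 - bval f q)"
  have res: "result (Sub 22 5 21) (R', M) = (?R2, M)" using inv by (simp add: Inv_def)
  have "runs flag_prog (R, M) (6 * q + 5) (?R2, M)"
    unfolding flag_prog_def
    by (rule runs_prefixI[OF _ order_refl _ runs_Seq[OF R' runs_straightI[OF _ order_refl res]]])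
      (use R in simp_all)
  then show ?thesis using inv unfolding Inv_def by (intro exI[of _ ?R2] conjI) (assumption | simp)+
qed

text \<open>The output overwrites the seed. Cell \<open>r + i\<close> is read in round i, before a
  write, which goes to cell i, can have reached it.\<close>

definition out_prog :: com where
  "out_prog = Seq (seqs [Add 25 0 40, SetC 26 0, Add 28 7 40])
     (While 25 (seqs [Load 27 28, Ite 27 (SetC 27 0) (Add 27 22 40), Store 26 27,
       Add 26 26 8, Add 28 28 8, Sub 25 25 8]))"

lemma runs_out_prog:
  assumes R: "R 8 = 1" "R 40 = 0" "R 0 = n" "R 7 = r" "R 22 = v"
  shows "\<exists>R' M'. runs out_prog (R, M) (8 * n + 4) (R', M') \<and>
    (\<forall>i<n. M' i = (if M (r + i) = 0 then v else 0))"
proof -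
  let ?body = "seqs [Load 27 28, Ite 27 (SetC 27 0) (Add 27 22 40), Store 26 27,
       Add 26 26 8, Add 28 28 8, Sub 25 25 8]"
  let ?R0 = "R(25 := n, 26 := 0, 28 := r)"
  define Inv where "Inv = (\<lambda>i R' M'. same {25, 26, 27, 28} R R' \<and>
    R' 25 = n - i \<and> R' 26 = i \<and> R' 28 = r + i \<and> (\<forall>j\<ge>i. M' j = M j) \<and>
    (\<forall>i'<i. M' i' = (if M (r + i') = 0 then v else 0)))"
  have "\<exists>R' M'. runs (While 25 ?body) (?R0, M) (n * (7 + 1) + 1) (R', M') \<and> Inv n R' M'"
  proof (rule while_straight)
    show "Inv 0 ?R0 M" by (simp add: Inv_def)
    fix i R' M' assume i: "i < n" and inv: "Inv i R' M'"
    show "R' 25 \<noteq> 0 \<and> Inv (Suc i) (fst (result ?body (R', M'))) (snd (result ?body (R', M')))"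
      using inv i R unfolding Inv_def all_less_Suc by (cases "M (r + i) = 0") simp_all
  qed (simp_all add: Inv_def)
  then obtain R' M' where R': "runs (While 25 ?body) (?R0, M) (n * (7 + 1) + 1) (R', M')"
    and inv: "Inv n R' M'" by blast
  have "runs out_prog (R, M) (8 * n + 4) (R', M')"
    unfolding out_prog_def by (rule runs_prefixI[OF _ order_refl _ R']) (use R in simp_all)
  then show ?thesis using inv unfolding Inv_def by blast
qed

text \<open>A bit per variable counts once for each of the \<open>s * 2 ^ j\<close> literals in
  question, so \<open>dlt / (4 * 2 ^ j)\<close> bits amount to \<open>s * dlt / 4\<close>.\<close>

definition sta :: "nat \<Rightarrow> nat \<Rightarrow> nat \<Rightarrow> nat" where
  "sta b dlt j = b + dpart dlt (4 * 2 ^ j)"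

definition stN :: "nat \<Rightarrow> nat \<Rightarrow> nat \<Rightarrow> nat \<Rightarrow> nat \<Rightarrow> nat" where
  "stN b lg s dlt j = 3 ^ Suc (tlog (2 * lg + (s * 2 ^ j) * (6 * sta b dlt j)))"

definition stpos :: "nat \<Rightarrow> nat \<Rightarrow> nat \<Rightarrow> nat \<Rightarrow> nat \<Rightarrow> nat" where
  "stpos b lg s dlt j = (\<Sum>i<j. 2 * stN b lg s dlt i + sta b dlt i)"

text \<open>For \<open>dlt = 0\<close> the parameter \<delta> is at least 1 and the claimed bound
  exceeds 1, so the coin alone suffices. Otherwise this counts the halvings that lead from a width
  of at least w down to s.\<close>

definition stages :: "nat \<Rightarrow> nat \<Rightarrow> nat \<Rightarrow> nat" where
  "stages w s dlt = (if dlt = 0 then 0 else (LEAST j. w \<le> s * 2 ^ j))"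

lemma le_stages: "0 < s \<Longrightarrow> 0 < dlt \<Longrightarrow> w \<le> s * 2 ^ stages w s dlt"
proof -
  assume "0 < s" "0 < dlt"
  have "w \<le> 2 ^ w" by (simp add: less_imp_le)
  also have "\<dots> \<le> s * 2 ^ w" using \<open>0 < s\<close> by simp
  finally show ?thesis unfolding stages_def using \<open>0 < dlt\<close> by (auto intro: LeastI)
qed

lemma stages_least: "j < stages w s dlt \<Longrightarrow> s * 2 ^ j < w"
  unfolding stages_def using not_less_Least[of j "\<lambda>j. w \<le> s * 2 ^ j"] by (auto split: if_splits)

lemma stages_le: "0 < s \<Longrightarrow> stages w s dlt \<le> w"
proof (cases "stages w s dlt")
  case (Suc j)
  assume s: "0 < s"
  have "j < 2 ^ j" by simp
  also have "2 ^ j \<le> s * 2 ^ j" using s by simp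
  also have "\<dots> < w" using Suc stages_least[of j w s dlt] by simp
  finally show ?thesis using Suc by simp
qed simp

text \<open>Register 18 becomes w minus t, so the stages run with t = s, 2 s, 4 s and so on until t
  reaches w. The analysis applies the widest stage first; for an intersection the order does not
  matter.\<close>

definition main_prog :: com where
  "main_prog = Seq (seqs [SetC 8 1, Sub 18 1 2, Ite 4 (SetC 41 0) (SetC 18 0)])
     (Seq (Ite 18 (Seq init_prog (While 18 stage_prog)) (SetC 41 0)) (Seq flag_prog out_prog))"

definition gen_out :: "nat \<Rightarrow> nat \<Rightarrow> nat \<Rightarrow> nat \<Rightarrow> nat \<Rightarrow> nat \<Rightarrow> nat \<Rightarrow> (nat \<Rightarrow> bool) \<Rightarrow> nat set" where
  "gen_out n b s dlt J m k \<sigma> = {i. i < n \<and>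
     (\<forall>j<J. selected (stN b (clog n) s dlt j) (sta b dlt j) (\<lambda>l. \<sigma> (stpos b (clog n) s dlt j + l)) i) \<and>
     bval (\<lambda>l. \<sigma> (stpos b (clog n) s dlt J + l)) (k - (\<Sum>j<J. sta b dlt j)) < m}"

lemma clog_le: "clog x \<le> x"
  unfolding clog_def by (rule Least_le) (simp add: less_imp_le)

text \<open>The time may depend on n and r only. So w and \<open>clog e\<close> are compared with Z
  only if there is a stage, and then the seed is long enough; without stages the loops that depend
  on them are skipped.\<close>

lemma runs_main_prog:
  fixes n w s e dlt m k r :: nat
  defines "J \<equiv> stages w s dlt" and "b \<equiv> 48 * clog w + 48 * clog e" and "lg \<equiv> clog n"
  assumes s: "0 < s"
    and R: "R 0 = n" "R 1 = w" "R 2 = s" "R 3 = e" "R 4 = dlt" "R 5 = m" "R 6 = k" "R 7 = r"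
      "\<And>j. 8 \<le> j \<Longrightarrow> R j = 0"
    and M: "\<forall>j<r. M j = of_bool (\<sigma> j)" "\<forall>i<n. M (r + i) = 0"
    and lay: "stpos b lg s dlt J + (k - (\<Sum>j<J. sta b dlt j)) \<le> r"
    and Z: "r \<le> Z" "n \<le> Z" "0 < J \<Longrightarrow> w \<le> Z" "0 < J \<Longrightarrow> clog e \<le> Z" "2 \<le> Z"
  shows "\<exists>R' M'. runs main_prog (R, M) (200 * Z ^ 5) (R', M') \<and>
    output_set n (R', M') = gen_out n b s dlt J m k \<sigma>"
proof -
  let ?N = "stN b lg s dlt" and ?a = "sta b dlt" and ?pos = "stpos b lg s dlt"
  let ?at = "\<lambda>j. \<Sum>i<j. ?a i"
  let ?pre = "seqs [SetC 8 1, Sub 18 1 2, Ite 4 (SetC 41 0) (SetC 18 0)]"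
  let ?c = "if dlt = 0 then 0 else w - s"
  let ?R0 = "R(8 := 1, 18 := ?c)"
  let ?S = "{9, 10, 11, 12, 13, 14, 15, 16, 17, 18, 19, 20, 21, 22, 23, 24, 25, 26, 27, 28, 29, 30, 31, 32, 33, 34, 35, 36, 37, 38}"
  have res0: "result ?pre (R, M) = (?R0, M)" using R by (simp add: fun_eq_iff)
  have c: "?c \<noteq> 0 \<longleftrightarrow> 0 < J"
  proof (cases "dlt = 0")
    case True
    then show ?thesis unfolding J_def stages_def by simp
  next
    case False
    then have "w - s \<noteq> 0 \<longleftrightarrow> 0 < J"
      using le_stages[OF s, of dlt w] stages_least[of 0 w s dlt] unfolding J_def
      by (cases "stages w s dlt") auto
    then show ?thesis using False by simp
  qed
  define sel where "sel = (\<lambda>j i. selected (?N j) (?a j) (\<lambda>l. \<sigma> (?pos j + l)) i)"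
  define Inv where "Inv = (\<lambda>j R' M'. same ?S ?R0 R' \<and> R' 13 = ?pos j \<and> R' 14 = ?at j \<and>
    (\<forall>j<r. M' j = M j) \<and> (\<forall>i<n. M' (r + i) = (if \<forall>j'<j. sel j' i then 0 else 1)))"
  have "\<exists>R1 M1. runs (Ite 18 (Seq init_prog (While 18 stage_prog)) (SetC 41 0)) (?R0, M)
      (160 * Z ^ 5) (R1, M1) \<and> Inv J R1 M1"
  proof (cases "0 < J")
    case False
    have "runs (Ite 18 (Seq init_prog (While 18 stage_prog)) (SetC 41 0)) (?R0, M) (1 + 1) (?R0, M)"
      by (rule runs_IteF, use c False in simp, rule runs_straightI) (use R in \<open>simp_all add: fun_eq_iff\<close>)
    moreover have "1 + 1 \<le> 160 * Z ^ 5" using one_le_power[of Z 5] Z(5) by linarith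
    ultimately have "runs (Ite 18 (Seq init_prog (While 18 stage_prog)) (SetC 41 0)) (?R0, M) (160 * Z ^ 5) (?R0, M)"
      by (rule runs_mono)
    moreover have "Inv J ?R0 M" using False R M unfolding Inv_def stpos_def by simp
    ultimately show ?thesis by blast
  next
    case True
    have dlt: "0 < dlt" using True unfolding J_def stages_def by (auto split: if_splits)
    have wZ: "w \<le> Z" "clog e \<le> Z" using Z True by auto
    have "clog w \<le> Z" "clog n \<le> Z" using clog_le[of w] clog_le[of n] wZ Z by simp_all
    note cl = this wZ(2)
    have "?R0 40 = 0" using R by simp
    from runs_init_prog[of ?R0 M, OF this] obtain R1 where R1:
      "runs init_prog (?R0, M) (4 * clog w + 4 * clog e + 4 * clog n + 25) (R1, M)"
      "same {9, 10, 11, 12, 19, 21, 22, 23, 24, 25} ?R0 R1"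
      "R1 9 = b" "R1 10 = lg" "R1 11 = s" "R1 12 = 4" "R1 19 = r + n"
      unfolding b_def lg_def using R by auto
    define Inv' where "Inv' = (\<lambda>j R' M'. Inv j R' M' \<and> R' 9 = b \<and> R' 10 = lg \<and> R' 11 = s * 2 ^ j \<and>
      R' 12 = 4 * 2 ^ j \<and> R' 19 = r + n \<and> R' 18 = w - s * 2 ^ j)"
    have "\<exists>R' M'. runs (While 18 stage_prog) (R1, M) (J * (150 * Z ^ 4 + 1) + 1) (R', M') \<and> Inv' J R' M'"
    proof (rule while_rule)
      show "Inv' 0 R1 M" using R1 R M dlt unfolding Inv'_def Inv_def stpos_def by simp
      show "R' 18 = 0" if "Inv' J R' M'" for R' M'
        using that le_stages[OF s dlt, of w] unfolding Inv'_def J_def by simp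
      fix j R2 M2 assume j: "j < J" and inv: "Inv' j R2 M2"
      have t: "s * 2 ^ j < w" using j unfolding J_def by (rule stages_least)
      show "R2 18 \<noteq> 0" using inv t by (simp add: Inv'_def)
      have s2: "same ?S ?R0 R2" using inv by (simp add: Inv'_def Inv_def)
      have r2: "R2 0 = n" "R2 4 = dlt" "R2 7 = r" "R2 8 = 1" "R2 40 = 0" using s2 R by simp_all
      have r2': "R2 19 = r + n" "R2 9 = b" "R2 10 = lg" "R2 11 = s * 2 ^ j" "R2 12 = 4 * 2 ^ j" "R2 13 = ?pos j"
        and at2: "R2 14 = ?at j" "R2 1 = w"
        using inv s2 R by (simp_all add: Inv'_def Inv_def)
      have pw: "0 < 4 * (2::nat) ^ j" by simp
      have "?pos (Suc j) \<le> ?pos J" unfolding stpos_def using j by (intro sum_mono2) auto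
      then have lay2: "?pos j + (2 * ?N j + ?a j) \<le> r" using lay unfolding stpos_def by simp
      have M2: "\<forall>j<r. M2 j = of_bool (\<sigma> j)" using inv M by (simp add: Inv'_def Inv_def)
      have d2: "\<forall>i<n. M2 (r + i) = (if \<forall>j'<j. sel j' i then 0 else 1)"
        using inv by (simp add: Inv'_def Inv_def)
      have tZ: "s * 2 ^ j \<le> Z" using t wZ by simp
      obtain R3 M3 where R3: "runs stage_prog (R2, M2) (150 * Z ^ 4) (R3, M3)"
        "same {11, 12, 13, 14, 15, 16, 17, 18, 20, 21, 22, 23, 24, 25, 26, 27, 28, 29, 30, 31, 32, 33, 34, 35, 36, 37, 38} R2 R3"
        "R3 11 = 2 * (s * 2 ^ j)" "R3 12 = 2 * (4 * 2 ^ j)" "R3 13 = ?pos j + (2 * ?N j + ?a j)"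
        "R3 14 = R2 14 + ?a j" "R3 18 = R2 1 - 2 * (s * 2 ^ j)" "\<forall>j<r. M3 j = M2 j"
        "\<forall>i<n. M3 (r + i) = (if selected (?N j) (?a j) (\<lambda>l. \<sigma> (?pos j + l)) i then M2 (r + i) else 1)"
        using runs_stage_prog[OF r2 r2' pw sta_def stN_def lay2 M2 Z(1,2) tZ Z(5)] by blast
      have "\<forall>i<n. M3 (r + i) = (if \<forall>j'<Suc j. sel j' i then 0 else 1)"
        using R3(9) d2 unfolding all_less_Suc sel_def by auto
      moreover have "\<forall>j<r. M3 j = M j" using R3(8) inv by (simp add: Inv'_def Inv_def)
      moreover have "same ?S ?R0 R3" using R3(2) s2 by simp
      ultimately have "Inv (Suc j) R3 M3" using R3(5,6) at2 unfolding Inv_def by (simp add: stpos_def)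
      then have "Inv' (Suc j) R3 M3" using R3(2-4,7) r2' at2 unfolding Inv'_def by simp
      then show "\<exists>R' M'. runs stage_prog (R2, M2) (150 * Z ^ 4) (R', M') \<and> Inv' (Suc j) R' M'"
        using R3(1) by blast
    qed
    then obtain R2 M2 where R2: "runs (While 18 stage_prog) (R1, M) (J * (150 * Z ^ 4 + 1) + 1) (R2, M2)"
      and inv: "Inv J R2 M2" unfolding Inv'_def by blast
    have "runs (Ite 18 (Seq init_prog (While 18 stage_prog)) (SetC 41 0)) (?R0, M)
      (((4 * clog w + 4 * clog e + 4 * clog n + 25) + (J * (150 * Z ^ 4 + 1) + 1)) + 1) (R2, M2)"
      by (rule runs_IteT[OF _ runs_Seq[OF R1(1) R2]]) (use c True in simp)
    moreover have "((4 * clog w + 4 * clog e + 4 * clog n + 25) + (J * (150 * Z ^ 4 + 1) + 1)) + 1 \<le> 160 * Z ^ 5"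
    proof -
      have "J \<le> Z" using stages_le[OF s, of w dlt] wZ unfolding J_def by simp
      then have "J * (150 * Z ^ 4 + 1) \<le> Z * (150 * Z ^ 4 + 1)" by (intro mult_right_mono) auto
      also have "\<dots> = 150 * Z ^ 5 + Z" by (simp add: numeral_eq_Suc algebra_simps)
      finally have 1: "J * (150 * Z ^ 4 + 1) \<le> 150 * Z ^ 5 + Z" .
      have "Z * 2 ^ 4 \<le> Z * Z ^ 4" using Z by (intro mult_left_mono power_mono) auto
      then have 2: "Z * 16 \<le> Z ^ 5" by (simp add: numeral_eq_Suc)
      have "p \<le> 150 * Q + Z \<Longrightarrow> Z * 16 \<le> Q \<Longrightarrow>
        ((4 * clog w + 4 * clog e + 4 * clog n + 25) + (p + 1)) + 1 \<le> 160 * Q" for p Q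
        using cl Z(5) by simp
      then show ?thesis using 1 2 by blast
    qed
    ultimately show ?thesis using inv runs_mono by blast
  qed
  then obtain R1 M1 where R1: "runs (Ite 18 (Seq init_prog (While 18 stage_prog)) (SetC 41 0)) (?R0, M)
      (160 * Z ^ 5) (R1, M1)" and inv: "Inv J R1 M1" by blast
  have s1: "same ?S ?R0 R1" and r1: "R1 13 = ?pos J" "R1 14 = ?at J" and m1: "\<forall>j<r. M1 j = M j"
    "\<forall>i<n. M1 (r + i) = (if \<forall>j'<J. sel j' i then 0 else 1)"
    using inv by (simp_all add: Inv_def)
  let ?q = "k - ?at J" and ?f = "\<lambda>l. \<sigma> (?pos J + l)"
  have "R1 8 = 1" "R1 40 = 0" "R1 6 - R1 14 = ?q" "R1 13 = ?pos J" using s1 r1 R by simp_all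
  moreover have "\<forall>l<?q. M1 (?pos J + l) = of_bool (?f l)" using m1(1) M(1) lay by simp
  ultimately obtain R2 where R2: "runs flag_prog (R1, M1) (6 * ?q + 5) (R2, M1)"
    "same {21, 22, 25, 26, 27} R1 R2" "R2 22 = R1 5 - bval ?f ?q"
    using runs_flag_prog[of R1 ?q "?pos J" M1 ?f] by blast
  have "R2 8 = 1" "R2 40 = 0" "R2 0 = n" "R2 7 = r" using R2(2) s1 R by simp_all
  moreover have v: "R2 22 = m - bval ?f ?q" using R2(3) s1 R by simp
  ultimately obtain R3 M3 where R3: "runs out_prog (R2, M1) (8 * n + 4) (R3, M3)"
    "\<forall>i<n. M3 i = (if M1 (r + i) = 0 then m - bval ?f ?q else 0)"
    using runs_out_prog[of R2 n r "m - bval ?f ?q" M1] by blast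
  have "runs main_prog (R, M) (4 + (160 * Z ^ 5 + ((6 * ?q + 5) + (8 * n + 4)))) (R3, M3)"
    unfolding main_prog_def
    by (rule runs_mono[OF runs_Seq[OF runs_straightI[OF _ order_refl res0] runs_Seq[OF R1 runs_Seq[OF R2(1) R3(1)]]]])
      simp_all
  moreover have "4 + (160 * Z ^ 5 + ((6 * ?q + 5) + (8 * n + 4))) \<le> 200 * Z ^ 5"
  proof -
    have "Z * 2 ^ 4 \<le> Z * Z ^ 4" using Z by (intro mult_left_mono power_mono) auto
    then have 2: "Z * 16 \<le> Z ^ 5" by (simp add: numeral_eq_Suc)
    have "?q \<le> Z" using lay Z by simp
    moreover have "q \<le> Z \<Longrightarrow> Z * 16 \<le> Q \<Longrightarrow> 4 + (160 * Q + ((6 * q + 5) + (8 * n + 4))) \<le> 200 * Q" for q Q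
      using Z(2,5) by simp
    ultimately show ?thesis using 2 by blast
  qed
  ultimately have "runs main_prog (R, M) (200 * Z ^ 5) (R3, M3)" by (rule runs_mono)
  moreover have "output_set n (R3, M3) = gen_out n b s dlt J m k \<sigma>"
  proof -
    have "M3 i \<noteq> 0 \<longleftrightarrow> (\<forall>j<J. sel j i) \<and> bval ?f ?q < m" if "i < n" for i
      using R3(2) m1(2) that by (cases "\<forall>j<J. sel j i") (simp_all add: not_le)
    then have "output_set n (R3, M3) = {i. i < n \<and> (\<forall>j<J. sel j i) \<and> bval ?f ?q < m}"
      unfolding output_set_def snd_conv by blast
    then show ?thesis unfolding gen_out_def sel_def lg_def .
  qed
  ultimately show ?thesis by blast
qed

section \<open>The distribution of the output\<close>

definition ulist :: "nat \<Rightarrow> bool list pmf" where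
  "ulist N = pmf_of_set {\<sigma>. length \<sigma> = N}"

lemma bool_lists_nonempty: "{\<sigma> :: bool list. length \<sigma> = N} \<noteq> {}"
  using Ex_list_of_length[of N] by blast

lemma set_ulist: "set_pmf (ulist N) = {\<sigma>. length \<sigma> = N}"
  unfolding ulist_def by (rule set_pmf_of_set[OF bool_lists_nonempty finite_bool_lists])

lemma prob_ulist: "measure_pmf.prob (ulist N) A = real (card {\<sigma>\<in>A. length \<sigma> = N}) / 2 ^ N"
proof -
  have "{\<sigma> :: bool list. length \<sigma> = N} \<inter> A = {\<sigma>\<in>A. length \<sigma> = N}" by blast
  then show ?thesis
    unfolding ulist_def measure_pmf_of_set[OF bool_lists_nonempty finite_bool_lists] card_bool_lists by simp
qed

lemma ulist_add: "ulist (a + b) = map_pmf (\<lambda>(u, v). u @ v) (pair_pmf (ulist a) (ulist b))"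
proof (rule pmf_eqI)
  fix \<sigma> :: "bool list"
  let ?S = "{(u :: bool list, v :: bool list). length u = a \<and> length v = b}"
  have vim: "measure_pmf.prob (pair_pmf (ulist a) (ulist b)) ((\<lambda>(u, v). u @ v) -` {\<sigma>})
    = measure_pmf.prob (pair_pmf (ulist a) (ulist b)) {z. fst z = take a \<sigma> \<and> (snd z = drop a \<sigma> \<and> length \<sigma> = a + b)}"
  proof (intro antisym prob_mono_set_pmf)
    fix z assume "z \<in> set_pmf (pair_pmf (ulist a) (ulist b))"
    then obtain u v where z: "z = (u, v)" "length u = a" "length v = b" by (auto simp: set_ulist)
    have "u @ v = \<sigma> \<longleftrightarrow> u = take a \<sigma> \<and> (v = drop a \<sigma> \<and> length \<sigma> = a + b)"
      using append_eq_conv_conj[of u v \<sigma>] z(2,3) by auto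
    then have "z \<in> (\<lambda>(u, v). u @ v) -` {\<sigma>} \<longleftrightarrow>
        z \<in> {z. fst z = take a \<sigma> \<and> (snd z = drop a \<sigma> \<and> length \<sigma> = a + b)}"
      unfolding z(1) by simp
    then show "z \<in> (\<lambda>(u, v). u @ v) -` {\<sigma>} \<Longrightarrow> z \<in> {z. fst z = take a \<sigma> \<and> (snd z = drop a \<sigma> \<and> length \<sigma> = a + b)}"
      "z \<in> {z. fst z = take a \<sigma> \<and> (snd z = drop a \<sigma> \<and> length \<sigma> = a + b)} \<Longrightarrow> z \<in> (\<lambda>(u, v). u @ v) -` {\<sigma>}"
      by blast+
  qed
  also have "\<dots> = measure_pmf.prob (ulist a) {u. u = take a \<sigma>}
      * measure_pmf.prob (ulist b) {v. v = drop a \<sigma> \<and> length \<sigma> = a + b}"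
    by (rule prob_pair_indep)
  also have "\<dots> = pmf (ulist (a + b)) \<sigma>"
  proof (cases "length \<sigma> = a + b")
    case True
    then have "{\<sigma>' \<in> {u. u = take a \<sigma>}. length \<sigma>' = a} = {take a \<sigma>}"
      "{\<sigma>' \<in> {v. v = drop a \<sigma> \<and> length \<sigma> = a + b}. length \<sigma>' = b} = {drop a \<sigma>}"
      "{\<sigma>' \<in> {\<sigma>}. length \<sigma>' = a + b} = {\<sigma>}" by auto
    then show ?thesis unfolding pmf.rep_eq prob_ulist by (simp add: power_add)
  next
    case False
    then show ?thesis by (simp add: pmf_eq_0_set_pmf[symmetric] set_ulist pmf_eq_0_set_pmf)
  qed
  finally show "pmf (ulist (a + b)) \<sigma> = pmf (map_pmf (\<lambda>(u, v). u @ v) (pair_pmf (ulist a) (ulist b))) \<sigma>"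
    by (simp add: pmf_map)
qed

lemma cpow_cong:
  assumes "\<And>l. l < N \<Longrightarrow> x l = x' l" "0 < N"
  shows "cpow N x e = cpow N x' e"
proof (induction e)
  case (Suc e)
  have "x ((i + (N - l)) mod N) = x' ((i + (N - l)) mod N)" for i l using assms by simp
  then show ?case using Suc by simp
qed simp

lemma dotp_cong:
  assumes "\<And>l. l < N \<Longrightarrow> y l = y' l"
  shows "dotp N c y = dotp N c y'"
proof -
  have "{i. i < N \<and> c i \<and> y i} = {i. i < N \<and> c i \<and> y' i}" using assms by auto
  then show ?thesis unfolding dotp_def by (simp only:)
qed

lemma selected_cong:
  assumes "\<And>l. l < 2 * N + a \<Longrightarrow> \<sigma> l = \<sigma>' l" "0 < N"
  shows "selected N a \<sigma> i = selected N a \<sigma>' i"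
proof -
  have c: "cpow N (\<lambda>l. \<sigma> l) e = cpow N (\<lambda>l. \<sigma>' l) e" for e by (rule cpow_cong) (use assms in auto)
  have d: "dotp N v (\<lambda>l. \<sigma> (N + l)) = dotp N v (\<lambda>l. \<sigma>' (N + l))" for v
    by (rule dotp_cong) (use assms in auto)
  have u: "\<sigma> (2 * N + b) = \<sigma>' (2 * N + b)" if "b < a" for b using assms that by auto
  show ?thesis unfolding selected_def c d using u by simp
qed

lemma selected_append:
  assumes "length xs = N" "length ys = N" "length us = a" "0 < N"
  shows "selected N a ((!) ((xs @ ys) @ us)) i \<longleftrightarrow>
    (\<forall>b<a. dotp N (cpow N ((!) xs) (a * i + b)) ((!) ys) = us ! b)"
proof -
  let ?\<sigma> = "(!) ((xs @ ys) @ us)"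
  have c: "cpow N (\<lambda>l. ?\<sigma> l) e = cpow N ((!) xs) e" for e
    by (rule cpow_cong) (use assms in \<open>auto simp: nth_append\<close>)
  have d: "dotp N v (\<lambda>l. ?\<sigma> (N + l)) = dotp N v ((!) ys)" for v
    by (rule dotp_cong) (use assms in \<open>auto simp: nth_append\<close>)
  have u: "?\<sigma> (2 * N + b) = us ! b" for b using assms by (simp add: nth_append)
  show ?thesis unfolding selected_def c d u ..
qed

section \<open>Distribution of one stage\<close>

definition stage_pmf :: "nat \<Rightarrow> nat \<Rightarrow> nat \<Rightarrow> nat set pmf" where
  "stage_pmf n N a = map_pmf (\<lambda>\<sigma>. {i. i < n \<and> selected N a ((!) \<sigma>) i}) (ulist (2 * N + a))"

lemma stage_pmf_triple:
  assumes "0 < N"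
  shows "stage_pmf n N a = map_pmf (\<lambda>((xs, ys), us).
    {i. i < n \<and> (\<forall>b<a. dotp N (cpow N ((!) xs) (a * i + b)) ((!) ys) = us ! b)})
    (pair_pmf (pair_pmf (ulist N) (ulist N)) (ulist a))"
proof -
  have "ulist (2 * N + a) = map_pmf (\<lambda>((xs, ys), us). (xs @ ys) @ us)
      (pair_pmf (pair_pmf (ulist N) (ulist N)) (ulist a))"
    unfolding mult_2 ulist_add by (simp add: pair_map_pmf1 map_pmf_comp case_prod_unfold)
  then have "stage_pmf n N a = map_pmf (\<lambda>((xs, ys), us). {i. i < n \<and> selected N a ((!) ((xs @ ys) @ us)) i})
      (pair_pmf (pair_pmf (ulist N) (ulist N)) (ulist a))"
    unfolding stage_pmf_def by (simp add: map_pmf_comp case_prod_unfold)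
  also have "\<dots> = map_pmf (\<lambda>((xs, ys), us).
    {i. i < n \<and> (\<forall>b<a. dotp N (cpow N ((!) xs) (a * i + b)) ((!) ys) = us ! b)})
    (pair_pmf (pair_pmf (ulist N) (ulist N)) (ulist a))"
  proof (intro map_pmf_cong refl)
    fix z assume "z \<in> set_pmf (pair_pmf (pair_pmf (ulist N) (ulist N)) (ulist a))"
    then obtain xs ys us where z: "z = ((xs, ys), us)" "length xs = N" "length ys = N" "length us = a"
      by (auto simp: set_ulist)
    show "(\<lambda>((xs, ys), us). {i. i < n \<and> selected N a ((!) ((xs @ ys) @ us)) i}) z
      = (\<lambda>((xs, ys), us). {i. i < n \<and> (\<forall>b<a. dotp N (cpow N ((!) xs) (a * i + b)) ((!) ys) = us ! b)}) z"
      unfolding z(1) prod.case selected_append[OF z(2-4) assms] ..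
  qed
  finally show ?thesis .
qed

text \<open>For every fixed output of the generator, exactly one value of the uniform third block
  selects the variable.\<close>

lemma prob_stage_mem:
  assumes "0 < N" "i < n"
  shows "measure_pmf.prob (stage_pmf n N a) {L. i \<in> L} = 1 / 2 ^ a"
proof -
  have one: "measure_pmf.prob (ulist a) {us. \<forall>b<a. f b = us ! b} = 1 / 2 ^ a" for f
  proof -
    have "us = map f [0..<a]" if "\<forall>b<a. f b = us ! b" "length us = a" for us
      by (rule nth_equalityI) (use that in simp_all)
    then have s: "{us \<in> {us. \<forall>b<a. f b = us ! b}. length us = a} = {map f [0..<a]}" by fastforce
    show ?thesis unfolding prob_ulist s by simp
  qed
  have "measure_pmf.prob (stage_pmf n N a) {L. i \<in> L} = measure_pmf.prob (pair_pmf (pair_pmf (ulist N) (ulist N)) (ulist a))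
      {((xs, ys), us). \<forall>b<a. dotp N (cpow N ((!) xs) (a * i + b)) ((!) ys) = us ! b}"
    unfolding stage_pmf_triple[OF assms(1)] using assms(2) by (simp add: vimage_def case_prod_unfold)
  also have "\<dots> = measure_pmf.expectation (pair_pmf (ulist N) (ulist N)) (\<lambda>z. 1 / 2 ^ a)"
    unfolding prob_pair_pmf by (simp add: case_prod_unfold one)
  finally show ?thesis by simp
qed

text \<open>For a fixed third block the event prescribes the generated bits at the
  \<open>a * t\<close> distinct positions \<open>a * i + b\<close>, all below \<open>n * a\<close>.
  The target at position e is \<open>us ! (e mod a)\<close>, so \<open>card_seeds\<close>
  applies.\<close>

lemma prob_stage_subset:
  assumes N: "N = 3 ^ Suc q" and a: "0 < a" and W: "W \<subseteq> {..<n}" "card W = t"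
  shows "measure_pmf.prob (stage_pmf n N a) {L. W \<subseteq> L} \<le> 1 / 2 ^ (a * t) + real (n * a) / 2 ^ (2 * 3 ^ q)"
proof -
  have N0: "0 < N" using N by simp
  have finW: "finite W" using W finite_subset by blast
  define E where "E = (\<lambda>(i, b). a * i + b) ` (W \<times> {..<a})"
  have inj: "inj_on (\<lambda>(i, b). a * i + b) (W \<times> {..<a})"
  proof (rule inj_onI, clarsimp)
    fix i b i' b' assume *: "b < a" "b' < a" "a * i + b = a * i' + b'"
    have d: "(a * i + b) div a = i" "(a * i' + b') div a = i'" "(a * i + b) mod a = b" "(a * i' + b') mod a = b'"
      using *(1,2) by simp_all
    show "i = i' \<and> b = b'" using d(1,3) unfolding *(3) d(2,4) by simp
  qed
  have cE: "card E = a * t" unfolding E_def using card_image[OF inj] W by (simp add: card_cartesian_product)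
  have ED: "E \<subseteq> {..<n * a}"
  proof
    fix e assume "e \<in> E"
    then obtain i b where e: "e = a * i + b" "i \<in> W" "b < a" unfolding E_def by auto
    then have "Suc i \<le> n" using W by auto
    then have "a * Suc i \<le> a * n" by (rule mult_le_mono2)
    then show "e \<in> {..<n * a}" using e by (simp add: mult.commute)
  qed
  let ?P = "\<lambda>xs ys us. \<forall>e\<in>E. dotp N (cpow N ((!) xs) e) ((!) ys) = us ! (e mod a)"
  have "measure_pmf.prob (stage_pmf n N a) {L. W \<subseteq> L} = measure_pmf.prob
      (pair_pmf (ulist a) (pair_pmf (ulist N) (ulist N))) {(us, (xs, ys)). ?P xs ys us}"
  proof -
    have "W \<subseteq> {i. i < n \<and> (\<forall>b<a. dotp N (cpow N ((!) xs) (a * i + b)) ((!) ys) = us ! b)} \<longleftrightarrow> ?P xs ys us" for xs ys us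
      using W unfolding E_def by auto
    then show ?thesis
      unfolding stage_pmf_triple[OF N0] by (subst pair_commute_pmf) (simp add: vimage_def case_prod_unfold)
  qed
  also have "\<dots> \<le> 1 / 2 ^ (a * t) + real (n * a) / 2 ^ (2 * 3 ^ q)"
  proof (rule prob_pair_le)
    fix us :: "bool list"
    have "measure_pmf.prob (pair_pmf (ulist N) (ulist N)) {(xs, ys). ?P xs ys us}
      = (\<Sum>xs | length (xs::bool list) = N. measure_pmf.prob (ulist N) {ys. ?P xs ys us}) / 2 ^ N"
      unfolding prob_pair_pmf
      by (subst (1) ulist_def) (simp add: integral_pmf_of_set[OF bool_lists_nonempty finite_bool_lists] card_bool_lists)
    also have "\<dots> = (\<Sum>xs | length (xs::bool list) = N. real (card {ys. length ys = N \<and> ?P xs ys us})) / 2 ^ (2 * N)"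
      unfolding prob_ulist by (simp add: sum_divide_distrib[symmetric] power_add mult_2 conj_commute)
    also have "\<dots> \<le> (2 ^ (2 * N) * (1 / 2 ^ card E + real (n * a) / 2 ^ (2 * 3 ^ q))) / 2 ^ (2 * N)"
      by (intro divide_right_mono card_seeds[OF ED N]) simp
    also have "\<dots> = 1 / 2 ^ (a * t) + real (n * a) / 2 ^ (2 * 3 ^ q)" unfolding cE by simp
    finally show "measure_pmf.prob (pair_pmf (ulist N) (ulist N)) {y. (us, y) \<in> {(us, (xs, ys)). ?P xs ys us}}
      \<le> 1 / 2 ^ (a * t) + real (n * a) / 2 ^ (2 * 3 ^ q)" by (simp add: case_prod_unfold)
  qed
  finally show ?thesis .
qed

section \<open>Several stages and the coin\<close>

definition prefix_pmf :: "nat \<Rightarrow> nat \<Rightarrow> nat \<Rightarrow> nat \<Rightarrow> nat \<Rightarrow> nat set pmf" where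
  "prefix_pmf n b s dlt j = map_pmf (\<lambda>\<sigma>. {i. i < n \<and> (\<forall>j'<j. selected (stN b (clog n) s dlt j') (sta b dlt j')
     (\<lambda>l. \<sigma> ! (stpos b (clog n) s dlt j' + l)) i)}) (ulist (stpos b (clog n) s dlt j))"

lemma stN_pos: "0 < stN b lg s dlt j"
  unfolding stN_def by simp

lemma stpos_mono: "j < j' \<Longrightarrow> stpos b lg s dlt j + (2 * stN b lg s dlt j + sta b dlt j) \<le> stpos b lg s dlt j'"
proof -
  assume "j < j'"
  then have "stpos b lg s dlt (Suc j) \<le> stpos b lg s dlt j'" unfolding stpos_def by (intro sum_mono2) auto
  then show ?thesis by (simp add: stpos_def)
qed

lemma selected_prefix:
  assumes "j' < j" "length u = stpos b lg s dlt j"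
  shows "selected (stN b lg s dlt j') (sta b dlt j') (\<lambda>l. (u @ v) ! (stpos b lg s dlt j' + l)) i
    = selected (stN b lg s dlt j') (sta b dlt j') (\<lambda>l. u ! (stpos b lg s dlt j' + l)) i"
  by (rule selected_cong[OF _ stN_pos]) (use stpos_mono[OF assms(1), of b lg s dlt] assms(2) in \<open>auto simp: nth_append\<close>)

text \<open>The stage with the largest t is split off: it acts on width \<open>2 * t\<close> before
  the narrower stages do, which is the order that \<open>fails_step\<close> requires.\<close>

lemma prefix_pmf_Suc:
  "prefix_pmf n b s dlt (Suc j) = map_pmf (\<lambda>(L1, L). L1 \<inter> L)
     (pair_pmf (stage_pmf n (stN b (clog n) s dlt j) (sta b dlt j)) (prefix_pmf n b s dlt j))"
proof -
  let ?N = "stN b (clog n) s dlt" and ?a = "sta b dlt" and ?p = "stpos b (clog n) s dlt"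
  let ?U = "\<lambda>u. {i. i < n \<and> (\<forall>j'<j. selected (?N j') (?a j') (\<lambda>l. u ! (?p j' + l)) i)}"
  let ?V = "\<lambda>v. {i. i < n \<and> selected (?N j) (?a j) ((!) v) i}"
  have "prefix_pmf n b s dlt (Suc j) = map_pmf (\<lambda>(u, v). {i. i < n \<and> (\<forall>j'<Suc j.
      selected (?N j') (?a j') (\<lambda>l. (u @ v) ! (?p j' + l)) i)}) (pair_pmf (ulist (?p j)) (ulist (2 * ?N j + ?a j)))"
  proof -
    have p: "?p (Suc j) = ?p j + (2 * ?N j + ?a j)" by (simp add: stpos_def)
    show ?thesis unfolding prefix_pmf_def p ulist_add[of "?p j" "2 * ?N j + ?a j"]
      by (simp add: map_pmf_comp case_prod_unfold)
  qed
  also have "\<dots> = map_pmf (\<lambda>(u, v). ?V v \<inter> ?U u) (pair_pmf (ulist (?p j)) (ulist (2 * ?N j + ?a j)))"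
  proof (intro map_pmf_cong refl)
    fix z assume "z \<in> set_pmf (pair_pmf (ulist (?p j)) (ulist (2 * ?N j + ?a j)))"
    then obtain u v where z: "z = (u, v)" "length u = ?p j" by (auto simp: set_ulist)
    have "selected (?N j) (?a j) (\<lambda>l. (u @ v) ! (?p j + l)) i = selected (?N j) (?a j) ((!) v) i" for i
      by (rule selected_cong[OF _ stN_pos]) (simp add: nth_append z(2))
    then show "(\<lambda>(u, v). {i. i < n \<and> (\<forall>j'<Suc j. selected (?N j') (?a j') (\<lambda>l. (u @ v) ! (?p j' + l)) i)}) z
      = (\<lambda>(u, v). ?V v \<inter> ?U u) z"
      using selected_prefix[OF _ z(2)] unfolding z(1) prod.case all_less_Suc by auto
  qed
  also have "\<dots> = map_pmf (\<lambda>(L1, L). L1 \<inter> L) (pair_pmf (stage_pmf n (?N j) (?a j)) (prefix_pmf n b s dlt j))"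
    unfolding stage_pmf_def prefix_pmf_def
    by (subst pair_commute_pmf) (simp add: map_pair[symmetric] map_pmf_comp case_prod_unfold)
  finally show ?thesis .
qed

lemma prob_prefix_mem:
  assumes "i < n"
  shows "measure_pmf.prob (prefix_pmf n b s dlt j) {L. i \<in> L} = 1 / 2 ^ (\<Sum>j'<j. sta b dlt j')"
proof (induction j)
  case 0
  then show ?case unfolding prefix_pmf_def using assms by (simp add: indicator_def)
next
  case (Suc j)
  have "measure_pmf.prob (prefix_pmf n b s dlt (Suc j)) {L. i \<in> L} =
      measure_pmf.prob (stage_pmf n (stN b (clog n) s dlt j) (sta b dlt j)) {L. i \<in> L}
      * measure_pmf.prob (prefix_pmf n b s dlt j) {L. i \<in> L}"
    unfolding prefix_pmf_Suc
    by (simp add: vimage_def case_prod_unfold prob_pair_indep)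
  then show ?case using Suc prob_stage_mem[OF stN_pos assms] by (simp add: power_add mult.commute)
qed

lemma bval_less: "bval f q < 2 ^ q"
  by (induction q) auto

lemma bval_inj: "bval f q = bval g q \<Longrightarrow> l < q \<Longrightarrow> f l = g l"
proof (induction q)
  case (Suc q)
  have "bval f q = bval g q \<and> f q = g q"
    using Suc.prems(1) by (cases "f q"; cases "g q") (simp_all, presburger+)
  then show ?case using Suc by (auto simp: less_Suc_eq)
qed simp

lemma bval_cong: "(\<And>l. l < q \<Longrightarrow> f l = g l) \<Longrightarrow> bval f q = bval g q"
  by (induction q) auto

text \<open>\<open>bval\<close> maps the strings of length q bijectively onto
  \<open>{..<2 ^ q}\<close>, and the d further bits are averaged out.\<close>

lemma prob_bval_less:
  assumes "m \<le> 2 ^ q"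
  shows "measure_pmf.prob (ulist (q + d)) {v. bval ((!) v) q < m} = real m / 2 ^ q"
proof -
  have "measure_pmf.prob (ulist (q + d)) {v. bval ((!) v) q < m}
    = measure_pmf.prob (pair_pmf (ulist q) (ulist d)) {z. bval ((!) (fst z)) q < m \<and> True}"
  proof -
    have "measure_pmf.prob (ulist (q + d)) {v. bval ((!) v) q < m}
      = measure_pmf.prob (pair_pmf (ulist q) (ulist d)) {z. bval ((!) (fst z @ snd z)) q < m}"
      unfolding ulist_add by (simp add: vimage_def case_prod_unfold)
    also have "\<dots> = measure_pmf.prob (pair_pmf (ulist q) (ulist d)) {z. bval ((!) (fst z)) q < m \<and> True}"
    proof (intro antisym prob_mono_set_pmf)
      fix z assume "z \<in> set_pmf (pair_pmf (ulist q) (ulist d))"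
      then have "bval ((!) (fst z @ snd z)) q = bval ((!) (fst z)) q"
        by (intro bval_cong) (auto simp: set_ulist nth_append)
      then show "z \<in> {z. bval ((!) (fst z @ snd z)) q < m} \<Longrightarrow> z \<in> {z. bval ((!) (fst z)) q < m \<and> True}"
        "z \<in> {z. bval ((!) (fst z)) q < m \<and> True} \<Longrightarrow> z \<in> {z. bval ((!) (fst z @ snd z)) q < m}" by simp_all
    qed
    finally show ?thesis .
  qed
  also have "\<dots> = measure_pmf.prob (ulist q) {v. bval ((!) v) q < m}"
    using prob_pair_indep[of "ulist q" "ulist d" "\<lambda>v. bval ((!) v) q < m" "\<lambda>_. True"] by simp
  also have "\<dots> = real m / 2 ^ q"
  proof -
    let ?S = "{v :: bool list. length v = q}"
    have inj: "inj_on (\<lambda>v. bval ((!) v) q) ?S"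
      by (intro inj_onI nth_equalityI) (auto dest: bval_inj)
    have "(\<lambda>v. bval ((!) v) q) ` ?S = {..<2 ^ q}"
      by (rule card_subset_eq) (use bval_less card_image[OF inj] in \<open>auto simp: card_bool_lists\<close>)
    then have im: "(\<lambda>v. bval ((!) v) q) ` ?S = {..<2 ^ q}" .
    have "(\<lambda>v. bval ((!) v) q) ` {v\<in>?S. bval ((!) v) q < m} = {..<m}"
    proof (intro equalityI subsetI)
      fix x assume x: "x \<in> {..<m}"
      then have "x \<in> (\<lambda>v. bval ((!) v) q) ` ?S" unfolding im using assms by simp
      then show "x \<in> (\<lambda>v. bval ((!) v) q) ` {v\<in>?S. bval ((!) v) q < m}" using x by auto
    qed auto
    moreover have "inj_on (\<lambda>v. bval ((!) v) q) {v\<in>?S. bval ((!) v) q < m}"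
      by (rule inj_on_subset[OF inj]) auto
    ultimately have "card {v\<in>?S. bval ((!) v) q < m} = card {..<m}"
      using card_image[of "\<lambda>v. bval ((!) v) q" "{v\<in>?S. bval ((!) v) q < m}"] by (simp only:)
    moreover have "{v\<in>?S. bval ((!) v) q < m} = {v \<in> {v. bval ((!) v) q < m}. length v = q}" by auto
    ultimately show ?thesis unfolding prob_ulist by simp
  qed
  finally show ?thesis .
qed

text \<open>The coin reads its bits behind those of the stages, hence is independent of them.
  Surplus bits do no harm, which allows one r for all k.\<close>

lemma gen_out_pmf:
  assumes r: "stpos b (clog n) s dlt J + (k - (\<Sum>j<J. sta b dlt j)) \<le> r"
  shows "map_pmf (\<lambda>\<sigma>. gen_out n b s dlt J m k ((!) \<sigma>)) (ulist r)
    = map_pmf (\<lambda>(v, L). if bval ((!) v) (k - (\<Sum>j<J. sta b dlt j)) < m then L else {})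
      (pair_pmf (ulist (r - stpos b (clog n) s dlt J)) (prefix_pmf n b s dlt J))"
proof -
  let ?N = "stN b (clog n) s dlt" and ?a = "sta b dlt" and ?p = "stpos b (clog n) s dlt"
  let ?q = "k - (\<Sum>j<J. sta b dlt j)"
  let ?U = "\<lambda>u. {i. i < n \<and> (\<forall>j'<J. selected (?N j') (?a j') (\<lambda>l. u ! (?p j' + l)) i)}"
  have "ulist r = ulist (?p J + (r - ?p J))" using r by simp
  then have "map_pmf (\<lambda>\<sigma>. gen_out n b s dlt J m k ((!) \<sigma>)) (ulist r)
    = map_pmf (\<lambda>(u, v). gen_out n b s dlt J m k ((!) (u @ v))) (pair_pmf (ulist (?p J)) (ulist (r - ?p J)))"
    unfolding ulist_add by (simp add: map_pmf_comp case_prod_unfold)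
  also have "\<dots> = map_pmf (\<lambda>(u, v). if bval ((!) v) ?q < m then ?U u else {})
      (pair_pmf (ulist (?p J)) (ulist (r - ?p J)))"
  proof (intro map_pmf_cong refl)
    fix z assume "z \<in> set_pmf (pair_pmf (ulist (?p J)) (ulist (r - ?p J)))"
    then obtain u v where z: "z = (u, v)" "length u = ?p J" by (auto simp: set_ulist)
    have "bval (\<lambda>l. (u @ v) ! (?p J + l)) ?q = bval ((!) v) ?q"
      by (rule bval_cong) (simp add: nth_append z(2))
    then show "(\<lambda>(u, v). gen_out n b s dlt J m k ((!) (u @ v))) z
      = (\<lambda>(u, v). if bval ((!) v) ?q < m then ?U u else {}) z"
      using selected_prefix[OF _ z(2)] unfolding z(1) prod.case gen_out_def by auto
  qed
  also have "\<dots> = map_pmf (\<lambda>(v, L). if bval ((!) v) ?q < m then L else {})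
      (pair_pmf (ulist (r - ?p J)) (prefix_pmf n b s dlt J))"
    unfolding prefix_pmf_def by (subst pair_commute_pmf) (simp add: pair_map_pmf2 map_pmf_comp case_prod_unfold cong: if_cong)
  finally show ?thesis .
qed

section \<open>Choice of the parameters\<close>

lemma scaled_cube_le_power:
  fixes v :: nat
  assumes "2 \<le> v"
  shows "640 * v ^ 3 \<le> v ^ 16"
proof -
  have "640 \<le> (2::nat) ^ 13" by simp
  also have "\<dots> \<le> v ^ 13" using assms by (rule power_mono) simp
  finally have "640 * v ^ 3 \<le> v ^ 13 * v ^ 3" by (rule mult_right_mono) simp
  then show ?thesis by (simp flip: power_add)
qed

lemma clog_pos: "2 \<le> x \<Longrightarrow> 1 \<le> clog x"
  using le_power_clog[of x] by (cases "clog x") auto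

lemma clog_le_log:
  assumes "1 \<le> x"
  shows "real (clog x) \<le> log 2 (real x) + 1"
proof (cases "clog x")
  case 0
  then show ?thesis using assms by simp
next
  case (Suc q)
  have "real (2 ^ q) < real x" using clog_least[of q x] Suc by (simp only: of_nat_less_iff)
  then have "real q < log 2 (real x)" using assms by (simp add: less_log_iff powr_realpow)
  then show ?thesis using Suc by simp
qed

locale parameters =
  fixes n w s e dlt :: nat and \<epsilon> \<delta> :: real
  assumes n: "0 < n" and w: "0 < w" and s: "0 < s" and eps: "0 < \<epsilon>" "\<epsilon> \<le> 1 / 2" and delta: "0 < \<delta>"
    and e: "e = nat \<lceil>log 2 (1 / \<epsilon>)\<rceil>" and dlt: "dlt = nat \<lceil>log 2 (1 / \<delta>)\<rceil>"
begin

abbreviation "J \<equiv> stages w s dlt"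
abbreviation "\<beta> \<equiv> clog w + clog e"
abbreviation "b \<equiv> 48 * clog w + 48 * clog e"
abbreviation "a \<equiv> sta b dlt"
abbreviation "N \<equiv> stN b (clog n) s dlt"
abbreviation "pos \<equiv> stpos b (clog n) s dlt"
abbreviation "asum \<equiv> (\<Sum>j<J. a j)"
abbreviation "le \<equiv> log 2 (1 / \<epsilon>)"
abbreviation "ld \<equiv> log 2 (1 / \<delta>)"

lemma le_ge: "1 \<le> le"
proof -
  have "2 \<le> 1 / \<epsilon>" using eps by (simp add: field_simps)
  then show ?thesis using eps by (subst le_log_iff) auto
qed

lemma e_ge: "1 \<le> e" "le \<le> real e" "real e \<le> 2 * le"
proof -
  have c: "1 \<le> \<lceil>le\<rceil>" using le_ge by (simp add: one_le_ceiling)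
  then have re: "real e = real_of_int \<lceil>le\<rceil>" unfolding e by simp
  show "1 \<le> e" using c unfolding e by linarith
  show "le \<le> real e" unfolding re by simp
  have "real_of_int \<lceil>le\<rceil> \<le> le + 1" by linarith
  then show "real e \<le> 2 * le" unfolding re using le_ge by linarith
qed

lemma eps_ge: "1 / 2 ^ e \<le> \<epsilon>"
proof -
  have "1 / \<epsilon> = 2 powr le" using eps by simp
  also have "\<dots> \<le> 2 powr real e" using e_ge(2) by simp
  also have "\<dots> = 2 ^ e" by (simp add: powr_realpow)
  finally show ?thesis using eps by (simp add: field_simps)
qed

lemma delta_ge: "1 / 2 ^ dlt \<le> \<delta>"
proof -
  have "ld \<le> real dlt" unfolding dlt using real_nat_ceiling_ge by blast
  have "1 / \<delta> = 2 powr ld" using delta by simp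
  also have "\<dots> \<le> 2 powr real dlt" using \<open>ld \<le> real dlt\<close> by simp
  also have "\<dots> = 2 ^ dlt" by (simp add: powr_realpow)
  finally show ?thesis using delta by (simp add: field_simps)
qed

lemma dlt_pos:
  assumes "0 < J"
  shows "0 < dlt" "0 < ld" "real dlt \<le> ld + 1" "\<delta> < 1"
proof -
  show d: "0 < dlt" using assms unfolding stages_def by (auto split: if_splits)
  then show l: "0 < ld" unfolding dlt by simp
  show "real dlt \<le> ld + 1" unfolding dlt using l by linarith
  show "\<delta> < 1" using l delta by (simp add: log_divide zero_less_log_cancel_iff)
qed

lemma dlt_zero: "dlt = 0 \<Longrightarrow> 1 \<le> \<delta>"
  using delta_ge by simp

lemma stage_bounds:
  assumes "j < J"
  shows "s * 2 ^ j < w" "2 \<le> w" "1 \<le> \<beta>" "w * e \<le> 2 ^ \<beta>" "48 \<le> a j"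
proof -
  show t: "s * 2 ^ j < w" using assms by (rule stages_least)
  have "1 \<le> s * 2 ^ j" using s by simp
  then show w: "2 \<le> w" using t by linarith
  show "1 \<le> \<beta>" using clog_pos[OF w] by simp
  then show "48 \<le> a j" unfolding sta_def by simp
  have "w * e \<le> 2 ^ clog w * 2 ^ clog e" by (intro mult_mono le_power_clog) auto
  then show "w * e \<le> 2 ^ \<beta>" by (simp add: power_add)
qed

lemma two_power_J: "0 < J \<Longrightarrow> s * 2 ^ J < 2 * w"
  using stages_least[of "J - 1" w s dlt] by (cases J) auto

section \<open>The constants of the stages\<close>

text \<open>At least the 16th power of \<open>w * e\<close>, which leaves room for the cubic bound
  in \<open>Bp_\<kappa>\<close>; a power of two reduces the later estimates to exponents.\<close>

definition \<kappa> :: nat where "\<kappa> = 2 ^ (16 * \<beta>)"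
text \<open>Chosen for the Markov parameter \<open>\<mu> = \<epsilon> / (4 * real w)\<close>: a
  stage then adds \<open>2 * \<epsilon>\<^sub>1 / \<mu> = \<epsilon> / w\<close> to the error, and
  there are at most w stages.\<close>

definition \<epsilon>\<^sub>1 :: real where "\<epsilon>\<^sub>1 = \<epsilon>\<^sup>2 / (8 * (real w)\<^sup>2)"
text \<open>The exponent of \<open>2 * (2 * \<kappa>) ^ (2 * w)\<close> plus that of a power of two
  which is at least \<open>1 / \<epsilon>\<^sub>1\<close>.\<close>

definition Bp :: nat where "Bp = 4 + 2 * w * (16 * \<beta> + 1) + 2 * e + 2 * clog w"

lemma Bp_\<kappa>:
  assumes "0 < J"
  shows "16 * Bp * w \<le> \<kappa>"
proof -
  \<comment> \<open>Everything is compared with \<open>?v\<close>, which is at least w, e and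
    \<beta>. Then Bp is at most quadratic in it, and the claim becomes
    \<open>640 * ?v ^ 3 \<le> ?v ^ 16\<close>.\<close>
  let ?v = "(2::nat) ^ \<beta>"
  note sb = stage_bounds[OF assms]
  have v2: "2 \<le> ?v" using sb(3) by (cases \<beta>) auto
  have "w * 1 \<le> w * e" using e_ge(1) by (rule mult_le_mono2)
  moreover have "1 * e \<le> w * e" using sb(2) by (intro mult_le_mono1) linarith
  ultimately have wv: "w \<le> ?v" "e \<le> ?v" using sb(4) by linarith+
  have bv: "\<beta> \<le> ?v" by (simp add: less_imp_le)
  have cv: "clog w \<le> ?v" using bv by linarith
  have v1: "1 \<le> ?v * ?v" "?v \<le> ?v * ?v" using v2 by simp_all
  have "w * \<beta> \<le> ?v * ?v" using wv(1) bv by (rule mult_le_mono)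
  moreover have "Bp = 4 + 32 * (w * \<beta>) + 2 * w + 2 * e + 2 * clog w" unfolding Bp_def by (simp add: algebra_simps)
  ultimately have "Bp \<le> 42 * (?v * ?v)" using wv cv v1 by linarith
  moreover have "4 \<le> ?v * ?v" using mult_le_mono[OF v2 v2] by simp
  ultimately have "Bp \<le> 4 + 32 * (?v * ?v) + 6 * ?v"
    using \<open>w * \<beta> \<le> ?v * ?v\<close> \<open>Bp = _\<close> wv cv by linarith
  also have "\<dots> \<le> 40 * (?v * ?v)"
  proof -
    have "2 * ?v \<le> ?v * ?v" using v2 by (intro mult_right_mono) auto
    then show ?thesis using \<open>4 \<le> ?v * ?v\<close> by linarith
  qed
  finally have "Bp * w \<le> (40 * (?v * ?v)) * ?v" using wv(1) by (rule mult_le_mono)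
  then have "16 * Bp * w \<le> 640 * ?v ^ 3" by (simp add: power3_eq_cube ac_simps)
  also have "\<dots> \<le> ?v ^ 16" using v2 by (rule scaled_cube_le_power)
  also have "\<dots> = \<kappa>" unfolding \<kappa>_def by (simp only: power_mult mult.commute[of 16])
  finally show ?thesis .
qed

lemma eps1_bound:
  assumes "j < J"
  shows "2 * (2 * real \<kappa>) ^ (2 * (s * 2 ^ j)) \<le> \<epsilon>\<^sub>1 * 2 ^ Bp" "0 < \<epsilon>\<^sub>1"
proof -
  note sb = stage_bounds[OF assms]
  let ?t = "s * 2 ^ j"
  have w0: "0 < real w" using sb by simp
  show e10: "0 < \<epsilon>\<^sub>1" unfolding \<epsilon>\<^sub>1_def using eps w0 by simp
  have "(1 / 2 ^ e)\<^sup>2 / (8 * (2 ^ clog w)\<^sup>2) \<le> \<epsilon>\<^sub>1"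
  proof -
    have "real w \<le> real (2 ^ clog w)" by (simp only: of_nat_le_iff le_power_clog)
    then have "real w \<le> 2 ^ clog w" by simp
    then show ?thesis unfolding \<epsilon>\<^sub>1_def using eps_ge w0 eps by (intro frac_le mult_left_mono power_mono) auto
  qed
  moreover have "(1 / 2 ^ e)\<^sup>2 / (8 * (2 ^ clog w)\<^sup>2) = (1 / 2 ^ (2 * e + 3 + 2 * clog w) :: real)"
    by (simp add: power_add power_mult power_one_over field_simps power2_eq_square flip: power_mult_distrib)
  ultimately have e1: "1 / 2 ^ (2 * e + 3 + 2 * clog w) \<le> \<epsilon>\<^sub>1" by simp
  have k: "2 * real \<kappa> = 2 ^ (16 * \<beta> + 1)" unfolding \<kappa>_def by simp
  have "2 * (2 * real \<kappa>) ^ (2 * ?t) = 2 ^ (1 + (16 * \<beta> + 1) * (2 * ?t))"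
    unfolding k power_mult[symmetric] by (simp only: power_add power_one_right)
  also have "\<dots> \<le> 2 ^ (1 + (16 * \<beta> + 1) * (2 * w))" using sb(1) by (intro power_increasing add_mono mult_le_mono) auto
  also have "\<dots> = 1 / 2 ^ (2 * e + 3 + 2 * clog w) * 2 ^ Bp"
  proof -
    have "Bp = (1 + (16 * \<beta> + 1) * (2 * w)) + (2 * e + 3 + 2 * clog w)" unfolding Bp_def by simp
    then show ?thesis by (simp only: power_add) simp
  qed
  also have "\<dots> \<le> \<epsilon>\<^sub>1 * 2 ^ Bp" using e1 by (rule mult_right_mono) simp
  finally show "2 * (2 * real \<kappa>) ^ (2 * ?t) \<le> \<epsilon>\<^sub>1 * 2 ^ Bp" .
qed

lemma sparsification_params:
  assumes j: "j < J" and I: "I \<subseteq> {..<n}" and F: "F \<subseteq> terms_on I (2 * (s * 2 ^ j))"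
  shows "sparsification {..<n} I F (2 * (s * 2 ^ j)) Bp \<kappa> \<epsilon>\<^sub>1"
proof
  show "finite {..<n}" "I \<subseteq> {..<n}" "F \<subseteq> terms_on I (2 * (s * 2 ^ j))" "0 < \<kappa>"
    using I F by (simp_all add: \<kappa>_def)
  have "8 * Bp * (2 * (s * 2 ^ j)) = 16 * Bp * (s * 2 ^ j)" by simp
  also have "\<dots> \<le> 16 * Bp * w" using stage_bounds(1)[OF j] by (intro mult_le_mono) auto
  also have "\<dots> \<le> \<kappa>" using Bp_\<kappa> j by simp
  finally show "8 * Bp * (2 * (s * 2 ^ j)) \<le> \<kappa>" .
qed (use eps1_bound[OF j] in auto)

text \<open>The choice of N gives \<open>2 * clog n + 6 * (a j * t) \<le> 3 * 3 ^ q\<close> with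
  \<open>t = s * 2 ^ j\<close>, which makes the additive error of the generator no larger than its
  main term; hence the numerator 2.\<close>

lemma live_bound:
  assumes j: "j < J" and W: "W \<subseteq> {..<n}" "card W = s * 2 ^ j"
  shows "measure_pmf.prob (stage_pmf n (N j) (a j)) {L. W \<subseteq> L} \<le> 2 / 2 ^ (a j * (s * 2 ^ j))"
proof -
  let ?t = "s * 2 ^ j" and ?X = "2 * clog n + (s * 2 ^ j) * (6 * a j)"
  let ?q = "tlog ?X"
  have a0: "0 < a j" using stage_bounds(5)[OF j] by simp
  have N: "N j = 3 ^ Suc ?q" unfolding stN_def ..
  have t1: "1 \<le> ?t" using s by simp
  have "?X \<le> 3 * 3 ^ ?q" using le_power_tlog[of ?X] by simp
  then have "2 * clog n + 6 * (a j * ?t) \<le> 3 * 3 ^ ?q" by (simp add: mult.commute mult.left_commute)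
  moreover have "a j \<le> a j * ?t" using t1 by simp
  ultimately have exp: "clog n + a j + a j * ?t \<le> 2 * 3 ^ ?q" by linarith
  have "n * a j \<le> 2 ^ clog n * 2 ^ a j" by (intro mult_le_mono le_power_clog) (simp add: less_imp_le)
  then have "real (n * a j) \<le> real (2 ^ clog n * 2 ^ a j)" by (simp only: of_nat_le_iff)
  then have "real (n * a j) / 2 ^ (2 * 3 ^ ?q) \<le> 2 ^ (clog n + a j) / 2 ^ (2 * 3 ^ ?q)"
    by (intro divide_right_mono) (simp_all add: power_add)
  also have "\<dots> \<le> 2 ^ (clog n + a j) / 2 ^ (clog n + a j + a j * ?t)"
    using exp by (intro divide_left_mono power_increasing) auto
  also have "\<dots> = 1 / 2 ^ (a j * ?t)" by (simp add: power_add)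
  finally have "real (n * a j) / 2 ^ (2 * 3 ^ ?q) \<le> 1 / 2 ^ (a j * ?t)" .
  then show ?thesis using prob_stage_subset[OF N a0 W] by simp
qed

text \<open>Compare exponents of 2. The number of terms and of t-subsets costs
  \<open>32 * \<beta> * t\<close> and a multiple of t; the \<open>48 * \<beta>\<close> in
  \<open>a j\<close> leave \<open>16 * \<beta> * t\<close>, enough for this multiple and for the
  factor \<open>8 * w\<close>. The bits of \<open>dpart\<close> satisfy
  \<open>s * dlt \<le> 4 * (dpart dlt (4 * 2 ^ j) * t)\<close>, whence
  \<open>\<delta> powr (s / 4)\<close>.\<close>

lemma union_bound:
  assumes j: "j < J"
  defines "t \<equiv> s * 2 ^ j"
  shows "2 * (real ((2 * t + 1) * (2 * \<kappa>) ^ (2 * t)) * (4 ^ t * (2 / 2 ^ (a j * t)))) \<le> \<delta> powr (real s / 4) / (8 * real w)"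
proof -
  note sb = stage_bounds[OF j]
  let ?d = "dpart dlt (4 * 2 ^ j)"
  have t1: "1 \<le> t" unfolding t_def using s by simp
  have tt: "2 * t + 1 \<le> 4 ^ t" using t1
  proof (induction t rule: dec_induct)
    case (step m)
    then show ?case by simp
  qed simp
  have aj: "a j = 48 * \<beta> + ?d" unfolding sta_def by simp
  have k: "2 * real \<kappa> = 2 ^ (1 + 16 * \<beta>)" unfolding \<kappa>_def by simp
  have "2 * (real ((2 * t + 1) * (2 * \<kappa>) ^ (2 * t)) * (4 ^ t * (2 / 2 ^ (a j * t))))
    \<le> 2 * ((4 ^ t * (2 * real \<kappa>) ^ (2 * t)) * (4 ^ t * (2 / 2 ^ (a j * t))))"
  proof (intro mult_left_mono mult_right_mono)
    have "(2 * t + 1) * (2 * \<kappa>) ^ (2 * t) \<le> 4 ^ t * (2 * \<kappa>) ^ (2 * t)" using tt by (rule mult_le_mono1)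
    then have "real ((2 * t + 1) * (2 * \<kappa>) ^ (2 * t)) \<le> real (4 ^ t * (2 * \<kappa>) ^ (2 * t))" by (simp only: of_nat_le_iff)
    then show "real ((2 * t + 1) * (2 * \<kappa>) ^ (2 * t)) \<le> 4 ^ t * (2 * real \<kappa>) ^ (2 * t)" by simp
  qed auto
  also have "\<dots> = 2 ^ (2 + 6 * t + 32 * \<beta> * t) / 2 ^ (a j * t)"
  proof -
    have 4: "(4::real) ^ t = 2 ^ (2 * t)" by (simp add: power_mult)
    have "(2 * real \<kappa>) ^ (2 * t) = 2 ^ ((1 + 16 * \<beta>) * (2 * t))" unfolding k power_mult[symmetric] ..
    also have "(1 + 16 * \<beta>) * (2 * t) = 2 * t + 32 * \<beta> * t" by (simp add: algebra_simps)
    finally have 5: "(2 * real \<kappa>) ^ (2 * t) = 2 ^ (2 * t + 32 * \<beta> * t)" .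
    have "2 + 6 * t + 32 * \<beta> * t = 1 + (2 * t + (2 * t + 32 * \<beta> * t)) + 2 * t + 1" by simp
    then have "(2::real) ^ (2 + 6 * t + 32 * \<beta> * t) = 2 * (2 ^ (2 * t) * 2 ^ (2 * t + 32 * \<beta> * t)) * 2 ^ (2 * t) * 2"
      by (simp only: power_add power_one_right)
    then show ?thesis unfolding 4 5 by simp
  qed
  also have "\<dots> \<le> 1 / 2 ^ (?d * t + \<beta> + 3)"
  proof -
    have "t * 1 \<le> t * \<beta>" "1 * \<beta> \<le> t * \<beta>" using sb(3) t1 by simp_all
    moreover have "x \<le> p \<Longrightarrow> y \<le> p \<Longrightarrow> 1 \<le> x \<Longrightarrow> 2 + 6 * x + y + 3 \<le> 16 * p" for x y p :: nat by linarith
    ultimately have "2 + 6 * t + \<beta> + 3 \<le> 16 * (t * \<beta>)" using t1 by (simp only: mult_1 mult_1_right)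
    then have "2 + 6 * t + 32 * \<beta> * t + (?d * t + \<beta> + 3) \<le> a j * t"
      unfolding aj by (simp add: algebra_simps)
    then have "(2::real) ^ (2 + 6 * t + 32 * \<beta> * t + (?d * t + \<beta> + 3)) \<le> 2 ^ (a j * t)"
      by (intro power_increasing) auto
    then show ?thesis by (simp add: power_add field_simps)
  qed
  also have "\<dots> = 1 / 2 ^ (?d * t) * (1 / (8 * 2 ^ \<beta>))" by (simp add: power_add)
  also have "\<dots> \<le> \<delta> powr (real s / 4) * (1 / (8 * real w))"
  proof (intro mult_mono)
    have "dlt \<le> ?d * (4 * 2 ^ j)" by (rule le_dpart) simp
    then have "s * dlt \<le> s * (?d * (4 * 2 ^ j))" by (rule mult_le_mono2)
    then have "s * dlt \<le> 4 * (?d * t)" unfolding t_def by (simp add: algebra_simps)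
    then have "real (s * dlt) \<le> real (4 * (?d * t))" by (simp only: of_nat_le_iff)
    then have dt: "real dlt * (real s / 4) \<le> real (?d * t)" by (simp add: mult.commute)
    have "1 / 2 ^ (?d * t) = 2 powr (- real (?d * t))" by (simp add: powr_minus powr_realpow[symmetric] divide_inverse)
    also have "\<dots> \<le> 2 powr (- (real dlt * (real s / 4)))" using dt by simp
    also have "\<dots> = (1 / 2 ^ dlt) powr (real s / 4)"
    proof -
      have "1 / 2 ^ dlt = (2::real) powr (- real dlt)" by (simp add: powr_minus powr_realpow divide_inverse)
      then show ?thesis by (simp only: powr_powr mult_minus_left)
    qed
    also have "\<dots> \<le> \<delta> powr (real s / 4)" using delta_ge by (intro powr_mono2) auto
    finally show "1 / 2 ^ (?d * t) \<le> \<delta> powr (real s / 4)" .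
    have "w * 1 \<le> w * e" using e_ge(1) by (rule mult_le_mono2)
    then have "real w \<le> real (2 ^ \<beta>)" using sb(4) by (simp only: of_nat_le_iff)
    then show "1 / (8 * 2 ^ \<beta>) \<le> 1 / (8 * real w)" using sb(2) by (intro divide_left_mono) auto
  qed auto
  finally show ?thesis by simp
qed

text \<open>The recursion \<open>x (Suc j) = 2 * x j + c\<close> from \<open>fails_step\<close> is
  solved by \<open>(2 ^ j - 1) * c\<close>, while the approximation errors only add up.\<close>

lemma fails_prefix:
  assumes "j \<le> J" "I \<subseteq> {..<n}" "G \<subseteq> terms_on I (s * 2 ^ j)"
  defines "\<mu> \<equiv> \<epsilon> / (4 * real w)"
  shows "fails {..<n} (prefix_pmf n b s dlt j) I G s (real j * (2 * \<epsilon>\<^sub>1 / \<mu>))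
    \<le> (2 ^ j - 1) * (\<mu> + \<delta> powr (real s / 4) / (8 * real w))"
  using assms(1-3)
proof (induction j arbitrary: I G)
  case 0
  have "finite I" using 0 finite_subset by blast
  then show ?case using fails_narrow[of I G s 0] 0 by simp
next
  case (Suc j)
  then have j: "j < J" by simp
  let ?t = "s * 2 ^ j" and ?c = "\<mu> + \<delta> powr (real s / 4) / (8 * real w)" and ?e = "real j * (2 * \<epsilon>\<^sub>1 / \<mu>)"
  have t2: "s * 2 ^ Suc j = 2 * ?t" by simp
  have G: "G \<subseteq> terms_on I (2 * ?t)" using Suc.prems(3) unfolding t2 .
  have mu: "0 < \<mu>" unfolding \<mu>_def using eps stage_bounds(2)[OF j] by simp
  have "fails {..<n} (prefix_pmf n b s dlt (Suc j)) I G s (?e + 2 * \<epsilon>\<^sub>1 / \<mu>)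
    \<le> 2 * ((2 ^ j - 1) * ?c) + \<mu> + 2 * (real ((2 * ?t + 1) * (2 * \<kappa>) ^ (2 * ?t)) * (4 ^ ?t * (2 / 2 ^ (a j * ?t))))"
    unfolding prefix_pmf_Suc
  proof (rule fails_step[OF _ Suc.prems(2) G sparsification_params[OF j Suc.prems(2) G]])
    show "fails {..<n} (prefix_pmf n b s dlt j) I' G s ?e \<le> (2 ^ j - 1) * ?c"
      if "I' \<subseteq> {..<n}" "G \<subseteq> terms_on I' ?t" for I' G
      using Suc.IH[OF _ that] j by simp
  qed (use live_bound[OF j] mu in auto)
  also have "\<dots> \<le> 2 * ((2 ^ j - 1) * ?c) + ?c" using union_bound[OF j] by simp
  also have "\<dots> = (2 ^ Suc j - 1) * ?c"
  proof -
    have "2 * ((2 ^ j - 1) * c) + c = (2 ^ Suc j - 1) * c" for c :: real by (simp add: algebra_simps)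
    then show ?thesis .
  qed
  finally have *: "fails {..<n} (prefix_pmf n b s dlt (Suc j)) I G s (?e + 2 * \<epsilon>\<^sub>1 / \<mu>) \<le> (2 ^ Suc j - 1) * ?c" .
  have "real (Suc j) * (2 * \<epsilon>\<^sub>1 / \<mu>) = ?e + 2 * \<epsilon>\<^sub>1 / \<mu>" by (simp only: of_nat_Suc distrib_right)
  then show ?case using * by (simp only:)
qed

end

lemma sandw_mono: "sandw V I s e g \<Longrightarrow> e \<le> e' \<Longrightarrow> sandw V I s e' g"
  unfolding sandw_def by (meson order_trans)

lemma fails_mono: "e \<le> e' \<Longrightarrow> fails V Q I F s e' \<le> fails V Q I F s e"
  unfolding fails_def by (intro measure_pmf.finite_measure_mono) (auto intro: sandw_mono)

text \<open>If the coin fails, no variable is live and the restricted formula is constant, hence its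
  own approximator.\<close>

lemma fails_flag:
  "fails V (map_pmf (\<lambda>(v, L). if P v then L else {}) (pair_pmf M Q)) I F s e \<le> fails V Q I F s e"
  if e: "0 \<le> e"
proof -
  let ?bad = "\<lambda>L z. \<not> sandw V (I \<inter> L) s e (\<lambda>y. eval_dnf F (merge L y z))"
  have nb: "\<not> ?bad {} z" for z
  proof -
    have "width_dnf {} s (if eval_dnf F z then {{}} else {})" by (simp add: width_dnf_def)
    moreover have "eval_dnf (if eval_dnf F z then {{}} else {}) = (\<lambda>y. eval_dnf F (merge {} y z))"
      by (auto simp: eval_dnf_def merge_def fun_eq_iff)
    ultimately show ?thesis using sandw_exact[of "{}" s _ e V] e by fastforce
  qed
  have "pair_pmf (map_pmf (\<lambda>(v, L). if P v then L else {}) (pair_pmf M Q)) (unif V)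
    = map_pmf (\<lambda>(v, (L, z)). (if P v then L else {}, z)) (pair_pmf M (pair_pmf Q (unif V)))"
    by (simp add: pair_pmf_def map_pmf_def bind_assoc_pmf bind_return_pmf)
  then have "fails V (map_pmf (\<lambda>(v, L). if P v then L else {}) (pair_pmf M Q)) I F s e
    = measure_pmf.prob (pair_pmf M (pair_pmf Q (unif V))) {(v, (L, z)). ?bad (if P v then L else {}) z}"
    unfolding fails_def by (simp add: vimage_def case_prod_unfold)
  also have "\<dots> \<le> fails V Q I F s e"
  proof (rule prob_pair_le)
    fix v
    show "measure_pmf.prob (pair_pmf Q (unif V)) {y. (v, y) \<in> {(v, (L, z)). ?bad (if P v then L else {}) z}} \<le> fails V Q I F s e"
      unfolding fails_def using nb by (intro measure_pmf.finite_measure_mono) (auto split: if_splits)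
  qed
  finally show ?thesis .
qed

lemma dpart_le: "0 < pw \<Longrightarrow> real (dpart d pw) \<le> real d / real pw + 1"
proof (cases "dpart d pw")
  case (Suc q)
  assume pw: "0 < pw"
  have "real (q * pw) < real d" using dpart_least[of q d pw] Suc by (simp only: of_nat_less_iff)
  then show ?thesis using pw Suc by (simp add: field_simps)
qed simp

lemma power_tlog_le:
  assumes "1 \<le> x"
  shows "3 ^ Suc (tlog x) \<le> 3 * x"
proof (cases "tlog x")
  case (Suc q)
  then show ?thesis using tlog_least[of q x] by simp
qed (use assms in simp)

section \<open>Error, selection probability and seed length\<close>

context parameters
begin

abbreviation "lw \<equiv> log 2 (real w)"
abbreviation "lB \<equiv> log 2 (real w * log 2 (1 / \<epsilon>))"

lemma fails_main:
  assumes F: "width_dnf {..<n} w F"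
  shows "fails {..<n} (prefix_pmf n b s dlt J) {..<n} F s \<epsilon> < \<epsilon> + \<delta> powr (real s / 4)"
proof (cases "dlt = 0")
  case True
  have "fails {..<n} (prefix_pmf n b s dlt J) {..<n} F s \<epsilon> \<le> 1" unfolding fails_def by simp
  moreover have "1 \<le> \<delta> powr (real s / 4)" using dlt_zero[OF True] by (intro ge_one_powr_ge_zero) auto
  ultimately show ?thesis using eps by linarith
next
  case False
  \<comment> \<open>Contradictory terms are dropped, since \<open>terms_on\<close> admits only
    consistent ones.\<close>
  define F' where "F' = {T\<in>F. consistent T}"
  have "eval_dnf F' x = eval_dnf F x" for x
    unfolding eval_dnf_satT F'_def using satT_consistent by blast
  then have same: "fails {..<n} Q {..<n} F s \<epsilon> = fails {..<n} Q {..<n} F' s \<epsilon>" for Q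
    unfolding fails_def by simp
  have "w \<le> s * 2 ^ J" using le_stages s False by simp
  then have F': "F' \<subseteq> terms_on {..<n} (s * 2 ^ J)"
    using F unfolding F'_def width_dnf_def terms_on_def by fastforce
  have d0: "0 < \<delta> powr (real s / 4)" using delta by simp
  show ?thesis
  proof (cases "J = 0")
    case True
    have "fails {..<n} (prefix_pmf n b s dlt J) {..<n} F' s \<epsilon> = 0"
      by (rule fails_narrow) (use F' eps True in simp_all)
    then show ?thesis unfolding same using eps d0 by linarith
  next
    case J: False
    let ?\<mu> = "\<epsilon> / (4 * real w)" and ?d = "\<delta> powr (real s / 4)"
    have w0: "0 < real w" using w by simp
    have "2 ^ J \<le> s * 2 ^ J" using s by simp
    also have "\<dots> < 2 * w" using two_power_J J by simp
    finally have "real (2 ^ J) < real (2 * w)" by (simp only: of_nat_less_iff)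
    then have J2: "2 ^ J - 1 \<le> 2 * real w" by simp
    have "real J * (2 * \<epsilon>\<^sub>1 / ?\<mu>) = real J * (\<epsilon> / real w)"
      unfolding \<epsilon>\<^sub>1_def using w0 eps by (simp add: field_simps power2_eq_square)
    also have "\<dots> \<le> real w * (\<epsilon> / real w)"
      using stages_le[OF s, of w dlt] eps w0 by (intro mult_right_mono) auto
    also have "\<dots> = \<epsilon>" using w0 by simp
    finally have "fails {..<n} (prefix_pmf n b s dlt J) {..<n} F' s \<epsilon>
      \<le> fails {..<n} (prefix_pmf n b s dlt J) {..<n} F' s (real J * (2 * \<epsilon>\<^sub>1 / ?\<mu>))" by (rule fails_mono)
    also have "\<dots> \<le> (2 ^ J - 1) * (?\<mu> + ?d / (8 * real w))" by (rule fails_prefix) (use F' in auto)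
    also have "\<dots> \<le> (2 * real w) * (?\<mu> + ?d / (8 * real w))"
      using J2 eps w0 by (intro mult_right_mono) auto
    \<comment> \<open>The factor \<open>2 * w\<close> from the doubling cancels the w in \<mu> and
      in the union bound; what is left over makes the final inequality strict.\<close>
    also have "\<dots> = \<epsilon> / 2 + ?d / 4" using w0 by (simp add: field_simps)
    also have "\<dots> < \<epsilon> + ?d" using eps d0 by linarith
    finally show ?thesis unfolding same .
  qed
qed

lemma log_bounds:
  assumes "0 < J"
  shows "1 \<le> lw" "lw \<le> lB" "real J \<le> 2 * lw" "real \<beta> \<le> 4 * lB"
proof -
  have w2: "2 \<le> w" using stage_bounds(2)[OF assms] .
  then show lw: "1 \<le> lw" by (simp add: le_log_iff)
  have lB: "lB = lw + log 2 le" using w le_ge by (simp add: log_mult)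
  have l0: "0 \<le> log 2 le" using le_ge by simp
  show "lw \<le> lB" unfolding lB using l0 by simp
  have "2 ^ J \<le> s * 2 ^ J" using s by simp
  also have "\<dots> < 2 * w" using two_power_J assms by simp
  finally have "real (2 ^ J) < real (2 * w)" by (simp only: of_nat_less_iff)
  then have "2 powr real J < 2 * real w" by (simp add: powr_realpow)
  then have "real J < log 2 (2 * real w)" using w by (simp add: less_log_iff)
  also have "\<dots> = 1 + lw" using w by (simp add: log_mult)
  finally show "real J \<le> 2 * lw" using lw by linarith
  have "real (clog e) \<le> log 2 (real e) + 1" by (rule clog_le_log) (rule e_ge)
  also have "log 2 (real e) \<le> log 2 (2 * le)" using e_ge by (intro log_mono) auto
  also have "log 2 (2 * le) = 1 + log 2 le" using le_ge by (simp add: log_mult)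
  finally have "real (clog e) \<le> log 2 le + 2" by simp
  moreover have "real (clog w) \<le> lw + 1" using w by (intro clog_le_log) simp
  ultimately have b: "real \<beta> \<le> lw + log 2 le + 3" by simp
  have "x \<le> y + z + 3 \<Longrightarrow> 1 \<le> y \<Longrightarrow> 0 \<le> z \<Longrightarrow> x \<le> 4 * (y + z)" for x y z :: real unfolding distrib_left by linarith
  from this[OF b lw l0] show "real \<beta> \<le> 4 * lB" unfolding lB .
qed

text \<open>193 = 48 * 4 + 1: \<beta> is at most \<open>4 * lB\<close>, and the 1 comes from
  rounding up in \<open>dpart\<close>.\<close>

lemma stage_bits_le:
  assumes "0 < J"
  shows "real (a j) \<le> 193 * lB + real dlt / 4 * (1 / 2 ^ j)"
proof -
  note lb = log_bounds[OF assms]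
  have "real (dpart dlt (4 * 2 ^ j)) \<le> real dlt / real (4 * 2 ^ j) + 1" by (rule dpart_le) simp
  then have d: "real (dpart dlt (4 * 2 ^ j)) \<le> real dlt / 4 * (1 / 2 ^ j) + 1" by simp
  have aj: "real (a j) = 48 * real \<beta> + real (dpart dlt (4 * 2 ^ j))" unfolding sta_def by simp
  have "d \<le> u + 1 \<Longrightarrow> x = 48 * y + d \<Longrightarrow> 1 \<le> l \<Longrightarrow> l \<le> l' \<Longrightarrow> y \<le> 4 * l' \<Longrightarrow> x \<le> 193 * l' + u"
    for d u x y l l' :: real by linarith
  from this[OF d aj lb(1,2,4)] show ?thesis .
qed

text \<open>The parts with \<open>dlt\<close> form a geometric series of at most
  \<open>dlt / 2\<close>. The others are \<open>193 * lB\<close> in each of at most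
  \<open>2 * lw\<close> stages, that is \<open>386 * lw * lB\<close>; the rest of 400 absorbs the
  rounding of \<open>dlt\<close>.\<close>

lemma asum_le: "0 < J \<Longrightarrow> real asum \<le> ld + 400 * lw * lB"
proof -
  assume J: "0 < J"
  note lb = log_bounds[OF J]
  have geo: "(\<Sum>j<i. 1 / 2 ^ j) \<le> (2::real)" for i :: nat
  proof -
    have "(\<Sum>j<i. 1 / 2 ^ j) = 2 - 2 / (2::real) ^ i" by (induction i) (auto simp: field_simps)
    then show ?thesis by simp
  qed
  have p: "1 * 1 \<le> lw * lB" using lb by (intro mult_mono) auto
  have "real asum \<le> (\<Sum>j<J. 193 * lB + real dlt / 4 * (1 / 2 ^ j))"
    unfolding of_nat_sum by (intro sum_mono stage_bits_le[OF J])
  also have "\<dots> = real J * (193 * lB) + real dlt / 4 * (\<Sum>j<J. 1 / 2 ^ j)"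
    by (simp only: sum.distrib sum_distrib_left sum_constant card_lessThan)
  also have "\<dots> \<le> (2 * lw) * (193 * lB) + real dlt / 4 * 2"
    using lb by (intro add_mono mult_mono geo sum_nonneg) auto
  also have "\<dots> \<le> ld + 400 * lw * lB"
  proof -
    have "(2 * lw) * (193 * lB) = 386 * (lw * lB)" "400 * lw * lB = 400 * (lw * lB)" by simp_all
    then show ?thesis using dlt_pos[OF J] p by linarith
  qed
  finally show ?thesis .
qed

text \<open>Written as a power of two, the bound on p has exponent
  \<open>- (ld + 400 * lw * lB)\<close>. So the stages never select with a probability below p, and
  a coin can correct them downwards.\<close>

lemma prob_le_stages:
  assumes "p \<le> 1" "p \<le> \<delta> / (real w * le) powr (400 * lw)"
  shows "p \<le> 1 / 2 ^ asum"
proof (cases "0 < J")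
  case True
  have x: "0 < real w * le" using w le_ge by simp
  have "\<delta> / (real w * le) powr (400 * lw) = 2 powr (- ld) / (2 powr lB) powr (400 * lw)"
    using x delta by (simp add: log_divide)
  also have "\<dots> = 2 powr (- (ld + 400 * lw * lB))"
    by (simp add: powr_powr powr_diff mult.commute)
  also have "\<dots> \<le> 2 powr (- real asum)" using asum_le[OF True] by simp
  also have "\<dots> = 1 / 2 ^ asum" by (simp add: powr_minus powr_realpow divide_inverse del: of_nat_sum)
  finally show ?thesis using assms(2) by linarith
qed (use assms(1) in simp)

text \<open>N overshoots its lower bound by a factor of at most 3, so the coefficients are 2 * 3 * 2
  = 12 and 2 * 3 * 6 + 1 = 37. In \<open>t * a j\<close> the power \<open>2 ^ j\<close> cancels from
  the part with \<open>dlt\<close>, which is therefore the same in all stages.\<close>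

lemma stage_len_le:
  assumes j: "j < J"
  shows "real (2 * N j + a j) \<le> 12 * (log 2 (real n) + 1)
    + 37 * (193 * (real (s * 2 ^ j) * lB) + real s * real dlt / 4)"
proof -
  let ?t = "s * 2 ^ j" and ?X = "2 * clog n + (s * 2 ^ j) * (6 * a j)"
  have J: "0 < J" using j by simp
  have "1 * 48 \<le> ?t * a j" using s stage_bounds(5)[OF j] by (intro mult_le_mono) auto
  have "1 * a j \<le> ?t * a j" using s by (intro mult_le_mono) auto
  have "N j \<le> 3 * ?X" unfolding stN_def
    by (rule power_tlog_le) (use \<open>1 * 48 \<le> ?t * a j\<close> in simp)
  moreover have "?X = 2 * clog n + 6 * (?t * a j)" by simp
  moreover have "x \<le> 3 * z \<Longrightarrow> z = 2 * c + 6 * p \<Longrightarrow> 1 * y \<le> p \<Longrightarrow> 2 * x + y \<le> 12 * c + 37 * p"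
    for x y z c p :: nat by linarith
  ultimately have "2 * N j + a j \<le> 12 * clog n + 37 * (?t * a j)"
    using \<open>1 * a j \<le> ?t * a j\<close> by blast
  then have "real (2 * N j + a j) \<le> real (12 * clog n + 37 * (?t * a j))" by (simp only: of_nat_le_iff)
  also have "\<dots> = 12 * real (clog n) + 37 * (real ?t * real (a j))" by simp
  also have "\<dots> \<le> 12 * (log 2 (real n) + 1) + 37 * (real ?t * (193 * lB + real dlt / 4 * (1 / 2 ^ j)))"
    using n by (intro add_mono mult_left_mono clog_le_log stage_bits_le[OF J]) auto
  also have "real ?t * (193 * lB + real dlt / 4 * (1 / 2 ^ j)) = 193 * (real ?t * lB) + real s * real dlt / 4"
    by (simp add: field_simps)
  finally show ?thesis .
qed

text \<open>The terms \<open>s * 2 ^ j * lB\<close> form a geometric series of at most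
  \<open>2 * w * lB\<close>, whereas \<open>log n\<close> and \<open>s * dlt\<close> occur once in
  each of the at most \<open>2 * lw\<close> stages; these are the two parts of
  \<open>seed_bound\<close>. Rounding \<open>dlt\<close> adds \<open>J * s\<close>, which w absorbs.
  The largest coefficient is 37 * 193 * 2 = 14282.\<close>

lemma pos_le:
  assumes B: "0 \<le> seed_bound n w s \<epsilon> \<delta>"
  shows "real (pos J) \<le> 15000 * seed_bound n w s \<epsilon> \<delta>"
proof (cases "0 < J")
  case False
  then show ?thesis using B by (simp add: stpos_def)
next
  case J: True
  note lb = log_bounds[OF J] and dp = dlt_pos[OF J]
  let ?ln = "log 2 (real n)"
  have geo: "(\<Sum>j<i. s * 2 ^ j) \<le> s * 2 ^ i" for i :: nat by (induction i) auto
  have ln0: "0 \<le> ?ln" using n by simp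
  have lB0: "0 \<le> lB" using lb by linarith
  have t: "real (\<Sum>j<J. s * 2 ^ j) \<le> 2 * real w"
  proof -
    have "(\<Sum>j<J. s * 2 ^ j) \<le> 2 * w" using geo[of J] two_power_J[OF J] by linarith
    then have "real (\<Sum>j<J. s * 2 ^ j) \<le> real (2 * w)" by (simp only: of_nat_le_iff)
    then show ?thesis by simp
  qed
  have Js: "real J * real s \<le> 2 * real w"
  proof -
    have "J * s \<le> 2 ^ J * s" by (intro mult_le_mono1) (simp add: less_imp_le)
    also have "\<dots> \<le> 2 * w" using two_power_J[OF J] by (simp add: mult.commute)
    finally have "real (J * s) \<le> real (2 * w)" by (simp only: of_nat_le_iff)
    then show ?thesis by simp
  qed
  have "real (pos J) = (\<Sum>j<J. real (2 * N j + a j))" unfolding stpos_def by (simp only: of_nat_sum)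
  also have "\<dots> \<le> (\<Sum>j<J. 12 * (?ln + 1) + 37 * (193 * (real (s * 2 ^ j) * lB) + real s * real dlt / 4))"
    by (rule sum_mono, rule stage_len_le) simp
  also have "\<dots> = 12 * (real J * (?ln + 1)) + 37 * (193 * (real (\<Sum>j<J. s * 2 ^ j) * lB) + real J * real s * real dlt / 4)"
    unfolding sum.distrib sum_distrib_left[symmetric] sum_distrib_right[symmetric] of_nat_sum[symmetric]
    by (simp add: algebra_simps)
  also have "\<dots> \<le> 12 * (2 * lw * (?ln + 1)) + 37 * (193 * (2 * real w * lB) + (2 * lw * real s * ld + 2 * real w) / 4)"
  proof (intro add_mono mult_left_mono divide_right_mono)
    show "real J * (?ln + 1) \<le> 2 * lw * (?ln + 1)" using lb ln0 by (intro mult_right_mono) auto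
    show "real (\<Sum>j<J. s * 2 ^ j) * lB \<le> 2 * real w * lB" using t lB0 by (rule mult_right_mono)
    have "real J * real s * real dlt \<le> real J * real s * (ld + 1)"
      using dp by (intro mult_left_mono) auto
    also have "\<dots> = real J * (real s * ld) + real J * real s" by (simp add: algebra_simps)
    also have "\<dots> \<le> 2 * lw * (real s * ld) + 2 * real w"
      using lb dp Js by (intro add_mono mult_right_mono) auto
    finally show "real J * real s * real dlt \<le> 2 * lw * real s * ld + 2 * real w" by (simp add: mult.assoc)
  qed auto
  also have "\<dots> \<le> 15000 * seed_bound n w s \<epsilon> \<delta>"
  proof -
    have x: "0 \<le> lw * ?ln" "0 \<le> lw * (real s * ld)" using lb dp ln0 by simp_all
    have y: "real w * 1 \<le> real w * lB" using lb by (intro mult_left_mono) auto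
    have z: "1 * lB \<le> real w * lB" using w lB0 by (intro mult_right_mono) auto
    have "12 * (2 * lw * (?ln + 1)) + 37 * (193 * (2 * real w * lB) + (2 * lw * real s * ld + 2 * real w) / 4)
      = 24 * (lw * ?ln) + 24 * lw + 14282 * (real w * lB) + 37 / 2 * (lw * (real s * ld)) + 37 / 2 * real w"
      by (simp add: algebra_simps)
    moreover have "15000 * seed_bound n w s \<epsilon> \<delta>
      = 15000 * (lw * ?ln) + 15000 * (lw * (real s * ld)) + 15000 * (real w * lB)"
      unfolding seed_bound_def by (simp add: algebra_simps)
    ultimately show ?thesis using x y z lb by linarith
  qed
  finally show ?thesis .
qed

lemma sampler:
  assumes p: "p = real m / 2 ^ k" "p \<le> 1" "p \<le> \<delta> / (real w * le) powr (400 * lw)"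
    and r: "pos J + k \<le> r"
  defines "D \<equiv> map_pmf (\<lambda>\<sigma>. gen_out n b s dlt J m k ((!) \<sigma>)) (ulist r)"
  shows "set_pmf D \<subseteq> Pow {..<n}" "p_regular n p D"
    "samples main_prog 13 (sampler_params n w s \<epsilon> \<delta> m k r) n r D"
    "\<And>F. width_dnf {..<n} w F \<Longrightarrow> measure_pmf.prob (random_restriction n D)
       {\<rho>. \<not> has_dnf_sandwich (live n \<rho>) \<epsilon> s (restrict_fun n \<rho> (eval_dnf F))} < \<epsilon> + \<delta> powr (real s / 4)"
proof -
  let ?q = "k - asum"
  let ?P = "\<lambda>v. bval ((!) v) ?q < m"
  have r': "pos J + ?q \<le> r" using r by linarith
  have D: "D = map_pmf (\<lambda>(v, L). if ?P v then L else {}) (pair_pmf (ulist (r - pos J)) (prefix_pmf n b s dlt J))"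
    unfolding D_def using r' by (rule gen_out_pmf)
  show set: "set_pmf D \<subseteq> Pow {..<n}" unfolding D_def gen_out_def by auto
  have pa: "real m / 2 ^ k \<le> 1 / 2 ^ asum" using prob_le_stages p by simp
  \<comment> \<open>For positive m the bound on p forces k to be at least the number of bits spent
    in the stages, so the truncated subtraction is exact.\<close>
  have k: "k = ?q + asum" if "0 < m"
  proof -
    have "1 / 2 ^ k \<le> real m / 2 ^ k" using that by (intro divide_right_mono) auto
    then have "1 / 2 ^ k \<le> 1 / (2::real) ^ asum" using pa by linarith
    then have "(2::real) ^ asum \<le> 2 ^ k" by (simp add: field_simps)
    then show ?thesis by simp
  qed
  have m: "m \<le> 2 ^ ?q"
  proof (cases "m = 0")
    case False
    then have "real m / 2 ^ (?q + asum) \<le> 1 / 2 ^ asum" using pa k by simp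
    then have "real m \<le> 2 ^ ?q" by (simp add: power_add field_simps)
    then have "real m \<le> real (2 ^ ?q)" by simp
    then show ?thesis by (simp only: of_nat_le_iff)
  qed simp
  show "p_regular n p D" unfolding p_regular_def
  proof (intro allI impI)
    fix i assume i: "i < n"
    have "measure_pmf.prob D {L. i \<in> L} = measure_pmf.prob (pair_pmf (ulist (r - pos J)) (prefix_pmf n b s dlt J))
        {z. ?P (fst z) \<and> i \<in> snd z}"
      unfolding D by (simp add: vimage_def case_prod_unfold if_distrib[of "\<lambda>x. i \<in> x"] if_bool_eq_conj cong: if_cong)
        (intro arg_cong[where f = "measure_pmf.prob _"], auto)
    also have "\<dots> = measure_pmf.prob (ulist (?q + (r - pos J - ?q))) {v. ?P v} * (1 / 2 ^ asum)"
      using r' prob_pair_indep[of "ulist (r - pos J)" "prefix_pmf n b s dlt J" ?P "\<lambda>L. i \<in> L"]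
      unfolding prob_prefix_mem[OF i] by simp
    also have "\<dots> = real m / 2 ^ ?q * (1 / 2 ^ asum)" unfolding prob_bval_less[OF m] ..
    also have "\<dots> = p"
    proof (cases "m = 0")
      case False
      then have "(2::real) ^ k = 2 ^ ?q * 2 ^ asum" using k by (simp flip: power_add)
      then show ?thesis unfolding p(1) by simp
    qed (simp add: p(1))
    finally show "measure_pmf.prob D {L. i \<in> L} = p" .
  qed
  show "measure_pmf.prob (random_restriction n D)
       {\<rho>. \<not> has_dnf_sandwich (live n \<rho>) \<epsilon> s (restrict_fun n \<rho> (eval_dnf F))} < \<epsilon> + \<delta> powr (real s / 4)"
    if F: "width_dnf {..<n} w F" for F
  proof -
    have "measure_pmf.prob (random_restriction n D)
       {\<rho>. \<not> has_dnf_sandwich (live n \<rho>) \<epsilon> s (restrict_fun n \<rho> (eval_dnf F))}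
      \<le> fails {..<n} D {..<n} F s \<epsilon>" using F set by (rule prob_random_restriction_le)
    also have "\<dots> \<le> fails {..<n} (prefix_pmf n b s dlt J) {..<n} F s \<epsilon>"
      unfolding D by (rule fails_flag) (use eps in simp)
    also have "\<dots> < \<epsilon> + \<delta> powr (real s / 4)" using F by (rule fails_main)
    finally show ?thesis .
  qed
  \<comment> \<open>The last stage has t at least w / 2, and its N, which is at least t, occurs
    twice in the seed; so r bounds w, and through \<open>a j\<close> also
    \<open>clog e\<close>.\<close>
  have w_r: "w \<le> r \<and> clog e \<le> r" if J: "0 < J"
  proof -
    obtain j where j: "J = Suc j" using J by (cases J) auto
    have j': "j < J" using j by simp
    have lay: "2 * N j + a j \<le> r" using stpos_mono[OF j', of b "clog n" s dlt] r by linarith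
    have "w \<le> s * 2 ^ J" using le_stages s dlt_pos(1)[OF J] by simp
    then have "w \<le> 2 * (s * 2 ^ j)" unfolding j by simp
    also have "s * 2 ^ j \<le> N j"
    proof -
      have "s * 2 ^ j * 1 \<le> s * 2 ^ j * (6 * a j)" using stage_bounds(5)[OF j'] by (intro mult_le_mono2) linarith
      then show ?thesis unfolding stN_def
        using le_power_tlog[of "2 * clog n + s * 2 ^ j * (6 * a j)"] by linarith
    qed
    finally have "w \<le> r" using lay by simp
    moreover have "clog e \<le> a j" unfolding sta_def by simp
    ultimately show ?thesis using lay by linarith
  qed
  show "samples main_prog 13 (sampler_params n w s \<epsilon> \<delta> m k r) n r D"
    unfolding samples_def
  proof (intro exI[of _ "\<lambda>\<sigma>. gen_out n b s dlt J m k ((!) \<sigma>)"] conjI allI impI)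
    show "D = map_pmf (\<lambda>\<sigma>. gen_out n b s dlt J m k ((!) \<sigma>)) (pmf_of_set {\<sigma>. length \<sigma> = r})"
      unfolding D_def ulist_def ..
    fix \<sigma> :: "bool list" assume \<sigma>: "length \<sigma> = r"
    let ?Z = "n + r + 2"
    define R where "R = fst (init_state (sampler_params n w s \<epsilon> \<delta> m k r) \<sigma>)"
    define M where "M = snd (init_state (sampler_params n w s \<epsilon> \<delta> m k r) \<sigma>)"
    have i: "init_state (sampler_params n w s \<epsilon> \<delta> m k r) \<sigma> = (R, M)" unfolding R_def M_def by simp
    have R: "R 0 = n" "R 1 = w" "R 2 = s" "R 3 = e" "R 4 = dlt" "R 5 = m" "R 6 = k" "R 7 = r"
      "\<And>j. 8 \<le> j \<Longrightarrow> R j = 0"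
      unfolding R_def init_state_def sampler_params_def e dlt by (simp_all add: nth_Cons')
    have M: "\<forall>j<r. M j = of_bool (\<sigma> ! j)" "\<forall>i<n. M (r + i) = 0"
      unfolding M_def init_state_def using \<sigma> by simp_all
    have "r \<le> ?Z" "n \<le> ?Z" "2 \<le> ?Z" "0 < J \<Longrightarrow> w \<le> ?Z" "0 < J \<Longrightarrow> clog e \<le> ?Z"
      using w_r by linarith+
    from runs_main_prog[OF s R M r' this(1,2,4,5,3)]
    obtain R' M' where *: "runs main_prog (R, M) (200 * ?Z ^ 5) (R', M')"
      "output_set n (R', M') = gen_out n b s dlt J m k ((!) \<sigma>)" by blast
    then obtain t where t: "t \<le> 200 * ?Z ^ 5" "exec main_prog (R, M) t (R', M')" unfolding runs_def by blast
    \<comment> \<open>The constant moves into the exponent: the base is at least 2, 200 is at most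
      \<open>2 ^ 8\<close>, and 13 = 5 + 8.\<close>
    have "200 \<le> (2::nat) ^ 8" by simp
    also have "\<dots> \<le> ?Z ^ 8" by (rule power_mono) auto
    finally have "200 * ?Z ^ 5 \<le> ?Z ^ 8 * ?Z ^ 5" by (rule mult_le_mono1)
    also have "\<dots> = ?Z ^ 13" by (simp flip: power_add)
    finally have "t \<le> ?Z ^ 13" using t(1) by linarith
    then show "\<exists>t st. exec main_prog (init_state (sampler_params n w s \<epsilon> \<delta> m k r) \<sigma>) t st \<and>
      t \<le> ?Z ^ 13 \<and> gen_out n b s dlt J m k ((!) \<sigma>) = output_set n st"
      unfolding i using t(2) *(2) by metis
  qed
qed

end

theorem theorem5p3:
  shows "\<exists>C::real. C > 0 \<and> (\<forall>A::real. A > 0 \<longrightarrow>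
    (\<exists>(K::real) (P::com) (c::nat). K > 0 \<and>
      (\<forall>(n::nat) (w::nat) (s::nat) (\<epsilon>::real) (\<delta>::real).
        n > 0 \<and> w > 0 \<and> s > 0 \<and> 0 < \<epsilon> \<and> \<epsilon> \<le> 1 / 2 \<and> \<delta> > 0 \<and> 0 \<le> seed_bound n w s \<epsilon> \<delta> \<longrightarrow>
        (\<exists>r::nat. real r \<le> K * seed_bound n w s \<epsilon> \<delta> \<and>
          (\<forall>(p::real) (m::nat) (k::nat).
            admissible_prob A (seed_bound n w s \<epsilon> \<delta>) p m k \<and>
            p \<le> \<delta> / (real w * log 2 (1 / \<epsilon>)) powr (C * log 2 (real w)) \<longrightarrow>
            (\<exists>D :: nat set pmf.
              set_pmf D \<subseteq> Pow {..<n} \<and>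
              p_regular n p D \<and>
              samples P c (sampler_params n w s \<epsilon> \<delta> m k r) n r D \<and>
              (\<forall>i<n. p_biased D p (\<lambda>L. i \<in> L)) \<and>
              (\<forall>F. width_dnf {..<n} w F \<longrightarrow>
                measure_pmf.prob (random_restriction n D)
                  {\<rho>. \<not> has_dnf_sandwich (live n \<rho>) \<epsilon> s (restrict_fun n \<rho> (eval_dnf F))}
                < \<epsilon> + \<delta> powr (real s / 4))))))))"
proof (rule exI[of _ 400], intro conjI allI impI)
  fix A :: real assume A: "A > 0"
  show "\<exists>(K::real) (P::com) (c::nat). K > 0 \<and>
      (\<forall>(n::nat) (w::nat) (s::nat) (\<epsilon>::real) (\<delta>::real).
        n > 0 \<and> w > 0 \<and> s > 0 \<and> 0 < \<epsilon> \<and> \<epsilon> \<le> 1 / 2 \<and> \<delta> > 0 \<and> 0 \<le> seed_bound n w s \<epsilon> \<delta> \<longrightarrow>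
        (\<exists>r::nat. real r \<le> K * seed_bound n w s \<epsilon> \<delta> \<and>
          (\<forall>(p::real) (m::nat) (k::nat).
            admissible_prob A (seed_bound n w s \<epsilon> \<delta>) p m k \<and>
            p \<le> \<delta> / (real w * log 2 (1 / \<epsilon>)) powr (400 * log 2 (real w)) \<longrightarrow>
            (\<exists>D :: nat set pmf.
              set_pmf D \<subseteq> Pow {..<n} \<and>
              p_regular n p D \<and>
              samples P c (sampler_params n w s \<epsilon> \<delta> m k r) n r D \<and>
              (\<forall>i<n. p_biased D p (\<lambda>L. i \<in> L)) \<and>
              (\<forall>F. width_dnf {..<n} w F \<longrightarrow>
                measure_pmf.prob (random_restriction n D)
                  {\<rho>. \<not> has_dnf_sandwich (live n \<rho>) \<epsilon> s (restrict_fun n \<rho> (eval_dnf F))}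
                < \<epsilon> + \<delta> powr (real s / 4))))))"
  \<comment> \<open>A pays for the bits of the coin and 15000 for the stages.\<close>
  proof (rule exI[of _ "A + 15000"], rule exI[of _ main_prog], rule exI[of _ 13], intro conjI allI impI)
    fix n w s :: nat and \<epsilon> \<delta> :: real
    assume *: "n > 0 \<and> w > 0 \<and> s > 0 \<and> 0 < \<epsilon> \<and> \<epsilon> \<le> 1 / 2 \<and> \<delta> > 0 \<and> 0 \<le> seed_bound n w s \<epsilon> \<delta>"
    define e where "e = nat \<lceil>log 2 (1 / \<epsilon>)\<rceil>"
    define dlt where "dlt = nat \<lceil>log 2 (1 / \<delta>)\<rceil>"
    interpret parameters n w s e dlt \<epsilon> \<delta> by unfold_locales (use * e_def dlt_def in auto)
    let ?B = "seed_bound n w s \<epsilon> \<delta>"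
    have B: "0 \<le> ?B" "0 \<le> A * ?B" using * A by simp_all
    \<comment> \<open>The seed length is fixed before p is given, so it reserves room for the
      largest admissible k.\<close>
    define r where "r = pos J + nat \<lfloor>A * ?B\<rfloor>"
    have "real (nat \<lfloor>A * ?B\<rfloor>) \<le> A * ?B" using B by simp
    then have r: "real r \<le> (A + 15000) * ?B"
      unfolding r_def using pos_le[OF B(1)] by (simp add: distrib_right)
    show "\<exists>r::nat. real r \<le> (A + 15000) * ?B \<and>
          (\<forall>(p::real) (m::nat) (k::nat). admissible_prob A ?B p m k \<and>
            p \<le> \<delta> / (real w * log 2 (1 / \<epsilon>)) powr (400 * log 2 (real w)) \<longrightarrow>
            (\<exists>D :: nat set pmf. set_pmf D \<subseteq> Pow {..<n} \<and> p_regular n p D \<and>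
              samples main_prog 13 (sampler_params n w s \<epsilon> \<delta> m k r) n r D \<and>
              (\<forall>i<n. p_biased D p (\<lambda>L. i \<in> L)) \<and>
              (\<forall>F. width_dnf {..<n} w F \<longrightarrow>
                measure_pmf.prob (random_restriction n D)
                  {\<rho>. \<not> has_dnf_sandwich (live n \<rho>) \<epsilon> s (restrict_fun n \<rho> (eval_dnf F))}
                < \<epsilon> + \<delta> powr (real s / 4))))"
    proof (rule exI[of _ r], intro conjI allI impI r)
      fix p :: real and m k :: nat
      assume **: "admissible_prob A ?B p m k \<and>
        p \<le> \<delta> / (real w * log 2 (1 / \<epsilon>)) powr (400 * log 2 (real w))"
      then have p: "p = real m / 2 ^ k" "p \<le> 1" "p \<le> \<delta> / (real w * log 2 (1 / \<epsilon>)) powr (400 * log 2 (real w))"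
        and k: "real k \<le> A * ?B" unfolding admissible_prob_def by blast+
      have "pos J + k \<le> r" unfolding r_def using k by (simp add: le_nat_floor)
      note D = sampler[OF p this]
      show "\<exists>D :: nat set pmf. set_pmf D \<subseteq> Pow {..<n} \<and> p_regular n p D \<and>
              samples main_prog 13 (sampler_params n w s \<epsilon> \<delta> m k r) n r D \<and>
              (\<forall>i<n. p_biased D p (\<lambda>L. i \<in> L)) \<and>
              (\<forall>F. width_dnf {..<n} w F \<longrightarrow>
                measure_pmf.prob (random_restriction n D)
                  {\<rho>. \<not> has_dnf_sandwich (live n \<rho>) \<epsilon> s (restrict_fun n \<rho> (eval_dnf F))}
                < \<epsilon> + \<delta> powr (real s / 4))"
        using D(1) D(2)[unfolded p_regular_def] D(2-4) unfolding p_biased_def by blast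
    qed
  qed (use A in simp)
qed simp

end
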